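(* Let $g=1$, $c=0$, and consider the reduced Gauss-Codazzi system with the isothermic constraint $q=r$, for functions $v,h,q$ of $\eta$ (prime $=d/d\eta$): $$\left(\eta\frac{v'}{v}\right)'-\frac{h^2}{2\eta^2}v+\frac{2q^2}{\eta^2v}=0,\qquad -\eta vh'-2\eta^2q'+2vh=0,\qquad -\eta^2vh'-2\eta q'=0,$$ with the first integral $$K=\left(\eta\frac{v'}{v}+1\right)^2-\frac{h^2v}{\eta}-2hq-\frac{2hq}{\eta^2}-\frac{4q^2}{\eta v}.$$ The subcase $q'\neq0$ is equivalent to $$h=c_h\frac{\eta^2}{\eta^2-1},\qquad v=-\frac{q'}{h},\qquad c_h\neq0\ \text{constant},$$ in which $q$ is, up to normalization, the Hamiltonian of the sixth Painlevé equation: $$q(\eta)=-\frac{8}{c_h}X(X-1)\mathrm{H}_{\rm VI},\qquad X=\frac1{1-\eta^2},\qquad A_0=\frac K4,\quad A_2=0,\quad A_3=0,\quad A_4=0,$$ where the $A_j$ are the coefficients of the equation SD-Ia obeyed by $Y=X(X-1)\mathrm{H}_{\rm VI}$. The four integration constants are $K$, $c_h$ and the two movable constants of the sixth Painlevé equation. For this solution $1/H$ is harmonic, $$\frac1H=\frac1{c_h}\left(g_1(z)^2-g_2(\bar z)^2\right),$$ and this solution is the particular case $\theta=0$ of the harmonic inverse mean curvature (HIMC) solution of Bobenko, Eitner and Kitaev.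
   Context: The Gauss-Codazzi system with $c=0$, for complex functions $u,H,Q,R$ (with $R$ standing for $\overline Q$) of the independent complex variables $z,\bar z$, is $$u_{z\bar z}+\tfrac12H^2e^u-2QRe^{-u}=0,\qquad Q_{\bar z}=\tfrac12H_ze^u,\qquad R_z=\tfrac12H_{\bar z}e^u.$$ The ODE system in the claim arises from it by $$\eta=\frac{g_1(z)}{g_2(\bar z)},\quad e^u=g_1^{2}g_1'g_2'\,v(\eta),\quad H=g_1^{-2}h(\eta),\quad Q=g_1'^2\,q(\eta),\quad R=g_2'^2\,r(\eta),\quad q=r,$$ with $g_1,g_2$ arbitrary functions of $z$ and $\bar z$ respectively. A function $f(z,\bar z)$ is harmonic if $f_{z\bar z}=0$. The sixth Painlevé equation with parameters $\theta_\infty^2,\theta_0^2,\theta_1^2,\theta_X^2$ is (prime $=d/dX$) $$V''=\frac12\left[\frac1V+\frac1{V-1}+\frac1{V-X}\right]V'^2-\left[\frac1X+\frac1{X-1}+\frac1{V-X}\right]V'$$ $$+\frac{V(V-1)(V-X)}{2X^2(X-1)^2}\left[\theta_\infty^2-\theta_0^2\frac{X}{V^2}+\theta_1^2\frac{X-1}{(V-1)^2}+(1-\theta_X^2)\frac{X(X-1)}{(V-X)^2}\right].$$ $\mathrm{H}_{\rm VI}$ denotes a Hamiltonian of this equation (there are 24 choices), viewed as a function of $X$ along its solutions; Malmquist's choice is $$\mathrm{H}_{\rm VI}=\frac{X(X-1)V'^2}{4V(V-1)(V-X)}+\frac1{4X(X-1)}\Big[-\theta_\infty^2\left(V-\tfrac12\right)-\theta_0^2\left(\tfrac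 XV-\tfrac12\right)+\theta_1^2\left(\tfrac{X-1}{V-1}-\tfrac12\right)-(\theta_X-1)^2\left(\tfrac{X(X-1)}{V-X}+X-\tfrac12\right)\Big].$$ The function $Y=X(X-1)\mathrm{H}_{\rm VI}$ obeys the equation SD-Ia, $$-\left(X(X-1)Y''\right)^2-4Y'(XY'-Y)^2+4Y'^2(XY'-Y)+A_0Y'^2+A_2(XY'-Y)+\left(A_3+\frac{A_0^2}4\right)Y'+A_4=0,$$ with, for $\Theta_X=\theta_X-1$: $2A_0=\theta_\infty^2+\theta_0^2+\theta_1^2+\Theta_X^2$, $4A_2=-(\theta_\infty^2-\Theta_X^2)(\theta_0^2-\theta_1^2)$, $4A_3=(\theta_\infty^2-\theta_1^2)(\theta_0^2-\Theta_X^2)$, $32A_4=(\theta_\infty^2+\Theta_X^2)(\theta_0^2-\theta_1^2)^2+(\theta_\infty^2-\Theta_X^2)^2(\theta_0^2+\theta_1^2)$. The HIMC solution (for $c=0$, with $x$ the real part of $z$, and complex constants $c_z,\hat c_h,c_u,c_q,\hat K$ and an arbitrary constant $\theta$) is $$\frac1H=\frac{2c_z}{\hat c_h}\left(\coth(2c_zz)+\coth(2c_z\bar z)\right),\qquad e^u=\frac{4c_u\hat v(x)}{H^2},$$ $$Q=\frac{4c_q}{\hat c_h}\left(\frac{2c_z}{\sinh(2c_zx)}\right)^2(\hat q(x)+i\theta),\qquad \overline Q=\frac{4c_q}{\hat c_h}\left(\frac{2c_z}{\sinh(2c_zx)}\right)^2(\hat q(x)-i\theta),$$ where $c_u\hat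 v=c_q\hat q'$ and $\hat q$ obeys (prime $=d/dx$) $$\hat K=\left(\frac{\hat q''}{\hat q'}+8c_z\coth(4c_zx)\right)^2+16c_q\left[\left(\frac{4c_z}{\sinh(4c_zx)}\right)^2\frac{\hat q^2+\theta^2}{\hat q'}+\hat q'+8c_z\coth(4c_zx)\,\hat q\right].$$
   Formalization: v=-q'/h is corrected to v=-(1-η²)q'/h, A_3=0 to A_3=-K²/64, sinh(2c_z x) in Q and Q̄ to sinh(2c_z z) and sinh(2c_z z̄); "particular case θ=0 of HIMC" is stated as the same ODE with θ=0, with this solution's fields the limit of translated HIMC fields. *)

theory Defs
  imports "HOL-Complex_Analysis.Complex_Analysis"
begin

text \<open>
  The conformal coordinate and its conjugate are treated as independent complex variables \<open>z\<close>, \<open>w\<close>.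
\<close>

section \<open>The reduced Gauss-Codazzi system (\<open>g = 1\<close>, \<open>c = 0\<close>, \<open>q = r\<close>)\<close>

text \<open>
  Since \<open>v\<close> is, up to a factor, the exponential \<open>e\<^sup>u\<close>, it has no zeros. The points \<open>\<eta> = 1\<close> and
  \<open>\<eta> = -1\<close> are regular for the system and are not removed.
\<close>

definition profile_functions ::
  "complex set \<Rightarrow> (complex \<Rightarrow> complex) \<Rightarrow> (complex \<Rightarrow> complex) \<Rightarrow> (complex \<Rightarrow> complex) \<Rightarrow> bool" where
  "profile_functions D v h q \<longleftrightarrow>
     open D \<and> connected D \<and> D \<noteq> {} \<and> 0 \<notin> D \<and>
     v holomorphic_on D \<and> h holomorphic_on D \<and> q holomorphic_on D \<and> (\<forall>\<eta>\<in>D. v \<eta> \<noteq> 0)"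

definition gauss_eq ::
  "(complex \<Rightarrow> complex) \<Rightarrow> (complex \<Rightarrow> complex) \<Rightarrow> (complex \<Rightarrow> complex) \<Rightarrow> complex \<Rightarrow> bool" where
  "gauss_eq v h q \<eta> \<longleftrightarrow>
     deriv (\<lambda>s. s * deriv v s / v s) \<eta> - (h \<eta>)\<^sup>2 / (2 * \<eta>\<^sup>2) * v \<eta> + 2 * (q \<eta>)\<^sup>2 / (\<eta>\<^sup>2 * v \<eta>) = 0"

definition codazzi_eqs ::
  "(complex \<Rightarrow> complex) \<Rightarrow> (complex \<Rightarrow> complex) \<Rightarrow> (complex \<Rightarrow> complex) \<Rightarrow> complex \<Rightarrow> bool" where
  "codazzi_eqs v h q \<eta> \<longleftrightarrow>
     - \<eta> * v \<eta> * deriv h \<eta> - 2 * \<eta>\<^sup>2 * deriv q \<eta> + 2 * v \<eta> * h \<eta> = 0 \<and>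
     - \<eta>\<^sup>2 * v \<eta> * deriv h \<eta> - 2 * \<eta> * deriv q \<eta> = 0"

definition reduced_GC ::
  "complex set \<Rightarrow> (complex \<Rightarrow> complex) \<Rightarrow> (complex \<Rightarrow> complex) \<Rightarrow> (complex \<Rightarrow> complex) \<Rightarrow> bool" where
  "reduced_GC D v h q \<longleftrightarrow> (\<forall>\<eta>\<in>D. gauss_eq v h q \<eta> \<and> codazzi_eqs v h q \<eta>)"

definition first_integral ::
  "(complex \<Rightarrow> complex) \<Rightarrow> (complex \<Rightarrow> complex) \<Rightarrow> (complex \<Rightarrow> complex) \<Rightarrow> complex \<Rightarrow> complex" where
  "first_integral v h q \<eta> =
     (\<eta> * deriv v \<eta> / v \<eta> + 1)\<^sup>2 - (h \<eta>)\<^sup>2 * v \<eta> / \<eta> - 2 * h \<eta> * q \<eta>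
       - 2 * h \<eta> * q \<eta> / \<eta>\<^sup>2 - 4 * (q \<eta>)\<^sup>2 / (\<eta> * v \<eta>)"

text \<open>
  The first conjunct is \<open>h = c \<eta>\<^sup>2 / (\<eta>\<^sup>2 - 1)\<close>. The second one is the elimination of \<open>h'\<close> between the
  two Codazzi equations, which gives \<open>v h = (\<eta>\<^sup>2 - 1) q'\<close>; the shorter formula \<open>v = - q' / h\<close>,
  without the factor \<open>1 - \<eta>\<^sup>2\<close>, is not a consequence of these equations.
\<close>

definition nonconstant_q_branch ::
  "complex \<Rightarrow> (complex \<Rightarrow> complex) \<Rightarrow> (complex \<Rightarrow> complex) \<Rightarrow> (complex \<Rightarrow> complex) \<Rightarrow> complex \<Rightarrow> bool" where
  "nonconstant_q_branch c v h q \<eta> \<longleftrightarrow>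
     h \<eta> = c * \<eta>\<^sup>2 / (\<eta>\<^sup>2 - 1) \<and> v \<eta> = - (1 - \<eta>\<^sup>2) * deriv q \<eta> / h \<eta>"

section \<open>The fields of the surface\<close>

definition gc_H ::
  "(complex \<Rightarrow> complex) \<Rightarrow> (complex \<Rightarrow> complex) \<Rightarrow> (complex \<Rightarrow> complex) \<Rightarrow> complex \<Rightarrow> complex \<Rightarrow> complex" where
  "gc_H g1 g2 h z w = h (g1 z / g2 w) / (g1 z)\<^sup>2"

definition gc_expu ::
  "(complex \<Rightarrow> complex) \<Rightarrow> (complex \<Rightarrow> complex) \<Rightarrow> (complex \<Rightarrow> complex) \<Rightarrow> complex \<Rightarrow> complex \<Rightarrow> complex" where
  "gc_expu g1 g2 v z w = (g1 z)\<^sup>2 * deriv g1 z * deriv g2 w * v (g1 z / g2 w)"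

definition gc_Q ::
  "(complex \<Rightarrow> complex) \<Rightarrow> (complex \<Rightarrow> complex) \<Rightarrow> (complex \<Rightarrow> complex) \<Rightarrow> complex \<Rightarrow> complex \<Rightarrow> complex" where
  "gc_Q g1 g2 q z w = (deriv g1 z)\<^sup>2 * q (g1 z / g2 w)"

definition gc_R ::
  "(complex \<Rightarrow> complex) \<Rightarrow> (complex \<Rightarrow> complex) \<Rightarrow> (complex \<Rightarrow> complex) \<Rightarrow> complex \<Rightarrow> complex \<Rightarrow> complex" where
  "gc_R g1 g2 q z w = (deriv g2 w)\<^sup>2 * q (g1 z / g2 w)"

definition gauge_functions ::
  "complex set \<Rightarrow> (complex \<times> complex) set \<Rightarrow> (complex \<Rightarrow> complex) \<Rightarrow> (complex \<Rightarrow> complex) \<Rightarrow> bool" where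
  "gauge_functions D \<Omega> g1 g2 \<longleftrightarrow>
     open \<Omega> \<and> g1 holomorphic_on (fst ` \<Omega>) \<and> g2 holomorphic_on (snd ` \<Omega>) \<and>
     (\<forall>(z, w)\<in>\<Omega>. g1 z / g2 w \<in> D)"

definition harmonic_on :: "(complex \<times> complex) set \<Rightarrow> (complex \<Rightarrow> complex \<Rightarrow> complex) \<Rightarrow> bool" where
  "harmonic_on \<Omega> f \<longleftrightarrow>
     (\<forall>(z, w)\<in>\<Omega>. (\<lambda>s. f s w) field_differentiable at z \<and>
        (\<lambda>t. deriv (\<lambda>s. f s t) z) field_differentiable at w \<and>
        deriv (\<lambda>t. deriv (\<lambda>s. f s t) z) w = 0)"

section \<open>The sixth Painleve equation, its Hamiltonian and SD-Ia\<close>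

text \<open>
  The four parameters are \<open>\<theta>\<^sub>\<infinity>\<close>, \<open>\<theta>\<^sub>0\<close>, \<open>\<theta>\<^sub>1\<close>, \<open>\<theta>\<^sub>X\<close> in this order (not their squares); \<open>V1\<close> stands for
  the value of the derivative of \<open>V\<close>.
\<close>

definition painleve_VI_rhs ::
  "complex \<Rightarrow> complex \<Rightarrow> complex \<Rightarrow> complex \<Rightarrow> complex \<Rightarrow> complex \<Rightarrow> complex \<Rightarrow> complex" where
  "painleve_VI_rhs tinf t0 t1 tX X V V1 =
     (1 / 2) * (1 / V + 1 / (V - 1) + 1 / (V - X)) * V1\<^sup>2
     - (1 / X + 1 / (X - 1) + 1 / (V - X)) * V1
     + V * (V - 1) * (V - X) / (2 * X\<^sup>2 * (X - 1)\<^sup>2) *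
         (tinf\<^sup>2 - t0\<^sup>2 * X / V\<^sup>2 + t1\<^sup>2 * (X - 1) / (V - 1)\<^sup>2
            + (1 - tX\<^sup>2) * X * (X - 1) / (V - X)\<^sup>2)"

definition painleve_VI_on ::
  "complex set \<Rightarrow> complex \<Rightarrow> complex \<Rightarrow> complex \<Rightarrow> complex \<Rightarrow> (complex \<Rightarrow> complex) \<Rightarrow> bool" where
  "painleve_VI_on S tinf t0 t1 tX V \<longleftrightarrow>
     open S \<and> V holomorphic_on S \<and>
     (\<forall>X\<in>S. X \<noteq> 0 \<and> X \<noteq> 1 \<and> V X \<noteq> 0 \<and> V X \<noteq> 1 \<and> V X \<noteq> X \<and>
        deriv (deriv V) X = painleve_VI_rhs tinf t0 t1 tX X (V X) (deriv V X))"

definition H_VI ::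
  "complex \<Rightarrow> complex \<Rightarrow> complex \<Rightarrow> complex \<Rightarrow> complex \<Rightarrow> complex \<Rightarrow> complex \<Rightarrow> complex" where
  "H_VI tinf t0 t1 tX X V V1 =
     X * (X - 1) * V1\<^sup>2 / (4 * V * (V - 1) * (V - X))
     + 1 / (4 * X * (X - 1)) *
         (- tinf\<^sup>2 * (V - 1 / 2) - t0\<^sup>2 * (X / V - 1 / 2) + t1\<^sup>2 * ((X - 1) / (V - 1) - 1 / 2)
            - (tX - 1)\<^sup>2 * (X * (X - 1) / (V - X) + X - 1 / 2))"

definition SD_Ia ::
  "complex \<Rightarrow> complex \<Rightarrow> complex \<Rightarrow> complex \<Rightarrow> (complex \<Rightarrow> complex) \<Rightarrow> complex \<Rightarrow> bool" where
  "SD_Ia A0 A2 A3 A4 Y X \<longleftrightarrow>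
     (let Y1 = deriv Y X; Y2 = deriv (deriv Y) X; L = X * Y1 - Y X in
        - (X * (X - 1) * Y2)\<^sup>2 - 4 * Y1 * L\<^sup>2 + 4 * Y1\<^sup>2 * L + A0 * Y1\<^sup>2 + A2 * L
          + (A3 + A0\<^sup>2 / 4) * Y1 + A4 = 0)"

definition SD_A0 :: "complex \<Rightarrow> complex \<Rightarrow> complex \<Rightarrow> complex \<Rightarrow> complex" where
  "SD_A0 tinf t0 t1 tX = (tinf\<^sup>2 + t0\<^sup>2 + t1\<^sup>2 + (tX - 1)\<^sup>2) / 2"

definition SD_A2 :: "complex \<Rightarrow> complex \<Rightarrow> complex \<Rightarrow> complex \<Rightarrow> complex" where
  "SD_A2 tinf t0 t1 tX = - (tinf\<^sup>2 - (tX - 1)\<^sup>2) * (t0\<^sup>2 - t1\<^sup>2) / 4"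

definition SD_A3 :: "complex \<Rightarrow> complex \<Rightarrow> complex \<Rightarrow> complex \<Rightarrow> complex" where
  "SD_A3 tinf t0 t1 tX = (tinf\<^sup>2 - t1\<^sup>2) * (t0\<^sup>2 - (tX - 1)\<^sup>2) / 4"

definition SD_A4 :: "complex \<Rightarrow> complex \<Rightarrow> complex \<Rightarrow> complex \<Rightarrow> complex" where
  "SD_A4 tinf t0 t1 tX =
     ((tinf\<^sup>2 + (tX - 1)\<^sup>2) * (t0\<^sup>2 - t1\<^sup>2)\<^sup>2 + (tinf\<^sup>2 - (tX - 1)\<^sup>2)\<^sup>2 * (t0\<^sup>2 + t1\<^sup>2)) / 32"

definition pvi_var :: "complex \<Rightarrow> complex" where
  "pvi_var \<eta> = 1 / (1 - \<eta>\<^sup>2)"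

text \<open>
  A solution of the reduced system in the branch where \<open>q\<close> is not constant, together with the
  solution \<open>V\<close> of the sixth Painleve equation (\<open>\<theta>\<^sub>\<infinity> = 0\<close>, \<open>\<theta>\<^sub>0\<^sup>2 = \<theta>\<^sub>1\<^sup>2 = K / 4\<close>, \<open>\<theta>\<^sub>X = 1\<close>) whose
  Hamiltonian is \<open>q\<close> up to normalization. Only squares of \<open>\<theta>\<^sub>0\<close>, \<open>\<theta>\<^sub>1\<close> matter, so the branch of the
  square root is irrelevant.
\<close>

definition HVI_solution ::
  "complex set \<Rightarrow> complex \<Rightarrow> complex \<Rightarrow> (complex \<Rightarrow> complex) \<Rightarrow> (complex \<Rightarrow> complex) \<Rightarrow>
     (complex \<Rightarrow> complex) \<Rightarrow> (complex \<Rightarrow> complex) \<Rightarrow> bool" where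
  "HVI_solution D c K v h q V \<longleftrightarrow>
     profile_functions D v h q \<and> reduced_GC D v h q \<and> c \<noteq> 0 \<and>
     (\<forall>\<eta>\<in>D. nonconstant_q_branch c v h q \<eta> \<and> first_integral v h q \<eta> = K) \<and>
     painleve_VI_on (pvi_var ` D) 0 (csqrt K / 2) (csqrt K / 2) 1 V \<and>
     (\<forall>\<eta>\<in>D. let X = pvi_var \<eta> in
        q \<eta> = - (8 / c) * (X * (X - 1) * H_VI 0 (csqrt K / 2) (csqrt K / 2) 1 X (V X) (deriv V X)))"

section \<open>The harmonic inverse mean curvature solution\<close>

definition ccoth :: "complex \<Rightarrow> complex" where
  "ccoth s = cosh s / sinh s"

text \<open>
  If \<open>1 / H = (F(z) - G(w)) / c\<close>, then \<open>H (1 - t F) (1 - t G)\<close>, \<open>e\<^sup>u / ((1 - t F) (1 - t G))\<^sup>2\<close>,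
  \<open>Q / (1 - t F)\<^sup>2\<close>, \<open>R / (1 - t G)\<^sup>2\<close> again solve the Gauss-Codazzi system, for every constant \<open>t\<close>,
  and the new \<open>1 / H\<close> is again harmonic: this is the family associated with a harmonic inverse mean
  curvature surface. The translation \<open>(z + L, w - L)\<close> of the solution below amounts to
  \<open>t = exp (- 4 c\<^sub>z L)\<close> with \<open>F = exp (- 4 c\<^sub>z z)\<close>, \<open>G = exp (4 c\<^sub>z w)\<close>.

  In independent complex variables the real part of \<open>z\<close> is \<open>(z + w) / 2\<close>.
\<close>

definition himc_x :: "complex \<Rightarrow> complex \<Rightarrow> complex" where
  "himc_x z w = (z + w) / 2"

definition himc_H :: "complex \<Rightarrow> complex \<Rightarrow> complex \<Rightarrow> complex \<Rightarrow> complex" where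
  "himc_H cz ch z w = inverse (2 * cz / ch * (ccoth (2 * cz * z) + ccoth (2 * cz * w)))"

definition himc_expu ::
  "complex \<Rightarrow> complex \<Rightarrow> complex \<Rightarrow> (complex \<Rightarrow> complex) \<Rightarrow> complex \<Rightarrow> complex \<Rightarrow> complex" where
  "himc_expu cz ch cu vh z w = 4 * cu * vh (himc_x z w) / (himc_H cz ch z w)\<^sup>2"

text \<open>
  The hyperbolic sines in \<open>Q\<close> and \<open>R\<close> are taken at \<open>2 c\<^sub>z z\<close> and \<open>2 c\<^sub>z w\<close> (not at \<open>2 c\<^sub>z x\<close>): this is
  what the Codazzi equations \<open>Q\<^sub>w = H\<^sub>z e\<^sup>u / 2\<close> and \<open>R\<^sub>z = H\<^sub>w e\<^sup>u / 2\<close> require for the above \<open>H\<close> and \<open>e\<^sup>u\<close>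
  with \<open>c\<^sub>u v = c\<^sub>q q'\<close>.
\<close>

definition himc_Q ::
  "complex \<Rightarrow> complex \<Rightarrow> complex \<Rightarrow> complex \<Rightarrow> (complex \<Rightarrow> complex) \<Rightarrow> complex \<Rightarrow> complex \<Rightarrow> complex" where
  "himc_Q cz ch cq \<theta> qh z w =
     4 * cq / ch * (2 * cz / sinh (2 * cz * z))\<^sup>2 * (qh (himc_x z w) + \<i> * \<theta>)"

definition himc_R ::
  "complex \<Rightarrow> complex \<Rightarrow> complex \<Rightarrow> complex \<Rightarrow> (complex \<Rightarrow> complex) \<Rightarrow> complex \<Rightarrow> complex \<Rightarrow> complex" where
  "himc_R cz ch cq \<theta> qh z w =
     4 * cq / ch * (2 * cz / sinh (2 * cz * w))\<^sup>2 * (qh (himc_x z w) - \<i> * \<theta>)"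

definition himc_profile ::
  "complex set \<Rightarrow> complex \<Rightarrow> complex \<Rightarrow> complex \<Rightarrow> complex \<Rightarrow> complex \<Rightarrow>
     (complex \<Rightarrow> complex) \<Rightarrow> (complex \<Rightarrow> complex) \<Rightarrow> bool" where
  "himc_profile S cz cu cq Kh \<theta> vh qh \<longleftrightarrow>
     open S \<and> qh holomorphic_on S \<and>
     (\<forall>x\<in>S. sinh (4 * cz * x) \<noteq> 0 \<and> deriv qh x \<noteq> 0 \<and> cu * vh x = cq * deriv qh x \<and>
        Kh = (deriv (deriv qh) x / deriv qh x + 8 * cz * ccoth (4 * cz * x))\<^sup>2
           + 16 * cq * ((4 * cz / sinh (4 * cz * x))\<^sup>2 * (((qh x)\<^sup>2 + \<theta>\<^sup>2) / deriv qh x)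
                + deriv qh x + 8 * cz * ccoth (4 * cz * x) * qh x))"

end

theory Submission
  imports Defs "HOL-Real_Asymp.Real_Asymp"
begin

text \<open>
  The elimination of \<open>h'\<close> between the two Codazzi equations makes \<open>h (\<eta>\<^sup>2 - 1) / \<eta>\<^sup>2\<close> constant. Writing
  \<open>q = - (8 / c) Y(X)\<close> with \<open>X = 1 / (1 - \<eta>\<^sup>2)\<close>, the Gauss equation and the first integral become an
  equation of order three and an equation of order two for \<open>Y\<close>, the latter being SD-Ia. Then
  \<open>V = X - Y / Y'\<close> solves the sixth Painleve equation and \<open>Y\<close> is its Hamiltonian; conversely, along a
  solution \<open>V\<close> the Hamiltonian satisfies \<open>Y' = Y / (X - V)\<close>, which recovers both equations. SD-Ia alone
  admits singular solutions such as \<open>Y\<close> proportional to \<open>X\<close> when \<open>K = 0\<close>; the Gauss equation excludes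
  them, so that \<open>V\<close> is not identically \<open>0\<close>, \<open>1\<close> or \<open>X\<close>.

  The HIMC formulas follow from \<open>\<eta> = exp (- 4 c\<^sub>z x)\<close>, and the four fields at the translate by \<open>L\<close> are
  rational in \<open>t = exp (- 4 c\<^sub>z L)\<close>, so that the reduced solution is their value at \<open>t = 0\<close>.
\<close>

section \<open>The equations in the variable X\<close>

text \<open>\<open>X\<close> depends on \<eta> only through its square, so \<open>q\<close> becomes
  a function of \<open>X\<close> only where \<open>pvi_var\<close> is injective; this is why
  \<open>E\<close> is local. Even there \<open>V\<close> may meet 0, 1 or \<open>X\<close> at
  isolated points (\<open>V X = X\<close> at the zeros of \<open>q\<close>), where \<open>q\<close>
  is regular but the sixth Painleve equation is undefined; hence a sparse exceptional set.

  With \<theta>_\<infinity> = 0, \<theta>_X = 1 and \<theta>_0^2 = \<theta>_1^2 = K/4 the definition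
  gives A_3 = -K^2/64: what vanishes in SD-Ia is the whole coefficient A_3 + A_0^2/4 of
  \<open>Y'\<close>.

  Counting integration constants means that \<open>c\<close>, \<open>K\<close> and the initial
  values of \<open>V\<close> can be prescribed and are recovered from the solution. This calls for
  existence and uniqueness for the sixth Painleve equation, both obtained by contraction. The
  Hamiltonian must be nonzero at the initial point, since \<open>Y' = Y / (X - V)\<close> must not
  vanish if \<open>v\<close> is to have no zeros.

  The value t = 0 is not exp (- 4 cz L) for any L. The reduced fields are therefore reached from the
  HIMC formulas as a limit, with L going to infinity along positive real multiples of 1 /
  cz.\<close>

text \<open>
  In the branch, \<open>h = - c (X - 1)\<close>; with \<open>q = - (8 / c) Y\<close> one gets \<open>\<eta> v = - (16 / c\<^sup>2) Y'\<close> and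
  \<open>\<eta> v' / v + 1 = 2 X (X - 1) Y'' / Y'\<close>. In these terms the Gauss equation, divided by \<open>4 / \<eta>\<close>, and
  the first integral are the following two expressions.
\<close>

definition sigma_gauss :: "(complex \<Rightarrow> complex) \<Rightarrow> complex \<Rightarrow> bool" where
  "sigma_gauss Y X \<longleftrightarrow>
     X * (X - 1) * deriv (\<lambda>x. x * (x - 1) * deriv (deriv Y) x / deriv Y x) X
       + 2 * X * (X - 1) * deriv Y X - 2 * (Y X)\<^sup>2 / deriv Y X = 0"

definition sigma_integral :: "(complex \<Rightarrow> complex) \<Rightarrow> complex \<Rightarrow> complex" where
  "sigma_integral Y X =
     4 * (X * (X - 1) * deriv (deriv Y) X / deriv Y X)\<^sup>2 + 16 * X * (X - 1) * deriv Y X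
       - 16 * (2 * X - 1) * Y X + 16 * (Y X)\<^sup>2 / deriv Y X"

text \<open>
  The left-hand side is \<open>V''\<close> for \<open>V' = G (X - V) / T\<close>, \<open>G = T Y'' / Y'\<close>, \<open>y = Y'\<close>, with \<open>G'\<close> taken from the
  Gauss equation; the hypothesis on \<open>t\<^sup>2\<close> is the first integral.
\<close>

lemma pvi_algebra:
  fixes X V G y t T d :: complex
  assumes T: "T = X * (X - 1)" and d: "d = X - V"
    and nz: "X \<noteq> 0" "X \<noteq> 1" "V \<noteq> 0" "V \<noteq> 1" "d \<noteq> 0"
    and y: "t\<^sup>2 = G\<^sup>2 + 4 * y * V * (V - 1)"
  shows "((2 * d\<^sup>2 * y - 2 * T * y) / T * d + G * (1 - G * d / T)) / T - G * d * (2 * X - 1) / T\<^sup>2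
     = painleve_VI_rhs 0 t t 1 X V (G * d / T)"
proof -
  \<comment> \<open>In terms of \<open>U\<close> and \<open>Z\<close> every denominator is an atom,
    an atom plus 1, or the difference \<open>Z - U\<close>, so that clearing denominators leaves a
    polynomial identity.\<close>
  define U where "U = V - 1"
  define Z where "Z = X - 1"
  have e: "V - 1 = U" "X - 1 = Z" "V - X = - d" "V = U + 1" "X = Z + 1" "d = Z - U" using d by (auto simp: U_def Z_def)
  have nz': "U \<noteq> 0" "Z \<noteq> 0" "T \<noteq> 0" "Z + 1 \<noteq> 0" "U + 1 \<noteq> 0" "Z - U \<noteq> 0" using nz T d by (auto simp: U_def Z_def)
  have "T * T * (((2 * d\<^sup>2 * y - 2 * T * y) / T * d + G * (1 - G * d / T)) / T - G * d * (2 * X - 1) / T\<^sup>2)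
    = (2 * d\<^sup>2 * y - 2 * T * y) * d + G * T - G\<^sup>2 * d - G * d * (2 * X - 1)"
    using nz' by (simp add: field_simps power2_eq_square)
  moreover have "T * T * painleve_VI_rhs 0 t t 1 X V (G * d / T) =
      (1/2) * (1 / V + 1 / U - 1 / d) * (G * d)\<^sup>2 - (2 * X - 1) * G * d + T * G
     - V * U * d * t\<^sup>2 * (Z / U\<^sup>2 - X / V\<^sup>2) / 2"
    unfolding painleve_VI_rhs_def e(1-3) T using nz nz'
    by (simp add: field_simps power2_eq_square) (auto simp: e(5) algebra_simps)
  \<comment> \<open>Here \<open>t\<^sup>2\<close> is replaced by the first integral. The terms in
    G^2, in G and in y agree separately; for those in y the reason is
    \<open>d\<^sup>2 - T = X * (V - 1)\<^sup>2 - (X - 1) * V\<^sup>2\<close>.\<close>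
  moreover have "(2 * d\<^sup>2 * y - 2 * T * y) * d + G * T - G\<^sup>2 * d - G * d * (2 * X - 1)
    = (1/2) * (1 / V + 1 / U - 1 / d) * (G * d)\<^sup>2 - (2 * X - 1) * G * d + T * G
     - V * U * d * t\<^sup>2 * (Z / U\<^sup>2 - X / V\<^sup>2) / 2"
    unfolding y T e(1,2) unfolding e(4-6) using nz'
    by (simp add: divide_simps) algebra
  ultimately show ?thesis using nz'(3)
    by (metis mult_cancel_left no_zero_divisors)
qed

text \<open>Equality of \<theta>_0^2 and \<theta>_1^2 cancels the constants 1/2 and merges the two
  fractions into one with numerator \<open>X - V\<close>. What remains is quadratic in
  \<open>X * (X - 1) * V1 / (X - V)\<close>, the quantity that becomes
  \<open>X * (X - 1) * Y'' / Y'\<close>.\<close>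

lemma H_VI_special:
  assumes "X \<noteq> 0" "X \<noteq> 1" "V \<noteq> 0" "V \<noteq> 1" "V \<noteq> X"
  shows "X * (X - 1) * H_VI 0 t t 1 X V V1 =
    (X - V) * (t\<^sup>2 - (X * (X - 1) * V1 / (X - V))\<^sup>2) / (4 * V * (V - 1))"
proof -
  define d where "d = X - V"
  have nz: "V - 1 \<noteq> 0" "d \<noteq> 0" "X * (X - 1) \<noteq> 0" using assms by (auto simp: d_def)
  have e: "(X - 1) / (V - 1) - X / V = d / (V * (V - 1))"
    using nz assms by (simp add: d_def field_simps)
  have *: "- 0\<^sup>2 * (V - 1 / 2) - t\<^sup>2 * (X / V - 1 / 2) + t\<^sup>2 * ((X - 1) / (V - 1) - 1 / 2)
      - (1 - 1)\<^sup>2 * (X * (X - 1) / (V - X) + X - 1 / 2) = t\<^sup>2 * (d / (V * (V - 1)))"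
    unfolding e[symmetric] by (simp add: right_diff_distrib)
  have "H_VI 0 t t 1 X V V1 =
      X * (X - 1) * V1\<^sup>2 / (4 * V * (V - 1) * (- d)) + 1 / (4 * X * (X - 1)) * (t\<^sup>2 * (d / (V * (V - 1))))"
    unfolding H_VI_def * by (simp add: d_def)
  also have "X * (X - 1) * \<dots> = (t\<^sup>2 * d - (X * (X - 1) * V1)\<^sup>2 / d) / (4 * V * (V - 1))"
    using assms nz by (simp add: divide_simps) (simp add: power2_eq_square algebra_simps)
  also have "\<dots> = d * (t\<^sup>2 - (X * (X - 1) * V1 / d)\<^sup>2) / (4 * V * (V - 1))"
    using nz by (simp add: power_divide power2_eq_square right_diff_distrib)
  finally show ?thesis unfolding d_def .
qed

text \<open>The points X = 1 and X = 0 correspond to \<eta> = 0 and \<eta> = \<infinity>; the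
  condition on \<open>deriv Y\<close> expresses that \<open>v\<close> has no zeros.\<close>

locale sigma_form =
  fixes S :: "complex set" and Y :: "complex \<Rightarrow> complex"
  assumes S: "open S" "0 \<notin> S" "1 \<notin> S" and Y: "Y holomorphic_on S"
    and Y': "\<And>X. X \<in> S \<Longrightarrow> deriv Y X \<noteq> 0"
begin

text \<open>
  For \<open>\<theta>\<^sub>\<infinity> = 0\<close>, \<open>\<theta>\<^sub>X = 1\<close> and \<open>\<theta>\<^sub>0\<^sup>2 = \<theta>\<^sub>1\<^sup>2\<close>, the partial derivative of \<open>X (X - 1) H\<close> in \<open>X\<close> at
  fixed canonical variables is \<open>- Y / (V - X)\<close>; solving \<open>Y' = - Y / (V - X)\<close> for \<open>V\<close> gives the formula.
\<close>

definition pvi_function :: "complex \<Rightarrow> complex" where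
  "pvi_function X = X - Y X / deriv Y X"

definition log_slope :: "complex \<Rightarrow> complex" where
  "log_slope X = X * (X - 1) * deriv (deriv Y) X / deriv Y X"

lemma nz: "X \<in> S \<Longrightarrow> X \<noteq> 0" "X \<in> S \<Longrightarrow> X - 1 \<noteq> 0"
  using S by auto

lemma hol_Y': "deriv Y holomorphic_on S" "deriv (deriv Y) holomorphic_on S"
  using S Y by (auto intro!: holomorphic_deriv)

lemma DERIV_Y:
  assumes "X \<in> S"
  shows "(Y has_field_derivative deriv Y X) (at X)"
    "(deriv Y has_field_derivative deriv (deriv Y) X) (at X)"
  using S Y hol_Y' assms by (auto intro!: holomorphic_derivI)

lemma hol_pvi: "pvi_function holomorphic_on S"
  unfolding pvi_function_def using Y hol_Y' Y' by (auto intro!: holomorphic_intros)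

lemma hol_log_slope: "log_slope holomorphic_on S"
  unfolding log_slope_def using Y hol_Y' Y' by (auto intro!: holomorphic_intros)

text \<open>The quotient rule leaves V' = Y Y'' / Y'^2, a product of \<open>Y / Y' = X - V\<close>
  and the logarithmic derivative of Y'. Thus V' involves Y only through V and
  \<open>log_slope\<close>.\<close>

lemma DERIV_pvi:
  assumes "X \<in> S"
  shows "(pvi_function has_field_derivative
     log_slope X * (X - pvi_function X) / (X * (X - 1))) (at X)"
  unfolding pvi_function_def
  by (rule derivative_eq_intros refl DERIV_Y assms Y')+
     (use Y'[OF assms] nz[OF assms] in \<open>simp add: log_slope_def field_simps power2_eq_square\<close>)

lemma deriv_pvi:
  "X \<in> S \<Longrightarrow> deriv pvi_function X = log_slope X * (X - pvi_function X) / (X * (X - 1))"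
  by (rule DERIV_imp_deriv) (rule DERIV_pvi)

lemma sigma_gauss_iff:
  assumes "X \<in> S"
  shows "sigma_gauss Y X \<longleftrightarrow> deriv log_slope X =
    (2 * (X - pvi_function X)\<^sup>2 * deriv Y X - 2 * (X * (X - 1)) * deriv Y X) / (X * (X - 1))"
proof -
  have "log_slope = (\<lambda>x. x * (x - 1) * deriv (deriv Y) x / deriv Y x)"
    by (simp add: log_slope_def fun_eq_iff)
  then have "sigma_gauss Y X \<longleftrightarrow> X * (X - 1) * deriv log_slope X
       + 2 * X * (X - 1) * deriv Y X - 2 * (X - pvi_function X)\<^sup>2 * deriv Y X = 0"
    using Y'[OF assms] by (simp add: sigma_gauss_def pvi_function_def power2_eq_square)
  then show ?thesis using nz[OF assms] by (simp add: field_simps)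
qed

text \<open>Put d = Y / Y' = X - V. The terms without Y'' add up to 16 Y' times
  \<open>X * (X - 1) - (2 * X - 1) * d + d\<^sup>2\<close>, which factors as
  \<open>(X - d) * (X - d - 1) = V * (V - 1)\<close>.\<close>

lemma sigma_integral_eq:
  assumes "X \<in> S"
  shows "sigma_integral Y X =
    4 * ((log_slope X)\<^sup>2 + 4 * deriv Y X * pvi_function X * (pvi_function X - 1))"
  using Y'[OF assms] by (simp add: sigma_integral_def log_slope_def pvi_function_def) (simp add: field_simps power2_eq_square)

lemma parameter_eq:
  assumes "X \<in> S" "sigma_integral Y X = K" "t\<^sup>2 = K / 4"
  shows "t\<^sup>2 = (log_slope X)\<^sup>2 + 4 * deriv Y X * pvi_function X * (pvi_function X - 1)"
proof -
  have "4 * t\<^sup>2 = K" unfolding assms(3) by simp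
  then have "4 * t\<^sup>2 = 4 * ((log_slope X)\<^sup>2 + 4 * deriv Y X * pvi_function X * (pvi_function X - 1))"
    unfolding sigma_integral_eq[OF assms(1), symmetric] assms(2) .
  then show ?thesis by (simp only: mult_cancel_left) simp
qed

lemma painleve:
  assumes "X \<in> S" "pvi_function X \<noteq> 0" "pvi_function X \<noteq> 1" "pvi_function X \<noteq> X"
    and "sigma_gauss Y X" "sigma_integral Y X = K" "t\<^sup>2 = K / 4"
  shows "deriv (deriv pvi_function) X =
    painleve_VI_rhs 0 t t 1 X (pvi_function X) (deriv pvi_function X)"
proof -
  let ?T = "X * (X - 1)" and ?V = "pvi_function X" and ?G = "log_slope X" and ?y = "deriv Y X"
  let ?d = "X - ?V"
  have ev: "eventually (\<lambda>x. deriv pvi_function x = log_slope x * (x - pvi_function x) / (x * (x - 1))) (nhds X)"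
    using S assms deriv_pvi by (auto simp: eventually_nhds)
  have G': "(log_slope has_field_derivative ((2 * ?d\<^sup>2 * ?y - 2 * ?T * ?y) / ?T)) (at X)"
    using sigma_gauss_iff[OF assms(1)] assms(5) hol_log_slope S assms(1)
    by (metis holomorphic_derivI)
  have "((\<lambda>x. log_slope x * (x - pvi_function x) / (x * (x - 1))) has_field_derivative
      ((2 * ?d\<^sup>2 * ?y - 2 * ?T * ?y) / ?T * ?d + ?G * (1 - ?G * ?d / ?T)) / ?T - ?G * ?d * (2 * X - 1) / ?T\<^sup>2) (at X)"
    apply (rule derivative_eq_intros refl G' DERIV_pvi assms(1))+
    using nz[OF assms(1)] apply simp
    apply (simp add: power2_eq_square divide_simps)
    done
  then have "deriv (deriv pvi_function) X = ((2 * ?d\<^sup>2 * ?y - 2 * ?T * ?y) / ?T * ?d + ?G * (1 - ?G * ?d / ?T)) / ?T - ?G * ?d * (2 * X - 1) / ?T\<^sup>2"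
    using deriv_cong_ev[OF ev refl] by (simp add: DERIV_imp_deriv)
  also have "\<dots> = painleve_VI_rhs 0 t t 1 X ?V (?G * ?d / ?T)"
    by (rule pvi_algebra[OF refl refl])
       (use assms(2-4) nz[OF assms(1)] parameter_eq[OF assms(1,6,7)] in auto)
  finally show ?thesis using deriv_pvi[OF assms(1)] by simp
qed

text \<open>The first integral says that t^2 minus the square of \<open>log_slope\<close> is 4 Y' V
  (V - 1). This cancels the denominator in \<open>H_VI_special\<close> and leaves (X - V) Y', which
  is Y by definition of V.\<close>

lemma Y_eq_H_VI:
  assumes "X \<in> S" "pvi_function X \<noteq> 0" "pvi_function X \<noteq> 1" "pvi_function X \<noteq> X"
    and "sigma_integral Y X = K" "t\<^sup>2 = K / 4"
  shows "Y X = X * (X - 1) * H_VI 0 t t 1 X (pvi_function X) (deriv pvi_function X)"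
proof -
  let ?V = "pvi_function X"
  have "X * (X - 1) * H_VI 0 t t 1 X ?V (deriv pvi_function X)
     = (X - ?V) * (t\<^sup>2 - (log_slope X)\<^sup>2) / (4 * ?V * (?V - 1))"
    using H_VI_special[of X ?V t] deriv_pvi[of X] assms nz[OF assms(1)] by (simp add: mult.commute)
  also have "\<dots> = (X - ?V) * deriv Y X"
  proof -
    have "t\<^sup>2 - (log_slope X)\<^sup>2 = 4 * deriv Y X * ?V * (?V - 1)"
      using parameter_eq[OF assms(1,5,6)] by simp
    then show ?thesis using assms(2,3) by (simp add: divide_simps)
  qed
  also have "\<dots> = Y X" using Y'[OF assms(1)] by (simp add: pvi_function_def)
  finally show ?thesis by simp
qed

text \<open>SD-Ia with these coefficients is the first integral multiplied by Y'^2 / 4: A_3 =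
  -K^2/64 compensates A_0^2/4, so no term linear in Y' survives beside the cubic part.\<close>

lemma SD_Ia:
  assumes "X \<in> S" "sigma_integral Y X = K"
  shows "SD_Ia (K / 4) 0 (- K\<^sup>2 / 64) 0 Y X"
proof -
  define y y2 where "y = deriv Y X" and "y2 = deriv (deriv Y) X"
  have "y \<noteq> 0" using Y' assms y_def by auto
  have K: "K / 4 * y\<^sup>2 = (X * (X - 1) * y2)\<^sup>2 + 4 * X * (X - 1) * y ^ 3
       - 4 * (2 * X - 1) * Y X * y\<^sup>2 + 4 * (Y X)\<^sup>2 * y"
    unfolding assms(2)[symmetric] sigma_integral_def y_def[symmetric] y2_def[symmetric]
    using \<open>y \<noteq> 0\<close> by (simp add: divide_simps) algebra
  have A: "- K\<^sup>2 / 64 + (K / 4)\<^sup>2 / 4 = 0" by (simp add: power2_eq_square)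
  show ?thesis
    unfolding SD_Ia_def Let_def y_def[symmetric] y2_def[symmetric] A K
    by algebra
qed

text \<open>If V = X on an open set, then Y = 0 there, against Y' \<noteq> 0. If V is constantly c
  with c = 0 or c = 1, then \<open>log_slope\<close> vanishes and the Gauss equation demands (X -
  c)^2 = X (X - 1), which forces X = c.\<close>

lemma not_locally_fixed:
  assumes X: "X0 \<in> S" and gauss: "\<And>X. X \<in> S \<Longrightarrow> sigma_gauss Y X"
    and a: "a = (\<lambda>X. 0) \<or> a = (\<lambda>X. 1) \<or> a = (\<lambda>X. X)"
    and ev: "\<forall>\<^sub>F X in nhds X0. pvi_function X = a X"
  shows False
proof -
  obtain T where T: "open T" "X0 \<in> T" "T \<subseteq> S" "\<And>X. X \<in> T \<Longrightarrow> pvi_function X = a X"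
    using ev S X unfolding eventually_nhds by (metis Int_iff inf_le2 open_Int)
  have *: "deriv pvi_function X = deriv a X" if "X \<in> T" for X
    by (rule deriv_cong_ev) (use T that in \<open>auto simp: eventually_nhds\<close>)
  from a consider "a = (\<lambda>X. X)" | c where "a = (\<lambda>X. c)" "c = 0 \<or> c = 1" by blast
  then show False
  proof cases
    case 1
    have "Y X = 0" if "X \<in> T" for X
      using T(3,4) that 1 Y' by (force simp: pvi_function_def)
    then have "deriv Y X0 = deriv (\<lambda>x. 0) X0"
      by (intro deriv_cong_ev) (use T in \<open>auto simp: eventually_nhds\<close>)
    then show False using Y'[OF X] by simp
  next
    case 2
    have ne: "X - c \<noteq> 0" if "X \<in> S" for X using 2 nz that by auto
    have "log_slope X = 0" if "X \<in> T" for X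
    proof -
      have "log_slope X * (X - c) / (X * (X - 1)) = 0"
        using *[OF that] deriv_pvi[of X] T that 2 by auto
      then show ?thesis using ne[of X] nz[of X] T that by auto
    qed
    then have "deriv log_slope X0 = deriv (\<lambda>x. 0) X0"
      by (intro deriv_cong_ev) (use T in \<open>auto simp: eventually_nhds\<close>)
    moreover have "pvi_function X0 = c" using T 2 by auto
    ultimately have "(X0 - c)\<^sup>2 = X0 * (X0 - 1)"
      using sigma_gauss_iff[OF X] gauss[OF X] nz[OF X] Y'[OF X] by (auto simp: power2_eq_square)
    then show False using 2(2) nz[OF X] by (auto simp: power2_eq_square algebra_simps)
  qed
qed

text \<open>A holomorphic function that vanishes on no neighbourhood has isolated zeros; where
  \<open>pvi_function X - a X\<close> is nonzero, continuity suffices.\<close>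

lemma sparse_fixed:
  assumes gauss: "\<And>X. X \<in> S \<Longrightarrow> sigma_gauss Y X"
    and a: "a = (\<lambda>X. 0) \<or> a = (\<lambda>X. 1) \<or> a = (\<lambda>X. X)"
  shows "{X \<in> S. pvi_function X = a X} sparse_in S"
proof -
  have hol: "(\<lambda>X. pvi_function X - a X) holomorphic_on S"
    using a hol_pvi by (auto intro!: holomorphic_intros)
  have "\<forall>\<^sub>F X in at X0. pvi_function X \<noteq> a X" if X: "X0 \<in> S" for X0
  proof -
    have an: "(\<lambda>X. pvi_function X - a X) analytic_on {X0}"
      using hol X S by (meson analytic_on_analytic_at analytic_on_open)
    have "\<not> (\<forall>\<^sub>F X in nhds X0. pvi_function X - a X = 0)"
      using not_locally_fixed[OF X gauss a] by auto
    then have "pvi_function X0 - a X0 \<noteq> 0 \<or> isolated_zero (\<lambda>X. pvi_function X - a X) X0"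
      using non_isolated_zero_imp_eventually_zero'[OF an] by blast
    then have "\<forall>\<^sub>F X in at X0. pvi_function X - a X \<noteq> 0"
      using tendsto_imp_eventually_ne[OF analytic_at_imp_isCont[OF an, unfolded isCont_def], of 0]
      by (auto simp: isolated_zero_def)
    then show ?thesis by simp
  qed
  then show ?thesis unfolding sparse_in_eventually_iff[OF S(1)]
    by (force elim: eventually_mono)
qed

end

section \<open>Holomorphic initial value problems of order two\<close>

lemma holomorphic_primitive_ball:
  assumes "f holomorphic_on ball a r" "r > 0"
  shows "\<exists>g. (\<forall>x\<in>ball a r. (g has_field_derivative f x) (at x)) \<and> g a = c"
proof -
  obtain g where g: "\<And>x. x \<in> ball a r \<Longrightarrow> (g has_field_derivative f x) (at x within ball a r)"
    using holomorphic_convex_primitive'[OF convex_ball open_ball assms(1)] by blast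
  have "((\<lambda>x. g x - g a + c) has_field_derivative f x) (at x)" if "x \<in> ball a r" for x
  proof -
    have "(g has_field_derivative f x) (at x)" using g[OF that] that by (simp add: at_within_open[OF _ open_ball])
    then have "((\<lambda>x. g x - g a + c) has_field_derivative f x - 0 + 0) (at x)"
      by (intro DERIV_add DERIV_diff DERIV_const)
    then show ?thesis by simp
  qed
  then show ?thesis by (intro exI[of _ "\<lambda>x. g x - g a + c"]) auto
qed

text \<open>The mean value inequality on a convex disc. The factor \<open>r\<close> gained over the
  bound for the derivatives is what makes integration contracting on small discs.\<close>

lemma norm_diff_le_on_ball:
  fixes f g :: "complex \<Rightarrow> complex"
  assumes "\<And>x. x \<in> ball a r \<Longrightarrow> (f has_field_derivative f' x) (at x)"
    and "\<And>x. x \<in> ball a r \<Longrightarrow> (g has_field_derivative g' x) (at x)"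
    and "\<And>x. x \<in> ball a r \<Longrightarrow> norm (f' x - g' x) \<le> B"
    and "f a = g a" "x \<in> ball a r" "0 \<le> B"
  shows "norm (f x - g x) \<le> B * r"
proof -
  have D: "((\<lambda>x. f x - g x) has_field_derivative f' x - g' x) (at x within ball a r)"
    if "x \<in> ball a r" for x
    using DERIV_diff[OF assms(1,2)[OF that]] by (rule has_field_derivative_at_within)
  have "a \<in> ball a r" using assms(5) zero_le_dist[of a x] by (simp del: zero_le_dist)
  then have "norm ((f x - g x) - (f a - g a)) \<le> B * norm (x - a)"
    using field_differentiable_bound[where f = "\<lambda>x. f x - g x" and f' = "\<lambda>x. f' x - g' x", OF convex_ball D assms(3), of x a]
      assms(5) by simp
  also have "\<dots> \<le> B * r"
    using assms(5,6) by (intro mult_left_mono) (simp_all add: dist_norm norm_minus_commute)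
  finally show ?thesis using assms(4) by simp
qed

text \<open>
  Picard iteration on \<open>u = V''\<close>, with \<open>V'\<close> and \<open>V\<close> recovered from \<open>u\<close> by primitives on a small disc.
\<close>

lemma second_order_ivp_exists:
  fixes F :: "complex \<Rightarrow> complex \<Rightarrow> complex \<Rightarrow> complex"
  assumes R: "R > 0"
    and lip: "\<And>x y y' p p'. \<lbrakk>x \<in> cball x0 R; y \<in> cball a R; y' \<in> cball a R; p \<in> cball b R; p' \<in> cball b R\<rbrakk>
      \<Longrightarrow> norm (F x y p - F x y' p') \<le> L * (norm (y - y') + norm (p - p'))"
    and bd: "\<And>x y p. \<lbrakk>x \<in> cball x0 R; y \<in> cball a R; p \<in> cball b R\<rbrakk> \<Longrightarrow> norm (F x y p) \<le> M"
    and hol: "\<And>r y p. \<lbrakk>0 < r; r \<le> R; y holomorphic_on ball x0 r; p holomorphic_on ball x0 r;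
        y ` ball x0 r \<subseteq> cball a R; p ` ball x0 r \<subseteq> cball b R\<rbrakk>
      \<Longrightarrow> (\<lambda>x. F x (y x) (p x)) holomorphic_on ball x0 r"
  shows "\<exists>r>0. \<exists>V. r \<le> R \<and> V holomorphic_on ball x0 r \<and> V x0 = a \<and> deriv V x0 = b \<and>
    (\<forall>x\<in>ball x0 r. deriv (deriv V) x = F x (V x) (deriv V x))"
proof -
  have M: "M \<ge> 0" using order_trans[OF norm_ge_zero bd[of x0 a b]] R by simp
  \<comment> \<open>A Lipschitz constant that is at least 1, so that division by it is
    harmless.\<close>
  define N where "N = max L 0 + 1"
  have N: "N \<ge> 1" "L \<le> N" by (auto simp: N_def)
  have lipN: "norm (F x y p - F x y' p') \<le> N * (norm (y - y') + norm (p - p'))"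
    if "x \<in> cball x0 R" "y \<in> cball a R" "y' \<in> cball a R" "p \<in> cball b R" "p' \<in> cball b R" for x y y' p p'
    using lip[OF that] N(2) by (meson add_nonneg_nonneg mult_right_mono norm_ge_zero order_trans)
  \<comment> \<open>Each entry serves one estimate: \<open>M * r \<le> R\<close> keeps V' within R
    of b, \<open>(norm b + R) * r \<le> R\<close> keeps V within R of a, \<open>r \<le> 1\<close>
    drops one power of r, and \<open>4 * N * r \<le> 1\<close> makes the contraction factor 1/2. The
    denominator M + 1 allows for M = 0.\<close>
  define r where "r = Min {R, 1, R / (M + 1), R / (norm b + R), 1 / (4 * N)}"
  have r_le: "r \<le> R" "r \<le> 1" "r \<le> R / (M + 1)" "r \<le> R / (norm b + R)" "r \<le> 1 / (4 * N)"
    unfolding r_def by (intro Min_le; simp)+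
  have bR: "0 < norm b + R" using R by (simp add: add_nonneg_pos)
  have r: "0 < r" "r \<le> R" "r \<le> 1" "M * r \<le> R" "(norm b + R) * r \<le> R" "4 * N * r \<le> 1"
  proof -
    show "0 < r" unfolding r_def using R M N bR by (subst Min_gr_iff) auto
    then show "M * r \<le> R" using r_le(3) M by (simp add: pos_le_divide_eq algebra_simps)
    show "(norm b + R) * r \<le> R" using r_le(4) bR by (simp add: pos_le_divide_eq mult.commute)
    show "4 * N * r \<le> 1" using r_le(5) N by (simp add: pos_le_divide_eq mult.commute)
  qed (use r_le in auto)
  define B where "B = ball x0 r"
  have x0: "x0 \<in> B" using r by (simp add: B_def)
  have BR: "x \<in> cball x0 R" if "x \<in> B" for x using that r by (auto simp: B_def)
  \<comment> \<open>A primitive with value c at x0; the estimates use only its derivative and this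
    value. Below, \<open>P u\<close> and \<open>W u\<close> are V' and V reconstructed from
    \<open>u\<close>.\<close>
  define J where "J c f = (SOME g. (\<forall>x\<in>B. (g has_field_derivative f x) (at x)) \<and> g x0 = c)"
    for c :: complex and f :: "complex \<Rightarrow> complex"
  have J: "\<forall>x\<in>B. (J c f has_field_derivative f x) (at x)" "J c f x0 = c" if "f holomorphic_on B" for c f
    unfolding J_def using someI_ex[OF holomorphic_primitive_ball[of f x0 r c]] that r(1) by (auto simp: B_def)
  have Jhol: "J c f holomorphic_on B" if "f holomorphic_on B" for c f
    using J(1)[OF that] by (auto simp: B_def holomorphic_on_open)
  define P where "P u = J b u" for u
  define W where "W u = J a (P u)" for u
  define good where "good u \<longleftrightarrow> u holomorphic_on B \<and> (\<forall>x\<in>B. norm (u x) \<le> M)" for u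
  have Pb: "P u x \<in> cball b R" if "good u" "x \<in> B" for u x
  proof -
    have "norm (P u x - b) \<le> M * r"
      using norm_diff_le_on_ball[of x0 r "P u" u "\<lambda>_. b" "\<lambda>_. 0" M x] J[of u b] that r M
      by (auto simp: good_def P_def B_def)
    then show ?thesis using r(4) by (simp add: dist_norm norm_minus_commute)
  qed
  have Wa: "W u x \<in> cball a R" if "good u" "x \<in> B" for u x
  proof -
    have "norm (P u x) \<le> norm b + R" if "x \<in> B" for x
      using Pb[OF \<open>good u\<close> that] norm_triangle_sub[of "P u x" b] by (simp add: dist_norm norm_minus_commute)
    then have "norm (W u x - a) \<le> (norm b + R) * r"
      using norm_diff_le_on_ball[of x0 r "W u" "P u" "\<lambda>_. a" "\<lambda>_. 0" "norm b + R" x] J[of "P u" a] Jhol[of u b] that r R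
      by (auto simp: good_def P_def W_def B_def)
    then show ?thesis using r(5) by (simp add: dist_norm norm_minus_commute)
  qed
  define step where "step u = (\<lambda>x. F x (W u x) (P u x))" for u
  have good_step: "good (step u)" if u: "good u" for u
  proof -
    have "P u holomorphic_on B" "W u holomorphic_on B"
      using u Jhol by (auto simp: good_def P_def W_def)
    then show ?thesis unfolding good_def step_def B_def
      by (intro conjI hol ballI bd)
         (use r BR Pb[OF u] Wa[OF u] in \<open>auto simp: B_def image_subset_iff simp del: mem_cball\<close>)
  qed
  have contract: "norm (step u x - step w x) \<le> d / 2"
    if u: "good u" and w: "good w" and d: "\<And>x. x \<in> B \<Longrightarrow> norm (u x - w x) \<le> d" and x: "x \<in> B" for u w d x
  proof -
    have hol: "u holomorphic_on B" "w holomorphic_on B" "P u holomorphic_on B" "P w holomorphic_on B"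
      using u w Jhol by (auto simp: good_def P_def)
    have d0: "0 \<le> d" using d[OF x0] norm_ge_zero order_trans by blast
    have P: "norm (P u x - P w x) \<le> d * r" if "x \<in> B" for x
      using norm_diff_le_on_ball[of x0 r "P u" u "P w" w d x] J[OF hol(1)] J[OF hol(2)] d d0 that
      by (auto simp: P_def B_def)
    also have "d * r \<le> d" using r d0 by (simp add: mult_left_le)
    finally have "norm (W u x - W w x) \<le> d * r"
      using norm_diff_le_on_ball[of x0 r "W u" "P u" "W w" "P w" d x] J[OF hol(3)] J[OF hol(4)] d0 x
      by (auto simp: W_def B_def)
    then have "norm (W u x - W w x) + norm (P u x - P w x) \<le> 2 * (d * r)" using P[OF x] by simp
    moreover have "norm (step u x - step w x) \<le> N * (norm (W u x - W w x) + norm (P u x - P w x))"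
      unfolding step_def by (intro lipN Pb Wa BR u w x)
    ultimately have "norm (step u x - step w x) \<le> N * (2 * (d * r))"
      using N(1) by (meson mult_left_mono order_trans zero_le_one)
    also have "\<dots> = 4 * N * r * (d / 2)" by simp
    also have "\<dots> \<le> 1 * (d / 2)" using r(6) d0 by (intro mult_right_mono) auto
    finally show ?thesis by simp
  qed
  \<comment> \<open>Starting from 0 makes the first increment at most M, the beginning of a
    geometric series with ratio 1/2.\<close>
  define U where "U n = (step ^^ n) (\<lambda>_. 0)" for n
  have U_Suc: "U (Suc n) = step (U n)" for n by (simp add: U_def)
  have goodU: "good (U n)" for n
    by (induction n) (use M good_step in \<open>auto simp: U_def good_def[of "\<lambda>_. 0"]\<close>)
  have Ud: "norm (U (Suc n) x - U n x) \<le> M * (1 / 2) ^ n" if "x \<in> B" for n x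
    using that
  proof (induction n arbitrary: x)
    case 0
    then show ?case using goodU[of 1] by (simp add: U_def good_def)
  next
    case (Suc n)
    have "norm (step (U (Suc n)) x - step (U n) x) \<le> M * (1 / 2) ^ n / 2"
      by (rule contract[OF goodU goodU]) (use Suc in auto)
    then show ?case by (simp add: U_Suc)
  qed
  \<comment> \<open>The exact partial sum of the geometric series is kept: the weaker bound
    \<open>2 * M * (1 / 2) ^ n\<close> would not pass the induction step.\<close>
  have Uc: "norm (U (n + k) x - U n x) \<le> 2 * M * (1 / 2) ^ n * (1 - (1 / 2) ^ k)" if "x \<in> B" for n k x
  proof (induction k)
    case (Suc k)
    have "norm (U (n + Suc k) x - U n x) \<le> norm (U (Suc (n + k)) x - U (n + k) x) + norm (U (n + k) x - U n x)"
      using norm_triangle_ineq[of "U (Suc (n + k)) x - U (n + k) x" "U (n + k) x - U n x"] by simp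
    also have "\<dots> \<le> M * (1 / 2) ^ (n + k) + 2 * M * (1 / 2) ^ n * (1 - (1 / 2) ^ k)"
      using Ud[OF that, of "n + k"] Suc by simp
    also have "\<dots> = 2 * M * (1 / 2) ^ n * (1 - (1 / 2) ^ Suc k)"
      by (simp add: power_add algebra_simps)
    finally show ?case .
  qed auto
  have Uc': "norm (U m x - U n x) \<le> 2 * M * (1 / 2) ^ n" if "x \<in> B" "n \<le> m" for m n x
  proof -
    have "2 * M * (1 / 2) ^ n * (1 - (1 / 2) ^ (m - n)) \<le> 2 * M * (1 / 2) ^ n"
      using M by (intro mult_left_le) auto
    then show ?thesis using Uc[OF that(1), of n "m - n"] that(2) by simp
  qed
  have lim0: "(\<lambda>n. 2 * M * (1 / 2 :: real) ^ n) \<longlonglongrightarrow> 0"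
    by (intro tendsto_mult_right_zero LIMSEQ_realpow_zero) auto
  have "uniformly_Cauchy_on B U"
    unfolding uniformly_Cauchy_on_def
  proof (intro allI impI)
    fix e :: real assume "e > 0"
    then obtain n0 where n0: "\<And>n. n \<ge> n0 \<Longrightarrow> 2 * M * (1 / 2) ^ n < e / 2"
      using order_tendstoD(2)[OF lim0, of "e / 2"] by (auto simp: eventually_sequentially)
    have "dist (U m x) (U n x) < e" if "x \<in> B" "m \<ge> n0" "n \<ge> n0" for m n x
    proof (rule dist_triangle_half_l)
      show "dist (U m x) (U n0 x) < e / 2" "dist (U n x) (U n0 x) < e / 2"
        using Uc'[OF that(1,2)] Uc'[OF that(1,3)] n0[of n0] by (simp_all add: dist_norm)
    qed
    then show "\<exists>M. \<forall>x\<in>B. \<forall>m\<ge>M. \<forall>n\<ge>M. dist (U m x) (U n x) < e" by blast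
  qed
  then obtain u where ul: "uniform_limit B U u sequentially"
    using uniformly_convergent_eq_Cauchy uniformly_convergent_on_def by blast
  have ulim: "(\<lambda>n. U n x) \<longlonglongrightarrow> u x" if "x \<in> B" for x
    using tendsto_uniform_limitI[OF ul that] .
  have uU: "norm (u x - U n x) \<le> 2 * M * (1 / 2) ^ n" if "x \<in> B" for x n
    by (rule tendsto_upperbound[OF tendsto_norm[OF tendsto_diff[OF ulim[OF that] tendsto_const]]])
       (use Uc'[OF that] in \<open>auto simp: eventually_sequentially\<close>)
  have "good u" unfolding good_def
  proof (intro conjI ballI)
    show "u holomorphic_on B"
    proof (rule holomorphic_uniform_sequence[of _ U])
      show "open B" by (simp add: B_def)
      show "U n holomorphic_on B" for n using goodU by (simp add: good_def)
      show "\<exists>d>0. cball x d \<subseteq> B \<and> uniform_limit (cball x d) U u sequentially" if x: "x \<in> B" for x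
      proof -
        have "open B" by (simp add: B_def)
        then obtain d where d: "d > 0" "cball x d \<subseteq> B"
          using open_contains_cball[THEN iffD1] x by blast
        then show ?thesis using uniform_limit_on_subset[OF ul d(2)] by auto
      qed
    qed
    show "norm (u x) \<le> M" if "x \<in> B" for x
      by (rule tendsto_upperbound[OF tendsto_norm[OF ulim[OF that]]])
         (use goodU that in \<open>auto simp: good_def\<close>)
  qed
  \<comment> \<open>The sequence \<open>U (Suc n) = step (U n)\<close> tends to
    \<open>step u\<close> by the contraction estimate and to \<open>u\<close> by
    construction.\<close>
  have fixp: "step u x = u x" if x: "x \<in> B" for x
  proof -
    have "norm (U (Suc n) x - step u x) \<le> 2 * M * (1 / 2) ^ n / 2" for n
      unfolding U_Suc by (rule contract[OF goodU \<open>good u\<close> _ x]) (use uU in \<open>simp add: norm_minus_commute\<close>)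
    then have "(\<lambda>n. U (Suc n) x) \<longlonglongrightarrow> step u x"
      by (intro LIM_zero_cancel[of _ "step u x"] Lim_null_comparison[OF always_eventually tendsto_divide_zero[OF lim0, of 2]]) auto
    then show ?thesis using LIMSEQ_unique LIMSEQ_Suc[OF ulim[OF x]] by blast
  qed
  have hu: "u holomorphic_on B" and hP: "P u holomorphic_on B" using \<open>good u\<close> Jhol by (auto simp: good_def P_def)
  have dW: "deriv (W u) x = P u x" if "x \<in> B" for x
    using J(1)[OF hP] that by (auto simp: W_def intro: DERIV_imp_deriv)
  have "deriv (deriv (W u)) x = u x" if "x \<in> B" for x
  proof -
    have "deriv (deriv (W u)) x = deriv (P u) x"
      by (rule deriv_cong_ev) (use that dW in \<open>auto simp: eventually_nhds B_def intro!: exI[of _ "ball x0 r"]\<close>)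
    also have "\<dots> = u x" using J(1)[OF hu] that by (auto simp: P_def intro: DERIV_imp_deriv)
    finally show ?thesis .
  qed
  then have "\<forall>x\<in>B. deriv (deriv (W u)) x = F x (W u x) (deriv (W u) x)"
    using fixp dW by (simp add: step_def)
  moreover have "W u holomorphic_on B" "W u x0 = a" "deriv (W u) x0 = b"
    using Jhol[OF hP] J(2)[OF hP] J(2)[OF hu] dW[OF x0] by (auto simp: W_def P_def)
  ultimately show ?thesis using r unfolding B_def by blast
qed

text \<open>
  On a small disc the supremum \<open>s\<close> of \<open>\<bar>V'' - W''\<bar>\<close> controls \<open>V - W\<close> and \<open>V' - W'\<close>, hence \<open>s \<le> s / 2\<close>.
\<close>

lemma second_order_ivp_unique_nhds:
  fixes F :: "complex \<Rightarrow> complex \<Rightarrow> complex \<Rightarrow> complex"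
  assumes R: "R > 0"
    and lip: "\<And>x y y' p p'. \<lbrakk>x \<in> cball x0 R; y \<in> cball a R; y' \<in> cball a R; p \<in> cball b R; p' \<in> cball b R\<rbrakk>
      \<Longrightarrow> norm (F x y p - F x y' p') \<le> L * (norm (y - y') + norm (p - p'))"
    and S: "open S" "x0 \<in> S" and hol: "V holomorphic_on S" "W holomorphic_on S"
    and ic: "V x0 = a" "W x0 = a" "deriv V x0 = b" "deriv W x0 = b"
    and ode: "\<And>x. x \<in> S \<Longrightarrow> deriv (deriv V) x = F x (V x) (deriv V x)"
      "\<And>x. x \<in> S \<Longrightarrow> deriv (deriv W) x = F x (W x) (deriv W x)"
  shows "\<exists>r>0. ball x0 r \<subseteq> S \<and> (\<forall>x\<in>ball x0 r. V x = W x)"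
proof -
  define N where "N = max L 1"
  have N: "N \<ge> 1" "L \<le> N" by (auto simp: N_def)
  have hd: "deriv V holomorphic_on S" "deriv W holomorphic_on S" "deriv (deriv V) holomorphic_on S" "deriv (deriv W) holomorphic_on S"
    using S hol by (auto intro!: holomorphic_deriv)
  \<comment> \<open>The part of S on which both solutions and their derivatives stay within the
    region of the Lipschitz estimate.\<close>
  define G where "G = S \<inter> ball x0 R \<inter> (S \<inter> V -` ball a R) \<inter> (S \<inter> W -` ball a R) \<inter> (S \<inter> deriv V -` ball b R) \<inter> (S \<inter> deriv W -` ball b R)"
  have "open G" unfolding G_def
    using S hol hd by (intro open_Int continuous_open_preimage) (auto intro: holomorphic_on_imp_continuous_on)
  moreover have "x0 \<in> G" using S R ic by (auto simp: G_def)
  ultimately obtain e where e: "e > 0" "cball x0 e \<subseteq> G" using open_contains_cball by blast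
  define r where "r = min (min e 1) (1 / (4 * N))"
  have "r \<le> 1 / (4 * N)" by (simp add: r_def)
  then have "4 * N * r \<le> 1" using N by (simp add: pos_le_divide_eq mult.commute)
  then have r: "r > 0" "r \<le> e" "r \<le> 1" "4 * N * r \<le> 1" using e N by (auto simp: r_def)
  have sub: "x \<in> S \<and> x \<in> cball x0 R \<and> V x \<in> cball a R \<and> W x \<in> cball a R \<and> deriv V x \<in> cball b R \<and> deriv W x \<in> cball b R"
    if "x \<in> cball x0 r" for x
  proof -
    have "x \<in> G" using that e(2) r by auto
    then show ?thesis by (auto simp: G_def)
  qed
  let ?f = "\<lambda>x. norm (deriv (deriv V) x - deriv (deriv W) x)"
  have "continuous_on (cball x0 r) ?f"
    using holomorphic_on_imp_continuous_on[OF hd(3)] holomorphic_on_imp_continuous_on[OF hd(4)] sub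
    by (intro continuous_intros) (auto intro: continuous_on_subset)
  then obtain s where s: "s \<in> cball x0 r" "\<And>x. x \<in> cball x0 r \<Longrightarrow> ?f x \<le> ?f s"
    using continuous_attains_sup[of "cball x0 r" ?f] r by auto
  have D: "(V has_field_derivative deriv V x) (at x)" "(W has_field_derivative deriv W x) (at x)"
    "(deriv V has_field_derivative deriv (deriv V) x) (at x)" "(deriv W has_field_derivative deriv (deriv W) x) (at x)"
    if "x \<in> ball x0 r" for x
    using sub[of x] that S hol hd by (auto intro!: holomorphic_derivI)
  have d1: "norm (deriv V x - deriv W x) \<le> ?f s * r" if "x \<in> ball x0 r" for x
    by (rule norm_diff_le_on_ball[OF D(3) D(4)]) (use s that ic in auto)
  have d1': "norm (deriv V x - deriv W x) \<le> ?f s" if "x \<in> ball x0 r" for x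
    using d1[OF that] r by (meson mult_left_le norm_ge_zero order_trans)
  have d0: "norm (V x - W x) \<le> ?f s * r" if "x \<in> ball x0 r" for x
    by (rule norm_diff_le_on_ball[OF D(1) D(2)]) (use d1' that ic in auto)
  have small: "?f x \<le> ?f s / 2" if "x \<in> ball x0 r" for x
  proof -
    have x: "x \<in> cball x0 r" using that by simp
    have "?f x \<le> L * (norm (V x - W x) + norm (deriv V x - deriv W x))"
      using sub[OF x] ode lip by simp
    also have "\<dots> \<le> N * (2 * (?f s * r))"
      using d0[OF that] d1[OF that] N by (intro mult_mono) auto
    also have "\<dots> = 4 * N * r * (?f s / 2)" by simp
    also have "\<dots> \<le> 1 * (?f s / 2)" using r by (intro mult_right_mono) auto
    finally show ?thesis by simp
  qed
  \<comment> \<open>The maximum \<open>s\<close> may lie on the boundary circle, while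
    \<open>small\<close> holds inside; continuity carries the bound to the closed disc.\<close>
  have "?f s \<le> ?f s / 2"
  proof (rule continuous_le_on_closure[of "ball x0 r" ?f s])
    show "continuous_on (closure (ball x0 r)) ?f" using \<open>continuous_on (cball x0 r) ?f\<close> r by simp
  qed (use s small r in auto)
  then have "?f s = 0" by simp
  then have "\<forall>x\<in>ball x0 r. V x = W x" using d0 by fastforce
  moreover have "ball x0 r \<subseteq> S" using sub by auto
  ultimately show ?thesis using r by blast
qed

section \<open>Local solutions of the sixth Painleve equation\<close>

text \<open>Neither radius nor constant is specified, so the property passes through sums, products
  and quotients with nonzero denominator at the centre. The right-hand side of the sixth Painleve
  equation, rational in (X, V, V'), is then treated term by term, without partial
  derivatives.\<close>

definition lipschitz_near :: "'a::metric_space \<Rightarrow> ('a \<Rightarrow> complex) \<Rightarrow> bool" where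
  "lipschitz_near s f \<longleftrightarrow> (\<exists>e>0. \<exists>K. K-lipschitz_on (ball s e) f)"

lemma lipschitz_near_common:
  assumes "lipschitz_near s f" "lipschitz_near s g"
  obtains e K L where "e > 0" "K-lipschitz_on (ball s e) f" "L-lipschitz_on (ball s e) g"
proof -
  obtain e1 K e2 L where "e1 > 0" "K-lipschitz_on (ball s e1) f" "e2 > 0" "L-lipschitz_on (ball s e2) g"
    using assms unfolding lipschitz_near_def by blast
  then show ?thesis
    by (intro that[of "min e1 e2" K L]) (auto elim: lipschitz_on_subset)
qed

lemma lipschitz_on_ball_bounded:
  fixes f :: "'a::metric_space \<Rightarrow> complex"
  assumes "K-lipschitz_on (ball s e) f" "e > 0" "p \<in> ball s e"
  shows "norm (f p) \<le> norm (f s) + K * e"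
proof -
  have "norm (f p - f s) \<le> K * dist p s"
    using lipschitz_onD[OF assms(1,3), of s] assms(2) by (simp add: dist_norm)
  also have "\<dots> \<le> K * e"
    using assms lipschitz_on_nonneg[OF assms(1)] by (intro mult_left_mono) (auto simp: dist_commute)
  finally show ?thesis using norm_triangle_sub[of "f p" "f s"] by linarith
qed

lemma lipschitz_near_const: "lipschitz_near s (\<lambda>_. c)"
  unfolding lipschitz_near_def using lipschitz_on_constant zero_less_one by blast

lemma lipschitz_near_add:
  assumes "lipschitz_near s f" "lipschitz_near s g"
  shows "lipschitz_near s (\<lambda>p. f p + g p)"
proof -
  obtain e K L where "e > 0" "K-lipschitz_on (ball s e) f" "L-lipschitz_on (ball s e) g"
    using lipschitz_near_common[OF assms] .
  then show ?thesis
    unfolding lipschitz_near_def by (intro exI[of _ e] conjI exI[of _ "K + L"] lipschitz_on_add)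
qed

lemma lipschitz_near_diff:
  assumes "lipschitz_near s f" "lipschitz_near s g"
  shows "lipschitz_near s (\<lambda>p. f p - g p)"
proof -
  obtain e K L where "e > 0" "K-lipschitz_on (ball s e) f" "L-lipschitz_on (ball s e) g"
    using lipschitz_near_common[OF assms] .
  then show ?thesis
    unfolding lipschitz_near_def by (intro exI[of _ e] conjI exI[of _ "K + L"] lipschitz_on_diff)
qed

lemma lipschitz_near_mult:
  assumes "lipschitz_near s f" "lipschitz_near s g"
  shows "lipschitz_near s (\<lambda>p. f p * g p)"
  using assms
proof (rule lipschitz_near_common)
  fix e K L
  assume e: "e > 0" and f: "K-lipschitz_on (ball s e) f" and g: "L-lipschitz_on (ball s e) g"
  define B where "B = norm (f s) + K * e"
  define C where "C = norm (g s) + L * e"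
  have KL: "0 \<le> K" "0 \<le> L" using f g by (auto dest: lipschitz_on_nonneg)
  then have BC: "0 \<le> B" "0 \<le> C" using e by (auto simp: B_def C_def)
  have "(B * L + K * C)-lipschitz_on (ball s e) (\<lambda>p. f p * g p)"
  proof (rule lipschitz_onI)
    fix p p' assume p: "p \<in> ball s e" "p' \<in> ball s e"
    have "f p * g p - f p' * g p' = f p * (g p - g p') + (f p - f p') * g p'"
      by (simp add: algebra_simps)
    then have "norm (f p * g p - f p' * g p') \<le> norm (f p) * norm (g p - g p') + norm (f p - f p') * norm (g p')"
      by (metis norm_mult norm_triangle_ineq)
    also have "\<dots> \<le> B * (L * dist p p') + (K * dist p p') * C"
      using lipschitz_on_ball_bounded[OF f e p(1)] lipschitz_on_ball_bounded[OF g e p(2)]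
        lipschitz_onD[OF f p] lipschitz_onD[OF g p] KL BC
      unfolding B_def[symmetric] C_def[symmetric]
      by (intro add_mono mult_mono) (auto simp: dist_norm)
    finally show "dist (f p * g p) (f p' * g p') \<le> (B * L + K * C) * dist p p'"
      by (simp add: dist_norm algebra_simps)
  qed (use KL BC in auto)
  then show ?thesis unfolding lipschitz_near_def using e by blast
qed

lemma lipschitz_near_inverse:
  assumes "lipschitz_near s f" "f s \<noteq> 0"
  shows "lipschitz_near s (\<lambda>p. inverse (f p))"
proof -
  obtain e K where e: "e > 0" and f: "K-lipschitz_on (ball s e) f"
    using assms unfolding lipschitz_near_def by blast
  have K: "0 \<le> K" using f by (rule lipschitz_on_nonneg)
  define m where "m = norm (f s) / 2"
  have m: "m > 0" using assms by (simp add: m_def)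
  \<comment> \<open>On a ball with \<open>K * d \<le> m\<close> the function varies by at most half
    of its modulus at the centre, hence stays at least \<open>m\<close> in modulus; K + 1 allows for
    K = 0.\<close>
  define d where "d = min e (m / (K + 1))"
  have d: "d > 0" "ball s d \<subseteq> ball s e" "K * d \<le> m"
  proof -
    show "d > 0" "ball s d \<subseteq> ball s e" using e m K by (auto simp: d_def)
    have "d \<le> m / (K + 1)" by (simp add: d_def)
    then have "(K + 1) * d \<le> m" using K by (simp add: pos_le_divide_eq mult.commute)
    then show "K * d \<le> m" using \<open>d > 0\<close> by (simp add: distrib_right)
  qed
  have fd: "K-lipschitz_on (ball s d) f" using f d(2) by (rule lipschitz_on_subset)
  have low: "m \<le> norm (f p)" if "p \<in> ball s d" for p
  proof -
    have "norm (f p - f s) \<le> K * dist p s"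
      using lipschitz_onD[OF fd that, of s] d by (simp add: dist_norm)
    also have "\<dots> \<le> K * d" using that K by (intro mult_left_mono) (auto simp: dist_commute)
    finally have "norm (f p - f s) \<le> m" using d(3) by linarith
    then show ?thesis using norm_triangle_sub[of "f s" "f p"] by (simp add: m_def norm_minus_commute)
  qed
  have "(K / m\<^sup>2)-lipschitz_on (ball s d) (\<lambda>p. inverse (f p))"
  proof (rule lipschitz_onI)
    fix p p' assume p: "p \<in> ball s d" "p' \<in> ball s d"
    have nz: "f p \<noteq> 0" "f p' \<noteq> 0" using low[OF p(1)] low[OF p(2)] m by auto
    have "norm (inverse (f p) - inverse (f p')) = norm (f p - f p') / (norm (f p) * norm (f p'))"
      using nz by (simp add: inverse_diff_inverse norm_mult norm_inverse divide_inverse)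
    also have "\<dots> \<le> (K * dist p p') / (m * m)"
      using lipschitz_onD[OF fd p] low[OF p(1)] low[OF p(2)] m K
      by (intro frac_le mult_mono) (auto simp: dist_norm)
    finally show "dist (inverse (f p)) (inverse (f p')) \<le> K / m\<^sup>2 * dist p p'"
      by (simp add: dist_norm power2_eq_square)
  qed (use K in auto)
  then show ?thesis unfolding lipschitz_near_def using d by blast
qed

lemma lipschitz_near_divide:
  assumes "lipschitz_near s f" "lipschitz_near s g" "g s \<noteq> 0"
  shows "lipschitz_near s (\<lambda>p. f p / g p)"
  using lipschitz_near_mult[OF assms(1) lipschitz_near_inverse[OF assms(2,3)]]
  by (simp add: divide_inverse)

lemma lipschitz_near_power2:
  assumes "lipschitz_near s f"
  shows "lipschitz_near s (\<lambda>p. (f p)\<^sup>2)"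
  using lipschitz_near_mult[OF assms assms] by (simp add: power2_eq_square)

lemma lipschitz_near_fst: "lipschitz_near s fst"
  unfolding lipschitz_near_def
  by (intro exI[of _ 1] conjI lipschitz_onI) (auto simp: dist_fst_le)

lemma lipschitz_near_snd:
  assumes "lipschitz_near (snd s) f"
  shows "lipschitz_near s (\<lambda>p. f (snd p))"
proof -
  obtain e K where e: "e > 0" and f: "K-lipschitz_on (ball (snd s) e) f"
    using assms unfolding lipschitz_near_def by blast
  have sub: "snd p \<in> ball (snd s) e" if "p \<in> ball s e" for p
    using that dist_snd_le[of s p] by auto
  have "K-lipschitz_on (ball s e) (\<lambda>p. f (snd p))"
  proof (rule lipschitz_onI)
    fix p p' assume p: "p \<in> ball s e" "p' \<in> ball s e"
    have "dist (f (snd p)) (f (snd p')) \<le> K * dist (snd p) (snd p')"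
      using lipschitz_onD[OF f sub[OF p(1)] sub[OF p(2)]] .
    also have "\<dots> \<le> K * dist p p'"
      using lipschitz_on_nonneg[OF f] dist_snd_le by (intro mult_left_mono)
    finally show "dist (f (snd p)) (f (snd p')) \<le> K * dist p p'" .
  qed (rule lipschitz_on_nonneg[OF f])
  then show ?thesis unfolding lipschitz_near_def using e by blast
qed

lemma lipschitz_near_ident: "lipschitz_near s (\<lambda>p. p)"
  unfolding lipschitz_near_def using lipschitz_on_id zero_less_one by blast

lemmas lipschitz_near_intros = lipschitz_near_const lipschitz_near_add lipschitz_near_diff
  lipschitz_near_mult lipschitz_near_divide lipschitz_near_power2

lemma lipschitz_near_painleve:
  assumes nz: "X0 \<noteq> 0" "X0 \<noteq> 1" "V0 \<noteq> 0" "V0 \<noteq> 1" "V0 \<noteq> X0"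
  shows "lipschitz_near (X0, V0, P0) (\<lambda>s. painleve_VI_rhs a b c d (fst s) (fst (snd s)) (snd (snd s)))"
proof -
  have p: "lipschitz_near (X0, V0, P0) (\<lambda>s. fst s)" "lipschitz_near (X0, V0, P0) (\<lambda>s. fst (snd s))"
    "lipschitz_near (X0, V0, P0) (\<lambda>s. snd (snd s))"
    by (intro lipschitz_near_fst lipschitz_near_snd[of _ fst] lipschitz_near_snd[of _ "\<lambda>p. snd p"]
      lipschitz_near_snd[of _ "\<lambda>p. p"] lipschitz_near_ident)+
  show ?thesis
    unfolding painleve_VI_rhs_def by (intro lipschitz_near_intros p) (use nz in auto)
qed

text \<open>The data demanded by the initial value lemmas, on closed balls that avoid the singular
  values. Here V' and P' are second values to compare with V and P, not derivatives.\<close>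

definition painleve_bounded_on_cballs where
  "painleve_bounded_on_cballs a b c d X0 V0 P0 R L M \<longleftrightarrow> R > 0 \<and>
    (\<forall>X\<in>cball X0 R. \<forall>V\<in>cball V0 R. X \<noteq> 0 \<and> X \<noteq> 1 \<and> V \<noteq> 0 \<and> V \<noteq> 1 \<and> V \<noteq> X) \<and>
    (\<forall>X\<in>cball X0 R. \<forall>V\<in>cball V0 R. \<forall>V'\<in>cball V0 R. \<forall>P\<in>cball P0 R. \<forall>P'\<in>cball P0 R.
       norm (painleve_VI_rhs a b c d X V P - painleve_VI_rhs a b c d X V' P')
         \<le> L * (norm (V - V') + norm (P - P'))) \<and>
    (\<forall>X\<in>cball X0 R. \<forall>V\<in>cball V0 R. \<forall>P\<in>cball P0 R. norm (painleve_VI_rhs a b c d X V P) \<le> M)"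

lemmas painleve_bounded_on_cballsD =
  painleve_bounded_on_cballs_def[THEN iffD1, THEN conjunct1]
  painleve_bounded_on_cballs_def[THEN iffD1, THEN conjunct2, THEN conjunct1, rule_format]
  painleve_bounded_on_cballs_def[THEN iffD1, THEN conjunct2, THEN conjunct2, THEN conjunct1, rule_format]
  painleve_bounded_on_cballs_def[THEN iffD1, THEN conjunct2, THEN conjunct2, THEN conjunct2, rule_format]

lemma painleve_bounds:
  assumes nz: "X0 \<noteq> 0" "X0 \<noteq> 1" "V0 \<noteq> 0" "V0 \<noteq> 1" "V0 \<noteq> X0"
  shows "\<exists>R L M. painleve_bounded_on_cballs a b c d X0 V0 P0 R L M"
proof -
  let ?f = "\<lambda>s. painleve_VI_rhs a b c d (fst s) (fst (snd s)) (snd (snd s))" and ?s = "(X0, V0, P0)"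
  obtain e K where e: "e > 0" and f: "K-lipschitz_on (ball ?s e) ?f"
    using lipschitz_near_painleve[OF nz, of P0 a b c d] unfolding lipschitz_near_def by (elim exE conjE)
  let ?G = "{s :: complex \<times> complex \<times> complex. fst s \<noteq> 0 \<and> fst s \<noteq> 1 \<and> fst (snd s) \<noteq> 0 \<and> fst (snd s) \<noteq> 1 \<and> fst (snd s) \<noteq> fst s}"
  have "open ?G"
    by (intro open_Collect_conj open_Collect_neq continuous_intros)
  moreover have "?s \<in> ?G" using nz by simp
  ultimately obtain e' where e': "e' > 0" "ball ?s e' \<subseteq> ?G"
    using open_contains_ball[THEN iffD1] by blast
  \<comment> \<open>The distance in the triple product is at most the sum of the three distances, so
    a product of balls of radius R lies within distance 3 R of the centre, which is less than both
    radii.\<close>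
  define R where "R = min e e' / 4"
  have R: "R > 0" "3 * R < e" "3 * R < e'" using e e' by (auto simp: R_def)
  have d: "dist (x, y, z) (x', y', z') \<le> dist x x' + (dist y y' + dist z z')"
    for x y z x' y' z' :: complex
    using sqrt_sum_squares_le_sum_abs[of "dist x x'" "dist (y, z) (y', z')"]
      sqrt_sum_squares_le_sum_abs[of "dist y y'" "dist z z'"]
    by (simp add: dist_Pair_Pair[of x] dist_Pair_Pair[of y])
  have in_ball: "(X, V, P) \<in> ball ?s e" "(X, V, P) \<in> ball ?s e'"
    if "X \<in> cball X0 R" "V \<in> cball V0 R" "P \<in> cball P0 R" for X V P
    using d[of X0 V0 P0 X V P] that R by auto
  show ?thesis
    unfolding painleve_bounded_on_cballs_def
  proof (rule exI[of _ R], rule exI[of _ K], rule exI[of _ "norm (?f ?s) + K * e"], intro conjI ballI)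
    show "R > 0" by (rule R)
    show "X \<noteq> 0" "X \<noteq> 1" "V \<noteq> 0" "V \<noteq> 1" "V \<noteq> X"
      if "X \<in> cball X0 R" "V \<in> cball V0 R" for X V
      using in_ball(2)[OF that, of P0] e'(2) R by auto
    show "norm (painleve_VI_rhs a b c d X V P) \<le> norm (?f ?s) + K * e"
      if "X \<in> cball X0 R" "V \<in> cball V0 R" "P \<in> cball P0 R" for X V P
      using lipschitz_on_ball_bounded[OF f e in_ball(1)[OF that]] by simp
    show "norm (painleve_VI_rhs a b c d X V P - painleve_VI_rhs a b c d X V' P')
         \<le> K * (norm (V - V') + norm (P - P'))"
      if "X \<in> cball X0 R" "V \<in> cball V0 R" "V' \<in> cball V0 R" "P \<in> cball P0 R" "P' \<in> cball P0 R" for X V V' P P'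
    proof -
      have "norm (painleve_VI_rhs a b c d X V P - painleve_VI_rhs a b c d X V' P')
         \<le> K * dist (X, V, P) (X, V', P')"
        using lipschitz_onD[OF f in_ball(1)[OF that(1,2,4)] in_ball(1)[OF that(1,3,5)]] by (simp add: dist_norm)
      also have "\<dots> \<le> K * (norm (V - V') + norm (P - P'))"
        using d[of X V P X V' P'] lipschitz_on_nonneg[OF f] by (intro mult_left_mono) (auto simp: dist_norm)
      finally show ?thesis .
    qed
  qed
qed

section \<open>Existence and uniqueness for the sixth Painleve equation\<close>

lemma painleve_VI_local_solution:
  assumes nz: "X0 \<noteq> 0" "X0 \<noteq> 1" "V0 \<noteq> 0" "V0 \<noteq> 1" "V0 \<noteq> X0"
  shows "\<exists>r>0. \<exists>V. painleve_VI_on (ball X0 r) a b c d V \<and> V X0 = V0 \<and> deriv V X0 = P0"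
proof -
  obtain R L M where "painleve_bounded_on_cballs a b c d X0 V0 P0 R L M"
    using painleve_bounds[OF nz] by blast
  note R = painleve_bounded_on_cballsD[OF this]
  have "\<exists>r>0. \<exists>V. r \<le> R \<and> V holomorphic_on ball X0 r \<and> V X0 = V0 \<and> deriv V X0 = P0 \<and>
    (\<forall>X\<in>ball X0 r. deriv (deriv V) X = painleve_VI_rhs a b c d X (V X) (deriv V X))"
  proof (rule second_order_ivp_exists[OF R(1) R(3,4)])
    fix r y p
    assume *: "r \<le> R" "y holomorphic_on ball X0 r" "p holomorphic_on ball X0 r" "y ` ball X0 r \<subseteq> cball V0 R"
    have "x \<noteq> 0 \<and> x \<noteq> 1 \<and> y x \<noteq> 0 \<and> y x \<noteq> 1 \<and> y x \<noteq> x" if "x \<in> ball X0 r" for x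
      by (rule R(2)) (use * that in \<open>auto simp: image_subset_iff\<close>)
    then show "(\<lambda>x. painleve_VI_rhs a b c d x (y x) (p x)) holomorphic_on ball X0 r"
      unfolding painleve_VI_rhs_def using * by (intro holomorphic_intros) auto
  qed
  then obtain r V where V: "r > 0" "r \<le> R" "V holomorphic_on ball X0 r" "V X0 = V0" "deriv V X0 = P0"
    "\<And>X. X \<in> ball X0 r \<Longrightarrow> deriv (deriv V) X = painleve_VI_rhs a b c d X (V X) (deriv V X)"
    by blast
  \<comment> \<open>The initial value lemma does not say that V avoids 0, 1 and X; this follows once
    V is confined to \<open>ball V0 R\<close>, by the choice of R.\<close>
  define G where "G = ball X0 r \<inter> V -` ball V0 R"
  have "open G" unfolding G_def
    by (intro continuous_open_preimage holomorphic_on_imp_continuous_on V) auto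
  moreover have "X0 \<in> G" using V R by (simp add: G_def)
  ultimately obtain r' where r': "r' > 0" "ball X0 r' \<subseteq> G" using open_contains_ball[THEN iffD1] by blast
  have "painleve_VI_on (ball X0 r') a b c d V"
    unfolding painleve_VI_on_def
  proof (intro conjI ballI)
    show "V holomorphic_on ball X0 r'" using V(3) r'(2) by (auto simp: G_def elim: holomorphic_on_subset)
    fix X assume X: "X \<in> ball X0 r'"
    then have XG: "X \<in> ball X0 r" "V X \<in> ball V0 R" using r' by (auto simp: G_def)
    show "X \<noteq> 0" "X \<noteq> 1" "V X \<noteq> 0" "V X \<noteq> 1" "V X \<noteq> X"
      using R(2)[of X "V X"] XG V(2) by auto
    show "deriv (deriv V) X = painleve_VI_rhs a b c d X (V X) (deriv V X)" using V(6) XG by blast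
  qed auto
  then show ?thesis using r' V by blast
qed

text \<open>Uniqueness near \<open>X0\<close> comes from the Lipschitz estimate; the identity
  theorem spreads it over the connected domain.\<close>

lemma painleve_VI_unique:
  assumes V: "painleve_VI_on S a b c d V" and W: "painleve_VI_on S a b c d W"
    and "connected S" "X0 \<in> S" "V X0 = W X0" "deriv V X0 = deriv W X0" "X \<in> S"
  shows "V X = W X"
proof -
  have S: "open S" and hol: "V holomorphic_on S" "W holomorphic_on S"
    using V W by (auto simp: painleve_VI_on_def)
  have nz: "X0 \<noteq> 0" "X0 \<noteq> 1" "V X0 \<noteq> 0" "V X0 \<noteq> 1" "V X0 \<noteq> X0"
    using V \<open>X0 \<in> S\<close> by (auto simp: painleve_VI_on_def)
  obtain R L M where "painleve_bounded_on_cballs a b c d X0 (V X0) (deriv V X0) R L M"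
    using painleve_bounds[OF nz] by blast
  note R = painleve_bounded_on_cballsD[OF this]
  have "\<exists>r>0. ball X0 r \<subseteq> S \<and> (\<forall>x\<in>ball X0 r. V x = W x)"
    by (rule second_order_ivp_unique_nhds[OF R(1) R(3) S \<open>X0 \<in> S\<close> hol])
       (use assms V W in \<open>auto simp: painleve_VI_on_def\<close>)
  then obtain r where r: "r > 0" "ball X0 r \<subseteq> S" "\<And>x. x \<in> ball X0 r \<Longrightarrow> V x = W x" by blast
  show ?thesis
    by (rule analytic_continuation_open[OF open_ball S _ \<open>connected S\<close> r(2) hol r(3) \<open>X \<in> S\<close>]) (use r in auto)
qed

section \<open>The branch with nonconstant q\<close>

lemma pvi_var_facts:
  assumes "\<eta> \<noteq> 0" "\<eta>\<^sup>2 \<noteq> 1"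
  shows "pvi_var \<eta> \<noteq> 0" "pvi_var \<eta> \<noteq> 1" "\<eta>\<^sup>2 = (pvi_var \<eta> - 1) / pvi_var \<eta>"
    "1 - \<eta>\<^sup>2 = 1 / pvi_var \<eta>" "(pvi_var has_field_derivative 2 * \<eta> * (pvi_var \<eta>)\<^sup>2) (at \<eta>)"
proof -
  have nz: "1 - \<eta>\<^sup>2 \<noteq> 0" using assms by auto
  then show "pvi_var \<eta> \<noteq> 0" "pvi_var \<eta> \<noteq> 1" "\<eta>\<^sup>2 = (pvi_var \<eta> - 1) / pvi_var \<eta>"
    "1 - \<eta>\<^sup>2 = 1 / pvi_var \<eta>"
    using assms by (auto simp: pvi_var_def field_simps)
  have "((\<lambda>\<eta>. 1 / (1 - \<eta>\<^sup>2)) has_field_derivative 2 * \<eta> * (pvi_var \<eta>)\<^sup>2) (at \<eta>)"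
    using nz by (auto intro!: derivative_eq_intros simp: pvi_var_def power2_eq_square)
  then show "(pvi_var has_field_derivative 2 * \<eta> * (pvi_var \<eta>)\<^sup>2) (at \<eta>)"
    by (simp add: pvi_var_def[abs_def])
qed

lemma holomorphic_on_pvi_var:
  assumes "\<And>\<eta>. \<eta> \<in> E \<Longrightarrow> \<eta> \<noteq> 0 \<and> \<eta>\<^sup>2 \<noteq> 1"
  shows "pvi_var holomorphic_on E"
  unfolding holomorphic_on_def
proof
  fix \<eta> assume "\<eta> \<in> E"
  then have "pvi_var field_differentiable at \<eta>"
    using assms pvi_var_facts(5)[of \<eta>] unfolding field_differentiable_def by blast
  then show "pvi_var field_differentiable at \<eta> within E"
    by (rule field_differentiable_at_within)
qed

text \<open>The branch formulas without the Gauss equation: the same facts serve to analyse a given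
  solution and to verify one that is being constructed.\<close>

locale hvi_branch =
  fixes D :: "complex set" and v h q :: "complex \<Rightarrow> complex" and c :: complex
  assumes D: "open D" "0 \<notin> D"
    and hol: "v holomorphic_on D" "h holomorphic_on D" "q holomorphic_on D"
    and v_nz: "\<And>\<eta>. \<eta> \<in> D \<Longrightarrow> v \<eta> \<noteq> 0" and c: "c \<noteq> 0"
    and branch: "\<And>\<eta>. \<eta> \<in> D \<Longrightarrow> nonconstant_q_branch c v h q \<eta>"
begin

lemma eta_nz: "\<eta> \<in> D \<Longrightarrow> \<eta> \<noteq> 0" using D by auto

text \<open>
  With the convention \<open>x / 0 = 0\<close> the formula for \<open>h\<close> gives \<open>h (\<plusminus>1) = 0\<close>, so it is continuity that
  excludes \<open>\<plusminus>1\<close>.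
\<close>

lemma sq_ne_1:
  assumes \<eta>: "\<eta> \<in> D"
  shows "\<eta>\<^sup>2 \<noteq> 1"
proof
  assume sq: "\<eta>\<^sup>2 = 1"
  have "isCont h \<eta>" using hol(2) D \<eta> by (intro field_differentiable_imp_continuous_at holomorphic_on_imp_differentiable_at)
  \<comment> \<open>Multiplied out, the formula for h says that this expression vanishes at the
    points of D other than 1 and -1, whereas its limit at a point with \<eta>^2 = 1 would be
    -c.\<close>
  then have "((\<lambda>x. (x\<^sup>2 - 1) * h x - c * x\<^sup>2) \<longlongrightarrow> (\<eta>\<^sup>2 - 1) * h \<eta> - c * \<eta>\<^sup>2) (at \<eta>)"
    by (intro tendsto_intros) (auto simp: isCont_def)
  moreover have "\<forall>\<^sub>F x in at \<eta>. (x\<^sup>2 - 1) * h x - c * x\<^sup>2 = 0"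
  proof -
    have "\<forall>\<^sub>F x in at \<eta>. x \<in> D" using D \<eta> by (simp add: eventually_at_topological) blast
    moreover have "\<forall>\<^sub>F x in at \<eta>. x \<noteq> 1" "\<forall>\<^sub>F x in at \<eta>. x \<noteq> -1" by (rule eventually_neq_at_within)+
    ultimately show ?thesis
    proof eventually_elim
      case (elim x)
      then have "x\<^sup>2 - 1 \<noteq> 0" by (simp add: power2_eq_1_iff)
      then show ?case using branch[of x] elim by (simp add: nonconstant_q_branch_def)
    qed
  qed
  ultimately have "(\<eta>\<^sup>2 - 1) * h \<eta> - c * \<eta>\<^sup>2 = 0"
    using tendsto_unique[OF trivial_limit_at _ tendsto_eventually] by blast
  then show False using sq c by simp
qed

lemma h_eq: "\<eta> \<in> D \<Longrightarrow> h \<eta> = c * \<eta>\<^sup>2 / (\<eta>\<^sup>2 - 1)"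
  using branch sq_ne_1 eta_nz c by (auto simp: nonconstant_q_branch_def)

lemma v_eq: "\<eta> \<in> D \<Longrightarrow> v \<eta> = (\<eta>\<^sup>2 - 1)\<^sup>2 * deriv q \<eta> / (c * \<eta>\<^sup>2)"
  using branch[of \<eta>] sq_ne_1[of \<eta>] eta_nz[of \<eta>] c
  by (simp add: nonconstant_q_branch_def h_eq field_simps power2_eq_square)

lemma q'_nz: "\<eta> \<in> D \<Longrightarrow> deriv q \<eta> \<noteq> 0"
  using v_eq v_nz by fastforce

lemma DERIV_h:
  assumes "\<eta> \<in> D"
  shows "(h has_field_derivative - 2 * c * \<eta> / (\<eta>\<^sup>2 - 1)\<^sup>2) (at \<eta>)"
proof -
  have "((\<lambda>\<eta>. c * \<eta>\<^sup>2 / (\<eta>\<^sup>2 - 1)) has_field_derivative - 2 * c * \<eta> / (\<eta>\<^sup>2 - 1)\<^sup>2) (at \<eta>)"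
    using sq_ne_1[OF assms]
    by (auto intro!: derivative_eq_intros simp: power2_eq_square divide_simps) (simp add: algebra_simps)
  then show ?thesis
    by (rule has_field_derivative_transform_within_open[OF _ D(1) assms]) (simp add: h_eq)
qed

lemma codazzi:
  assumes "\<eta> \<in> D"
  shows "codazzi_eqs v h q \<eta>"
proof -
  have nz: "\<eta>\<^sup>2 - 1 \<noteq> 0" "\<eta> \<noteq> 0" using sq_ne_1 eta_nz assms by auto
  have "\<eta> * (v \<eta> * deriv h \<eta>) = - 2 * deriv q \<eta>" "v \<eta> * h \<eta> = (\<eta>\<^sup>2 - 1) * deriv q \<eta>"
    using nz c unfolding DERIV_imp_deriv[OF DERIV_h[OF assms]] v_eq[OF assms] h_eq[OF assms]
    by (simp_all add: divide_simps) (simp_all add: power2_eq_square)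
  then show ?thesis
    unfolding codazzi_eqs_def by (intro conjI; algebra)
qed

lemma pm1_notin: "1 \<notin> D" "-1 \<notin> D"
  using sq_ne_1[of 1] sq_ne_1[of "-1"] by auto

end

text \<open>Used in both directions: either Y is q transported along an inverse of
  \<open>pvi_var\<close>, or Y is a Hamiltonian and q is defined from it.\<close>

locale hvi_branch_sigma = hvi_branch +
  fixes E S :: "complex set" and Y :: "complex \<Rightarrow> complex"
  assumes E: "open E" "E \<subseteq> D" and S: "open S" "pvi_var ` E \<subseteq> S" and Y: "Y holomorphic_on S"
    and q_Y: "\<And>\<eta>. \<eta> \<in> E \<Longrightarrow> q \<eta> = - (8 / c) * Y (pvi_var \<eta>)"
begin

lemma X_in: "\<eta> \<in> E \<Longrightarrow> pvi_var \<eta> \<in> S" using S by auto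

lemma X_facts:
  assumes "\<eta> \<in> E"
  shows "pvi_var \<eta> \<noteq> 0" "pvi_var \<eta> \<noteq> 1" "\<eta>\<^sup>2 = (pvi_var \<eta> - 1) / pvi_var \<eta>"
    "1 - \<eta>\<^sup>2 = 1 / pvi_var \<eta>" "(pvi_var has_field_derivative 2 * \<eta> * (pvi_var \<eta>)\<^sup>2) (at \<eta>)"
  using pvi_var_facts[of \<eta>] eta_nz sq_ne_1 assms E by auto

lemma DERIV_comp:
  assumes "\<eta> \<in> E" "f holomorphic_on S"
  shows "((\<lambda>s. f (pvi_var s)) has_field_derivative deriv f (pvi_var \<eta>) * (2 * \<eta> * (pvi_var \<eta>)\<^sup>2)) (at \<eta>)"
  using DERIV_chain2[OF holomorphic_derivI[OF assms(2) S(1) X_in[OF assms(1)]] X_facts(5)[OF assms(1)]] .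

text \<open>By the chain rule q' contains the derivative 2 \<eta> X^2 of \<open>pvi_var\<close>, and
  its X^2 cancels the factor \<open>(\<eta>\<^sup>2 - 1)\<^sup>2 = 1 / X\<^sup>2\<close> in
  \<open>v_eq\<close>.\<close>

lemma v_Y:
  assumes "\<eta> \<in> E"
  shows "v \<eta> = - 16 * deriv Y (pvi_var \<eta>) / (c\<^sup>2 * \<eta>)"
proof -
  have "(q has_field_derivative - (8 / c) * (deriv Y (pvi_var \<eta>) * (2 * \<eta> * (pvi_var \<eta>)\<^sup>2))) (at \<eta>)"
    by (rule has_field_derivative_transform_within_open[OF DERIV_cmult[OF DERIV_comp[OF assms Y]] E(1) assms])
       (simp add: q_Y)
  then have q': "deriv q \<eta> = - (8 / c) * (deriv Y (pvi_var \<eta>) * (2 * \<eta> * (pvi_var \<eta>)\<^sup>2))"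
    by (rule DERIV_imp_deriv)
  have "(\<eta>\<^sup>2 - 1)\<^sup>2 = 1 / (pvi_var \<eta>)\<^sup>2"
    using X_facts(4)[OF assms] by (metis power2_commute power_divide power_one)
  then have "v \<eta> = 1 / (pvi_var \<eta>)\<^sup>2 * (- (8 / c) * (deriv Y (pvi_var \<eta>) * (2 * \<eta> * (pvi_var \<eta>)\<^sup>2))) / (c * \<eta>\<^sup>2)"
    using v_eq[of \<eta>] E assms unfolding q' by auto
  also have "\<dots> = - 16 * deriv Y (pvi_var \<eta>) / (c\<^sup>2 * \<eta>)"
    using X_facts(1)[OF assms] by (simp add: power2_eq_square)
  finally show ?thesis .
qed

lemma Y'_nz: "\<eta> \<in> E \<Longrightarrow> deriv Y (pvi_var \<eta>) \<noteq> 0"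
  using v_Y[of \<eta>] v_nz[of \<eta>] E by auto

lemma h_Y: "\<eta> \<in> E \<Longrightarrow> h \<eta> = - c * (pvi_var \<eta> - 1)"
proof -
  assume *: "\<eta> \<in> E"
  have "\<eta>\<^sup>2 - 1 = - (1 / pvi_var \<eta>)" using X_facts(4)[OF *] by (simp add: algebra_simps)
  then show ?thesis
    using h_eq[of \<eta>] X_facts(1,3)[OF *] E * by auto
qed

text \<open>The factor 1 / \<eta> in \<open>v_Y\<close> contributes -1 to the logarithmic derivative
  of v and so absorbs the summand 1 of the first integral; the rest carries
  \<open>\<eta>\<^sup>2 * X\<^sup>2 = X * (X - 1)\<close>.\<close>

lemma Y''_eq:
  assumes "\<eta> \<in> E"
  shows "\<eta> * deriv v \<eta> / v \<eta> + 1 =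
    2 * (pvi_var \<eta> * (pvi_var \<eta> - 1) * deriv (deriv Y) (pvi_var \<eta>) / deriv Y (pvi_var \<eta>))"
proof -
  let ?X = "pvi_var \<eta>"
  have nz: "\<eta> \<noteq> 0" using assms E eta_nz by auto
  have "((\<lambda>s. - 16 * deriv Y (pvi_var s) / (c\<^sup>2 * s)) has_field_derivative
     - 16 / c\<^sup>2 * (deriv (deriv Y) ?X * (2 * ?X\<^sup>2) - deriv Y ?X / \<eta>\<^sup>2)) (at \<eta>)"
    by (rule derivative_eq_intros DERIV_comp[OF assms holomorphic_deriv[OF Y S(1)]] refl)+
       (use nz c in \<open>auto simp: field_simps power2_eq_square\<close>)
  then have "(v has_field_derivative - 16 / c\<^sup>2 * (deriv (deriv Y) ?X * (2 * ?X\<^sup>2) - deriv Y ?X / \<eta>\<^sup>2)) (at \<eta>)"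
    by (rule has_field_derivative_transform_within_open[OF _ E(1) assms]) (simp add: v_Y)
  then have "deriv v \<eta> = - 16 / c\<^sup>2 * (deriv (deriv Y) ?X * (2 * ?X\<^sup>2) - deriv Y ?X / \<eta>\<^sup>2)"
    by (rule DERIV_imp_deriv)
  note v' = this
  have "\<eta> * deriv v \<eta> / v \<eta> + 1 = 2 * (\<eta>\<^sup>2 * ?X\<^sup>2) * deriv (deriv Y) ?X / deriv Y ?X"
    unfolding v' v_Y[OF assms] using Y'_nz[OF assms] nz c
    by (simp add: divide_simps) (simp add: algebra_simps power2_eq_square)
  also have "\<eta>\<^sup>2 * ?X\<^sup>2 = ?X * (?X - 1)"
    using X_facts(1,3)[OF assms] by (simp add: power2_eq_square)
  finally show ?thesis by simp
qed

text \<open>The terms translate one by one through \<open>h = - c * (X - 1)\<close>,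
  \<open>\<eta> * v = - 16 * Y' / c\<^sup>2\<close> and \<open>\<eta>\<^sup>2 = (X - 1) / X\<close>;
  the two products of h and q combine into the factor 2 X - 1.\<close>

lemma first_integral_iff:
  assumes "\<eta> \<in> E"
  shows "first_integral v h q \<eta> = sigma_integral Y (pvi_var \<eta>)"
proof -
  let ?X = "pvi_var \<eta>"
  have nz: "\<eta> \<noteq> 0" using assms E eta_nz by auto
  define Z where "Z = ?X - 1"
  have XZ: "?X = Z + 1" "Z \<noteq> 0" "Z + 1 \<noteq> 0" using X_facts(1,2)[OF assms] by (auto simp: Z_def)
  have s: "\<eta>\<^sup>2 = Z / ?X" using X_facts(3)[OF assms] by (simp add: Z_def)
  have v\<eta>: "\<eta> * v \<eta> = - 16 * deriv Y ?X / c\<^sup>2" using v_Y[OF assms] nz by simp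
  have "(h \<eta>)\<^sup>2 * v \<eta> / \<eta> = (h \<eta>)\<^sup>2 * (\<eta> * v \<eta>) / \<eta>\<^sup>2"
    using nz by (simp add: power2_eq_square)
  also have "\<dots> = - 16 * ?X * Z * deriv Y ?X"
    unfolding v\<eta> s h_Y[OF assms] Z_def[symmetric] using c XZ(2) by (simp add: power2_eq_square field_simps)
  finally have 1: "(h \<eta>)\<^sup>2 * v \<eta> / \<eta> = - 16 * ?X * Z * deriv Y ?X" .
  have 2: "2 * h \<eta> * q \<eta> = 16 * Z * Y ?X"
    unfolding h_Y[OF assms] q_Y[OF assms] Z_def[symmetric] using c by simp
  have 3: "2 * h \<eta> * q \<eta> / \<eta>\<^sup>2 = 16 * ?X * Y ?X"
    unfolding 2 s using XZ by simp
  have 4: "4 * (q \<eta>)\<^sup>2 / (\<eta> * v \<eta>) = - 16 * (Y ?X)\<^sup>2 / deriv Y ?X"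
    unfolding v\<eta> q_Y[OF assms] using c Y'_nz[OF assms] by (simp add: power2_eq_square)
  show ?thesis
    unfolding first_integral_def Y''_eq[OF assms] 1 3 4 unfolding 2 sigma_integral_def Z_def
    by (simp add: algebra_simps power2_eq_square)
qed

lemma gauss_iff:
  assumes "\<eta> \<in> E" and S': "0 \<notin> S" "1 \<notin> S" "\<And>X. X \<in> S \<Longrightarrow> deriv Y X \<noteq> 0"
  shows "gauss_eq v h q \<eta> \<longleftrightarrow> sigma_gauss Y (pvi_var \<eta>)"
proof -
  let ?X = "pvi_var \<eta>" and ?G = "\<lambda>x. x * (x - 1) * deriv (deriv Y) x / deriv Y x"
  have nz: "\<eta> \<noteq> 0" using assms E eta_nz by auto
  define Z where "Z = ?X - 1"
  have XZ: "?X = Z + 1" "Z \<noteq> 0" "?X \<noteq> 0" using X_facts(1,2)[OF assms(1)] by (auto simp: Z_def)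
  have s: "\<eta>\<^sup>2 = Z / ?X" using X_facts(3)[OF assms(1)] by (simp add: Z_def)
  have v\<eta>: "\<eta> * v \<eta> = - 16 * deriv Y ?X / c\<^sup>2" using v_Y[OF assms(1)] nz by simp
  have "?G holomorphic_on S"
    using Y S S' by (auto intro!: holomorphic_intros holomorphic_deriv)
  from DERIV_diff[OF DERIV_cmult[OF DERIV_comp[OF assms(1) this]] DERIV_const]
  have "((\<lambda>s. 2 * ?G (pvi_var s) - 1) has_field_derivative 2 * (deriv ?G ?X * (2 * \<eta> * ?X\<^sup>2)) - 0) (at \<eta>)" .
  then have "((\<lambda>s. s * deriv v s / v s) has_field_derivative 2 * (deriv ?G ?X * (2 * \<eta> * ?X\<^sup>2)) - 0) (at \<eta>)"
    by (rule has_field_derivative_transform_within_open[OF _ E(1) assms(1)]) (simp only: Y''_eq[symmetric], simp)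
  then have 1: "\<eta> * deriv (\<lambda>s. s * deriv v s / v s) \<eta> = 4 * \<eta>\<^sup>2 * ?X\<^sup>2 * deriv ?G ?X"
    by (simp add: DERIV_imp_deriv power2_eq_square)
  have "\<eta> * ((h \<eta>)\<^sup>2 / (2 * \<eta>\<^sup>2) * v \<eta>) = (h \<eta>)\<^sup>2 * (\<eta> * v \<eta>) / (2 * \<eta>\<^sup>2)"
    using nz by (simp add: power2_eq_square)
  also have "\<dots> = - 8 * ?X * Z * deriv Y ?X"
    unfolding v\<eta> s h_Y[OF assms(1)] Z_def[symmetric] using c XZ(2) by (simp add: power2_eq_square field_simps)
  finally have 2: "\<eta> * ((h \<eta>)\<^sup>2 / (2 * \<eta>\<^sup>2) * v \<eta>) = - 8 * ?X * Z * deriv Y ?X" .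
  have "\<eta> * (2 * (q \<eta>)\<^sup>2 / (\<eta>\<^sup>2 * v \<eta>)) = 2 * (q \<eta>)\<^sup>2 / (\<eta> * v \<eta>)"
    using nz by (simp add: power2_eq_square)
  also have "\<dots> = - 8 * (Y ?X)\<^sup>2 / deriv Y ?X"
    unfolding v\<eta> q_Y[OF assms(1)] using c Y'_nz[OF assms(1)] by (simp add: power2_eq_square)
  finally have 3: "\<eta> * (2 * (q \<eta>)\<^sup>2 / (\<eta>\<^sup>2 * v \<eta>)) = - 8 * (Y ?X)\<^sup>2 / deriv Y ?X" .
  have "gauss_eq v h q \<eta> \<longleftrightarrow> \<eta> * deriv (\<lambda>s. s * deriv v s / v s) \<eta>
      - \<eta> * ((h \<eta>)\<^sup>2 / (2 * \<eta>\<^sup>2) * v \<eta>) + \<eta> * (2 * (q \<eta>)\<^sup>2 / (\<eta>\<^sup>2 * v \<eta>)) = 0"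
    unfolding gauss_eq_def right_diff_distrib[symmetric] distrib_left[symmetric] using nz by simp
  also have "\<dots> \<longleftrightarrow> 4 * (?X * Z * deriv ?G ?X + 2 * ?X * Z * deriv Y ?X - 2 * (Y ?X)\<^sup>2 / deriv Y ?X) = 0"
    unfolding 1 2 3 unfolding s using XZ(3) by (simp add: algebra_simps power2_eq_square)
  also have "\<dots> \<longleftrightarrow> sigma_gauss Y ?X"
    unfolding sigma_gauss_def Z_def by (subst mult_eq_0_iff) simp
  finally show ?thesis .
qed

end

section \<open>The Hamiltonian along a Painleve solution\<close>

locale painleve_hamiltonian =
  fixes S :: "complex set" and V :: "complex \<Rightarrow> complex" and t :: complex
  assumes PVI: "painleve_VI_on S 0 t t 1 V"
begin

definition Y :: "complex \<Rightarrow> complex" where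
  "Y X = X * (X - 1) * H_VI 0 t t 1 X (V X) (deriv V X)"

definition G :: "complex \<Rightarrow> complex" where
  "G X = X * (X - 1) * deriv V X / (X - V X)"

text \<open>The candidate for Y', obtained by solving the first integral t^2 = G^2 + 4 Y' V (V - 1)
  before anything is known about the derivative of Y; likewise \<open>G\<close> is the candidate for
  \<open>log_slope\<close>.\<close>

definition slope :: "complex \<Rightarrow> complex" where
  "slope X = (t\<^sup>2 - (G X)\<^sup>2) / (4 * V X * (V X - 1))"

lemma S: "open S" and hol_V: "V holomorphic_on S"
  and nz: "X \<in> S \<Longrightarrow> X \<noteq> 0" "X \<in> S \<Longrightarrow> X - 1 \<noteq> 0" "X \<in> S \<Longrightarrow> V X \<noteq> 0" "X \<in> S \<Longrightarrow> V X - 1 \<noteq> 0" "X \<in> S \<Longrightarrow> X - V X \<noteq> 0"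
  and PVI': "X \<in> S \<Longrightarrow> deriv (deriv V) X = painleve_VI_rhs 0 t t 1 X (V X) (deriv V X)"
  using PVI by (auto simp: painleve_VI_on_def)

lemma hol_G: "G holomorphic_on S"
  unfolding G_def using hol_V S nz by (auto intro!: holomorphic_intros holomorphic_deriv)

lemma hol_slope: "slope holomorphic_on S"
  unfolding slope_def using hol_V hol_G nz by (auto intro!: holomorphic_intros)

lemma Y_eq: "X \<in> S \<Longrightarrow> Y X = (X - V X) * slope X"
  using H_VI_special[of X "V X" t "deriv V X"] nz[of X] by (auto simp: Y_def slope_def G_def)

lemma hol_Y: "Y holomorphic_on S"
proof -
  have "(\<lambda>X. (X - V X) * slope X) holomorphic_on S"
    using hol_V hol_slope by (intro holomorphic_intros)
  then show ?thesis by (rule holomorphic_transform) (simp add: Y_eq)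
qed

lemma DERIV_V:
  assumes "X \<in> S"
  shows "(V has_field_derivative deriv V X) (at X)"
    "(deriv V has_field_derivative deriv (deriv V) X) (at X)"
  using holomorphic_derivI[OF hol_V S assms] holomorphic_derivI[OF holomorphic_deriv[OF hol_V S] S assms] .

lemma V'_eq: "X \<in> S \<Longrightarrow> deriv V X = G X * (X - V X) / (X * (X - 1))"
  using nz[of X] by (simp add: G_def)

lemma t2: "X \<in> S \<Longrightarrow> t\<^sup>2 = (G X)\<^sup>2 + 4 * slope X * V X * (V X - 1)"
proof -
  assume "X \<in> S"
  then have "4 * V X * (V X - 1) \<noteq> 0" using nz[of X] by simp
  then have "slope X * (4 * V X * (V X - 1)) = t\<^sup>2 - (G X)\<^sup>2"
    by (rule iffD1[OF nonzero_eq_divide_eq slope_def])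
  then show ?thesis by (simp add: algebra_simps)
qed

text \<open>\<open>pvi_algebra\<close> read backwards: the Painleve equation gives V'' in the form
  found there, and the quotient rule applied to G = X (X - 1) V' / (X - V) returns the value of G'
  that was put in. This is the Gauss equation with \<open>slope\<close> in place of Y'.\<close>

lemma DERIV_G:
  assumes "X \<in> S"
  shows "(G has_field_derivative
    (2 * (X - V X)\<^sup>2 * slope X - 2 * (X * (X - 1)) * slope X) / (X * (X - 1))) (at X)"
proof -
  note n = nz[OF assms]
  define T d A g where "T = X * (X - 1)" and "d = X - V X"
    and "A = (2 * (X - V X)\<^sup>2 * slope X - 2 * (X * (X - 1)) * slope X) / (X * (X - 1))"
    and "g = G X"
  have Td: "T \<noteq> 0" "d \<noteq> 0" using n by (auto simp: T_def d_def)
  have V': "deriv V X = g * d / T" using V'_eq[OF assms] by (simp add: g_def d_def T_def)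
  have V'': "deriv (deriv V) X = (A * d + g * (1 - g * d / T)) / T - g * d * (2 * X - 1) / T\<^sup>2"
    using pvi_algebra[OF refl refl, of X "V X" t "G X" "slope X"] n t2[OF assms] PVI'[OF assms] V'
    by (simp add: g_def d_def T_def A_def)
  have "(G has_field_derivative (((2 * X - 1) * deriv V X + T * deriv (deriv V) X) * d
      - T * deriv V X * (1 - deriv V X)) / (d * d)) (at X)"
    unfolding G_def[abs_def] T_def d_def
    by (rule derivative_eq_intros DERIV_V assms refl)+ (use n in \<open>auto simp: algebra_simps\<close>)
  also have "((2 * X - 1) * deriv V X + T * deriv (deriv V) X) * d
      - T * deriv V X * (1 - deriv V X) = A * (d * d)"
    unfolding V'' V' using Td by (simp add: divide_simps) (simp add: algebra_simps power2_eq_square)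
  finally show ?thesis using Td by (simp add: A_def)
qed

lemma DERIV_slope:
  assumes "X \<in> S"
  shows "(slope has_field_derivative G X * slope X / (X * (X - 1))) (at X)"
proof -
  note n = nz[OF assms]
  define T d W y g where "T = X * (X - 1)" and "d = X - V X" and "W = V X" and "y = slope X" and "g = G X"
  have TW: "T \<noteq> 0" "W \<noteq> 0" "W - 1 \<noteq> 0" using n by (auto simp: T_def W_def)
  have y: "t\<^sup>2 - g\<^sup>2 = 4 * y * W * (W - 1)" using t2[OF assms] by (simp add: y_def W_def g_def)
  \<comment> \<open>The left-hand side is the common factor that the derivatives of t^2 - G^2 and of
    4 V (V - 1) produce together; being V (V - 1), it cancels against the denominator.\<close>
  have TX: "T - d\<^sup>2 - (2 * W - 1) * d = W * (W - 1)"
    by (simp add: T_def d_def W_def power2_eq_square algebra_simps)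
  have G': "(G has_field_derivative (2 * d\<^sup>2 * y - 2 * T * y) / T) (at X)"
    using DERIV_G[OF assms] by (simp add: T_def d_def y_def)
  have V': "(V has_field_derivative g * d / T) (at X)"
    using DERIV_V(1)[OF assms] V'_eq[OF assms] by (simp add: T_def d_def g_def)
  have N: "((\<lambda>X. t\<^sup>2 - (G X)\<^sup>2) has_field_derivative - (2 * g * ((2 * d\<^sup>2 * y - 2 * T * y) / T))) (at X)"
    by (rule derivative_eq_intros G' refl)+ (simp add: g_def)
  have Dn: "((\<lambda>X. 4 * V X * (V X - 1)) has_field_derivative 4 * (2 * W - 1) * e) (at X)"
    if "(V has_field_derivative e) (at X)" for e
    by (rule derivative_eq_intros that refl)+ (simp add: W_def algebra_simps)
  have "(slope has_field_derivative (- (2 * g * ((2 * d\<^sup>2 * y - 2 * T * y) / T)) * (4 * W * (W - 1))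
      - (t\<^sup>2 - g\<^sup>2) * (4 * (2 * W - 1) * (g * d / T))) / ((4 * W * (W - 1)) * (4 * W * (W - 1)))) (at X)"
    unfolding slope_def[abs_def] W_def g_def
    by (rule DERIV_divide[OF N Dn[OF V'], unfolded W_def g_def]) (use n in simp)
  also have "- (2 * g * ((2 * d\<^sup>2 * y - 2 * T * y) / T)) * (4 * W * (W - 1))
      - (t\<^sup>2 - g\<^sup>2) * (4 * (2 * W - 1) * (g * d / T))
    = 16 * W * (W - 1) * (g * y / T) * (T - d\<^sup>2 - (2 * W - 1) * d)"
    unfolding y using TW by (simp add: divide_simps) (simp add: algebra_simps power2_eq_square)
  also have "\<dots> / ((4 * W * (W - 1)) * (4 * W * (W - 1))) = g * y / T"
    unfolding TX using TW by simp
  finally show ?thesis by (simp add: T_def g_def y_def)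
qed

text \<open>In the product (X - V) times \<open>slope\<close> the contributions of V' = G (X - V) /
  T and of the derivative G \<open>slope\<close> / T of the second factor cancel, where T = X (X -
  1).\<close>

lemma DERIV_Y:
  assumes "X \<in> S"
  shows "(Y has_field_derivative slope X) (at X)"
proof -
  have "((\<lambda>X. (X - V X) * slope X) has_field_derivative slope X) (at X)"
    by (rule derivative_eq_intros DERIV_V DERIV_slope assms refl)+
       (use V'_eq[OF assms] in \<open>simp add: algebra_simps\<close>)
  then show ?thesis
    by (rule has_field_derivative_transform_within_open[OF _ S assms]) (simp add: Y_eq)
qed

lemma deriv_Y: "X \<in> S \<Longrightarrow> deriv Y X = slope X"
  by (rule DERIV_imp_deriv) (rule DERIV_Y)

lemma deriv_deriv_Y:
  assumes "X \<in> S"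
  shows "deriv (deriv Y) X = G X * slope X / (X * (X - 1))"
proof -
  have "deriv (deriv Y) X = deriv slope X"
    by (rule deriv_cong_ev) (use assms S deriv_Y in \<open>auto simp: eventually_nhds\<close>)
  then show ?thesis using DERIV_imp_deriv[OF DERIV_slope[OF assms]] by simp
qed

lemma V_eq:
  assumes "X \<in> S" "deriv Y X \<noteq> 0"
  shows "V X = X - Y X / deriv Y X"
  using assms deriv_Y[of X] Y_eq[of X] by simp

text \<open>The two constructions are mutually inverse where Y' has no zeros:
  \<open>pvi_function\<close> returns V and \<open>log_slope\<close> returns G. Hence
  \<open>DERIV_G\<close> is the Gauss equation and \<open>t2\<close> the first integral with K = 4
  t^2.\<close>

lemma sigma:
  assumes Y': "\<And>X. X \<in> S \<Longrightarrow> deriv Y X \<noteq> 0" and X: "X \<in> S"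
  shows "sigma_gauss Y X" "sigma_integral Y X = 4 * t\<^sup>2"
proof -
  interpret sigma_form S Y
    using S nz hol_Y Y' by unfold_locales auto
  have pf: "pvi_function X = V X" using V_eq[OF X Y'[OF X]] by (simp add: pvi_function_def)
  have ls: "log_slope x = G x" if "x \<in> S" for x
    using nz[OF that] Y'[OF that] deriv_deriv_Y[OF that] deriv_Y[OF that] by (simp add: log_slope_def)
  have "deriv log_slope X = deriv G X"
    by (rule deriv_cong_ev) (use X S ls in \<open>auto simp: eventually_nhds\<close>)
  then show "sigma_gauss Y X"
    using DERIV_imp_deriv[OF DERIV_G[OF X]] deriv_Y[OF X] unfolding sigma_gauss_iff[OF X] pf by simp
  show "sigma_integral Y X = 4 * t\<^sup>2"
    using t2[OF X] ls[OF X] deriv_Y[OF X] unfolding sigma_integral_eq[OF X] pf by simp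
qed

end

section \<open>First integral, Codazzi equations and harmonicity\<close>

lemma constant_if_deriv_zero:
  assumes "open D" "connected D" "\<And>\<eta>. \<eta> \<in> D \<Longrightarrow> (f has_field_derivative 0) (at \<eta>)"
  shows "\<exists>K. \<forall>\<eta>\<in>D. f \<eta> = (K :: complex)"
proof -
  have "f constant_on D"
    by (rule has_field_derivative_0_imp_constant_on[OF assms(3,2,1)])
  then show ?thesis by (auto simp: constant_on_def)
qed

lemma codazzi_solved:
  assumes "codazzi_eqs v h q \<eta>" "\<eta> \<noteq> 0"
  shows "\<eta> * v \<eta> * deriv h \<eta> = - 2 * deriv q \<eta>" "v \<eta> * h \<eta> = (\<eta>\<^sup>2 - 1) * deriv q \<eta>"
proof -
  have *: "- \<eta> * v \<eta> * deriv h \<eta> - 2 * \<eta>\<^sup>2 * deriv q \<eta> + 2 * v \<eta> * h \<eta> = 0"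
    "- \<eta>\<^sup>2 * v \<eta> * deriv h \<eta> - 2 * \<eta> * deriv q \<eta> = 0"
    using assms(1) by (auto simp: codazzi_eqs_def)
  have "\<eta> * (\<eta> * v \<eta> * deriv h \<eta>) = \<eta> * (- 2 * deriv q \<eta>)" using *(2) by algebra
  then show 1: "\<eta> * v \<eta> * deriv h \<eta> = - 2 * deriv q \<eta>"
    using mult_left_cancel[OF assms(2)] by blast
  have "2 * (v \<eta> * h \<eta>) = 2 * ((\<eta>\<^sup>2 - 1) * deriv q \<eta>)" using *(1) 1 by algebra
  then show "v \<eta> * h \<eta> = (\<eta>\<^sup>2 - 1) * deriv q \<eta>" by simp
qed

text \<open>The Gauss equation supplies the derivative of \<eta> v' / v, after which the terms in v'
  cancel among themselves; the Codazzi equations express h and h' through v and q' and cancel the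
  rest.\<close>

lemma first_integral_const:
  assumes "profile_functions D v h q" "reduced_GC D v h q"
  shows "\<exists>K. \<forall>\<eta>\<in>D. first_integral v h q \<eta> = K"
proof -
  have D: "open D" "connected D" "0 \<notin> D" and hol: "v holomorphic_on D" "h holomorphic_on D" "q holomorphic_on D"
    and v_nz: "\<And>\<eta>. \<eta> \<in> D \<Longrightarrow> v \<eta> \<noteq> 0"
    using assms(1) by (auto simp: profile_functions_def)
  show ?thesis
  proof (rule constant_if_deriv_zero[OF D(1,2)])
    fix \<eta> assume \<eta>: "\<eta> \<in> D"
    have nz: "\<eta> \<noteq> 0" "v \<eta> \<noteq> 0" using D \<eta> v_nz by auto
    note DV = holomorphic_derivI[OF hol(1) D(1) \<eta>] and Dh = holomorphic_derivI[OF hol(2) D(1) \<eta>]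
      and Dq = holomorphic_derivI[OF hol(3) D(1) \<eta>]
    have "(\<lambda>s. s * deriv v s / v s) holomorphic_on D"
      using hol D v_nz by (auto intro!: holomorphic_intros holomorphic_deriv)
    note DU = holomorphic_derivI[OF this D(1) \<eta>]
    define a b d where "a = v \<eta>" and "b = h \<eta>" and "d = q \<eta>"
    define a' b' d' where "a' = deriv v \<eta>" and "b' = deriv h \<eta>" and "d' = deriv q \<eta>"
    have gauss: "deriv (\<lambda>s. s * deriv v s / v s) \<eta> = b\<^sup>2 / (2 * \<eta>\<^sup>2) * a - 2 * d\<^sup>2 / (\<eta>\<^sup>2 * a)"
      using assms(2) \<eta> by (simp add: reduced_GC_def gauss_eq_def a_def b_def d_def algebra_simps)
    have DU1: "((\<lambda>s. s * deriv v s / v s + 1) has_field_derivative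
        (b\<^sup>2 / (2 * \<eta>\<^sup>2) * a - 2 * d\<^sup>2 / (\<eta>\<^sup>2 * a)) + 0) (at \<eta>)"
      using DERIV_add[OF DU DERIV_const] unfolding gauss .
    have cod: "b' = - 2 * d' / (\<eta> * a)" "b * a = (\<eta>\<^sup>2 - 1) * d'"
      using codazzi_solved[of v h q \<eta>] assms(2) \<eta> nz
      by (simp_all add: reduced_GC_def a_def b_def d_def b'_def d'_def field_simps)
    have "(first_integral v h q has_field_derivative
        of_nat 2 * ((b\<^sup>2 / (2 * \<eta>\<^sup>2) * a - 2 * d\<^sup>2 / (\<eta>\<^sup>2 * a) + 0) * (\<eta> * a' / a + 1) ^ (2 - Suc 0))
        - ((2 * b * b' * a + b\<^sup>2 * a') * \<eta> - b\<^sup>2 * a) / \<eta>\<^sup>2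
        - 2 * (b' * d + b * d')
        - (2 * (b' * d + b * d') * \<eta>\<^sup>2 - 2 * b * d * (2 * \<eta>)) / (\<eta>\<^sup>2)\<^sup>2
        - (8 * d * d' * (\<eta> * a) - 4 * d\<^sup>2 * (a + \<eta> * a')) / (\<eta> * a)\<^sup>2) (at \<eta>)"
      unfolding first_integral_def[abs_def] a_def b_def d_def a'_def b'_def d'_def
      apply (rule DERIV_diff)+
      subgoal by (rule DERIV_power[OF DU1[unfolded a_def b_def d_def]])
      subgoal by (rule derivative_eq_intros DV Dh refl nz)+ (simp add: power2_eq_square algebra_simps)
      subgoal by (rule derivative_eq_intros Dq Dh refl nz)+ (simp add: algebra_simps)
      subgoal by (rule derivative_eq_intros Dq Dh refl)+ (use nz in \<open>simp_all add: power2_eq_square algebra_simps\<close>)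
      subgoal by (rule derivative_eq_intros Dq DV refl)+ (use nz in \<open>simp_all add: power2_eq_square algebra_simps\<close>)
      done
    also have "of_nat 2 * ((b\<^sup>2 / (2 * \<eta>\<^sup>2) * a - 2 * d\<^sup>2 / (\<eta>\<^sup>2 * a) + 0) * (\<eta> * a' / a + 1) ^ (2 - Suc 0))
        - ((2 * b * b' * a + b\<^sup>2 * a') * \<eta> - b\<^sup>2 * a) / \<eta>\<^sup>2
        - 2 * (b' * d + b * d')
        - (2 * (b' * d + b * d') * \<eta>\<^sup>2 - 2 * b * d * (2 * \<eta>)) / (\<eta>\<^sup>2)\<^sup>2
        - (8 * d * d' * (\<eta> * a) - 4 * d\<^sup>2 * (a + \<eta> * a')) / (\<eta> * a)\<^sup>2 = 0"
    proof -
      have "a \<noteq> 0" using nz by (simp add: a_def)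
      have b: "b = (\<eta>\<^sup>2 - 1) * d' / a" using cod(2) \<open>a \<noteq> 0\<close> by (simp add: field_simps)
      show ?thesis
        unfolding cod(1) b using nz(1) \<open>a \<noteq> 0\<close>
        by (simp add: divide_simps) algebra
    qed
    finally show "(first_integral v h q has_field_derivative 0) (at \<eta>)" .
  qed
qed

lemma profile_hvi_branch:
  assumes "profile_functions D v h q" "c \<noteq> 0" "\<forall>\<eta>\<in>D. nonconstant_q_branch c v h q \<eta>"
  shows "hvi_branch D v h q c"
  using assms by unfold_locales (auto simp: profile_functions_def)

text \<open>Eliminating q' leaves the linear equation \<eta> (\<eta>^2 - 1) h' + 2 h = 0, so that h
  (\<eta>^2 - 1) / \<eta>^2 is constant. A single point with q' \<noteq> 0 makes the constant
  nonzero, and then q' vanishes nowhere.\<close>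

lemma codazzi_branch_iff:
  assumes pf: "profile_functions D v h q"
  shows "((\<forall>\<eta>\<in>D. codazzi_eqs v h q \<eta>) \<and> (\<exists>\<eta>\<in>D. deriv q \<eta> \<noteq> 0)) \<longleftrightarrow>
      (\<exists>c. c \<noteq> 0 \<and> (\<forall>\<eta>\<in>D. nonconstant_q_branch c v h q \<eta>))"
proof
  assume "\<exists>c. c \<noteq> 0 \<and> (\<forall>\<eta>\<in>D. nonconstant_q_branch c v h q \<eta>)"
  then obtain c where "hvi_branch D v h q c" using profile_hvi_branch[OF pf] by blast
  then interpret hvi_branch D v h q c .
  show "(\<forall>\<eta>\<in>D. codazzi_eqs v h q \<eta>) \<and> (\<exists>\<eta>\<in>D. deriv q \<eta> \<noteq> 0)"
    using codazzi q'_nz pf by (auto simp: profile_functions_def)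
next
  assume asm: "(\<forall>\<eta>\<in>D. codazzi_eqs v h q \<eta>) \<and> (\<exists>\<eta>\<in>D. deriv q \<eta> \<noteq> 0)"
  have D: "open D" "connected D" "0 \<notin> D" and hol: "h holomorphic_on D"
    and v_nz: "\<And>\<eta>. \<eta> \<in> D \<Longrightarrow> v \<eta> \<noteq> 0"
    using pf by (auto simp: profile_functions_def)
  have nz: "\<eta> \<noteq> 0" if "\<eta> \<in> D" for \<eta> using that D by auto
  note cod = codazzi_solved[of v h q, OF asm[THEN conjunct1, rule_format] nz]
  have "\<exists>K. \<forall>\<eta>\<in>D. h \<eta> * (\<eta>\<^sup>2 - 1) / \<eta>\<^sup>2 = K"
  proof (rule constant_if_deriv_zero[OF D(1,2)])
    fix \<eta> assume \<eta>: "\<eta> \<in> D"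
    have "v \<eta> * (\<eta> * (\<eta>\<^sup>2 - 1) * deriv h \<eta> + 2 * h \<eta>) = 0"
      using cod[OF \<eta> \<eta>] by algebra
    then have "\<eta> * (\<eta>\<^sup>2 - 1) * deriv h \<eta> + 2 * h \<eta> = 0" using v_nz[OF \<eta>] by simp
    then have e: "((deriv h \<eta> * (\<eta>\<^sup>2 - 1) + h \<eta> * (2 * \<eta>)) * \<eta>\<^sup>2 - h \<eta> * (\<eta>\<^sup>2 - 1) * (2 * \<eta>)) / (\<eta>\<^sup>2 * \<eta>\<^sup>2) = 0"
      using nz[OF \<eta>] by (simp add: divide_simps) algebra
    have "((\<lambda>\<eta>. h \<eta> * (\<eta>\<^sup>2 - 1) / \<eta>\<^sup>2) has_field_derivative
      ((deriv h \<eta> * (\<eta>\<^sup>2 - 1) + h \<eta> * (2 * \<eta>)) * \<eta>\<^sup>2 - h \<eta> * (\<eta>\<^sup>2 - 1) * (2 * \<eta>)) / (\<eta>\<^sup>2 * \<eta>\<^sup>2)) (at \<eta>)"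
      by (rule derivative_eq_intros holomorphic_derivI[OF hol D(1) \<eta>] refl)+ (use nz[OF \<eta>] in auto)
    then show "((\<lambda>\<eta>. h \<eta> * (\<eta>\<^sup>2 - 1) / \<eta>\<^sup>2) has_field_derivative 0) (at \<eta>)" unfolding e .
  qed
  then obtain c where c': "\<And>\<eta>. \<eta> \<in> D \<Longrightarrow> h \<eta> * (\<eta>\<^sup>2 - 1) / \<eta>\<^sup>2 = c" by blast
  then have c: "h \<eta> * (\<eta>\<^sup>2 - 1) = c * \<eta>\<^sup>2" if "\<eta> \<in> D" for \<eta>
    using iffD1[OF nonzero_divide_eq_eq c'[OF that]] nz[OF that] by simp
  obtain \<eta>1 where \<eta>1: "\<eta>1 \<in> D" "deriv q \<eta>1 \<noteq> 0" using asm by blast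
  have "c \<noteq> 0"
  proof
    assume "c = 0"
    \<comment> \<open>The relation for h says nothing at 1 and -1, which may still belong to D here;
      continuity fills them in. With h = 0 throughout, the Codazzi equations give q' = 0.\<close>
    have h0: "h \<eta> = 0" if "\<eta> \<in> D - {1, -1}" for \<eta>
      using c[of \<eta>] that \<open>c = 0\<close> by (auto simp: power2_eq_1_iff)
    have "h \<eta> = 0" if "\<eta> \<in> D" for \<eta>
    proof -
      have "isCont h \<eta>"
        using hol D that by (intro field_differentiable_imp_continuous_at holomorphic_on_imp_differentiable_at)
      moreover have "\<forall>\<^sub>F x in at \<eta>. h x = 0"
      proof -
        have "\<forall>\<^sub>F x in at \<eta>. x \<in> D" using D that by (simp add: eventually_at_topological) blast
        moreover have "\<forall>\<^sub>F x in at \<eta>. x \<noteq> 1" "\<forall>\<^sub>F x in at \<eta>. x \<noteq> -1" by (rule eventually_neq_at_within)+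
        ultimately show ?thesis by eventually_elim (use h0 in auto)
      qed
      ultimately show ?thesis
        unfolding isCont_def using tendsto_unique[OF trivial_limit_at _ tendsto_eventually] by blast
    qed
    then have "deriv h \<eta>1 = deriv (\<lambda>_. 0) \<eta>1"
      by (intro deriv_cong_ev) (use \<eta>1 D in \<open>auto simp: eventually_nhds\<close>)
    then show False using cod(1)[OF \<eta>1(1) \<eta>1(1)] \<eta>1(2) by simp
  qed
  have "nonconstant_q_branch c v h q \<eta>" if "\<eta> \<in> D" for \<eta>
  proof -
    \<comment> \<open>A zero of h or of \<eta>^2 - 1 would turn the relation into 0 = c \<eta>^2; so
      1 and -1 are excluded from D only now that c \<noteq> 0 is known.\<close>
    have ne: "h \<eta> \<noteq> 0" "\<eta>\<^sup>2 - 1 \<noteq> 0" using c[OF that] \<open>c \<noteq> 0\<close> nz[OF that] by auto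
    have "v \<eta> = (\<eta>\<^sup>2 - 1) * deriv q \<eta> / h \<eta>" using cod(2)[OF that that] ne by (simp add: field_simps)
    also have "\<dots> = - (1 - \<eta>\<^sup>2) * deriv q \<eta> / h \<eta>" by simp
    finally show ?thesis
      using c[OF that] ne unfolding nonconstant_q_branch_def by (simp add: nonzero_eq_divide_eq)
  qed
  then show "\<exists>c. c \<noteq> 0 \<and> (\<forall>\<eta>\<in>D. nonconstant_q_branch c v h q \<eta>)" using \<open>c \<noteq> 0\<close> by blast
qed

text \<open>In g1^2 / h the factor \<eta>^2 of h cancels g1^2 against g2^2, and 1 / H becomes a
  function of z plus a function of w.\<close>

lemma inverse_H_harmonic:
  assumes "hvi_branch D v h q c" and g: "gauge_functions D \<Omega> g1 g2"
  shows "(\<forall>(z, w)\<in>\<Omega>. 1 / gc_H g1 g2 h z w = (1 / c) * ((g1 z)\<^sup>2 - (g2 w)\<^sup>2)) \<and>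
        harmonic_on \<Omega> (\<lambda>z w. 1 / gc_H g1 g2 h z w)"
proof -
  interpret hvi_branch D v h q c by fact
  have \<Omega>: "open \<Omega>" and hg: "g1 holomorphic_on (fst ` \<Omega>)"
    and gD: "\<And>z w. (z, w) \<in> \<Omega> \<Longrightarrow> g1 z / g2 w \<in> D"
    using g by (auto simp: gauge_functions_def)
  have eq: "1 / gc_H g1 g2 h z w = (1 / c) * ((g1 z)\<^sup>2 - (g2 w)\<^sup>2)" if "(z, w) \<in> \<Omega>" for z w
  proof -
    \<comment> \<open>With the convention x / 0 = 0 a zero of g2 would also give the quotient 0,
      which is not in D.\<close>
    have nz: "g1 z \<noteq> 0" "g2 w \<noteq> 0" using eta_nz[OF gD[OF that]] by auto
    have "(g1 z)\<^sup>2 \<noteq> (g2 w)\<^sup>2" using sq_ne_1[OF gD[OF that]] nz by (simp add: power_divide)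
    then have "(g1 z)\<^sup>2 - (g2 w)\<^sup>2 \<noteq> 0" by simp
    then show ?thesis
      unfolding gc_H_def h_eq[OF gD[OF that]] using nz c by (simp add: power_divide divide_simps)
  qed
  have "harmonic_on \<Omega> (\<lambda>z w. 1 / gc_H g1 g2 h z w)"
    unfolding harmonic_on_def
  proof (clarify, intro conjI)
    fix z w assume zw: "(z, w) \<in> \<Omega>"
    have op: "open (fst ` \<Omega>)" using \<Omega> by (rule open_image_fst)
    have D1: "((\<lambda>s. 1 / gc_H g1 g2 h s t) has_field_derivative 2 * g1 z * deriv g1 z / c) (at z)"
      if zt: "(z, t) \<in> \<Omega>" for t
    proof -
      have "(g1 has_field_derivative deriv g1 z) (at z)"
        using hg op zt by (intro holomorphic_derivI[of _ "fst ` \<Omega>"]) force+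
      then have "((\<lambda>s. (1 / c) * ((g1 s)\<^sup>2 - (g2 t)\<^sup>2)) has_field_derivative 2 * g1 z * deriv g1 z / c) (at z)"
        using c by (auto intro!: derivative_eq_intros)
      moreover have "open ((\<lambda>s. (s, t)) -` \<Omega>)"
        by (intro open_vimage \<Omega> continuous_intros)
      ultimately show ?thesis
        by (rule has_field_derivative_transform_within_open) (use zt eq in auto)
    qed
    show "(\<lambda>s. 1 / gc_H g1 g2 h s w) field_differentiable at z"
      using D1[OF zw] by (auto simp: field_differentiable_def)
    have "open ((\<lambda>t. (z, t)) -` \<Omega>)"
      by (intro open_vimage \<Omega> continuous_intros)
    then have *: "((\<lambda>t. deriv (\<lambda>s. 1 / gc_H g1 g2 h s t) z) has_field_derivative 0) (at w)"
      by (rule has_field_derivative_transform_within_open[OF DERIV_const[of "2 * g1 z * deriv g1 z / c"]])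
         (use zw DERIV_imp_deriv[OF D1] in auto)
    show "(\<lambda>t. deriv (\<lambda>s. 1 / gc_H g1 g2 h s t) z) field_differentiable at w"
      "deriv (\<lambda>t. deriv (\<lambda>s. 1 / gc_H g1 g2 h s t) z) w = 0"
      using * by (auto simp: field_differentiable_def DERIV_imp_deriv)
  qed
  then show ?thesis using eq by blast
qed

section \<open>Equivalence with the sixth Painleve equation\<close>

lemma csqrt_half_squared: "(csqrt K / 2)\<^sup>2 = K / 4"
  by (simp add: power_divide)

text \<open>Injectivity of \<open>pvi_var\<close> on E provides a holomorphic inverse, which carries
  q to a function of X; \<open>pvi_function\<close> of that function is the Painleve
  solution.\<close>

lemma branch_is_painleve:
  assumes pf: "profile_functions D v h q" and gc: "reduced_GC D v h q" and c: "c \<noteq> 0"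
    and br: "\<forall>\<eta>\<in>D. nonconstant_q_branch c v h q \<eta> \<and> first_integral v h q \<eta> = K"
    and E: "open E" "E \<subseteq> D" "inj_on pvi_var E" and t: "t\<^sup>2 = K / 4"
  shows "\<exists>Y V. Y holomorphic_on (pvi_var ` E) \<and> V holomorphic_on (pvi_var ` E) \<and>
     (\<forall>\<eta>\<in>E. q \<eta> = - (8 / c) * Y (pvi_var \<eta>)) \<and>
     (\<forall>X\<in>pvi_var ` E. SD_Ia (K / 4) 0 (- K\<^sup>2 / 64) 0 Y X) \<and>
     {X \<in> pvi_var ` E. V X = 0 \<or> V X = 1 \<or> V X = X} sparse_in (pvi_var ` E) \<and>
     painleve_VI_on {X \<in> pvi_var ` E. V X \<noteq> 0 \<and> V X \<noteq> 1 \<and> V X \<noteq> X} 0 t t 1 V \<and>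
     (\<forall>X\<in>pvi_var ` E. V X \<noteq> 0 \<and> V X \<noteq> 1 \<and> V X \<noteq> X \<longrightarrow>
        Y X = X * (X - 1) * H_VI 0 t t 1 X (V X) (deriv V X))"
proof -
  interpret hvi_branch D v h q c
    using profile_hvi_branch[OF pf c] br by blast
  let ?S = "pvi_var ` E"
  have hp: "pvi_var holomorphic_on E"
    by (rule holomorphic_on_pvi_var) (use E eta_nz sq_ne_1 in auto)
  obtain g where g: "g holomorphic_on ?S" "\<And>\<eta>. \<eta> \<in> E \<Longrightarrow> g (pvi_var \<eta>) = \<eta>"
    using holomorphic_has_inverse[OF hp E(1,3)] by metis
  have opS: "open ?S" by (rule open_mapping_thm3[OF hp E(1,3)])
  \<comment> \<open>The factor - c / 8 inverts the normalization - 8 / c.\<close>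
  define Y where "Y = (\<lambda>X. - (c / 8) * q (g X))"
  have gS: "g ` ?S \<subseteq> D" using g(2) E by auto
  have "(q \<circ> g) holomorphic_on ?S"
    by (rule holomorphic_on_compose_gen[OF g(1) hol(3) gS])
  then have hY: "Y holomorphic_on ?S"
    unfolding Y_def o_def by (intro holomorphic_intros)
  interpret hvi_branch_sigma D v h q c E ?S Y
    by unfold_locales (use E opS hY g c in \<open>auto simp: Y_def\<close>)
  interpret sigma_form ?S Y
  proof
    show "open ?S" by fact
    show "0 \<notin> ?S" "1 \<notin> ?S" using X_facts(1,2) by force+
    show "Y holomorphic_on ?S" by fact
    show "deriv Y X \<noteq> 0" if "X \<in> ?S" for X using that Y'_nz by auto
  qed
  let ?V = "pvi_function"
  have sg: "sigma_gauss Y X" if X: "X \<in> ?S" for X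
  proof -
    obtain \<eta> where \<eta>: "\<eta> \<in> E" "X = pvi_var \<eta>" using X by blast
    then have "gauss_eq v h q \<eta>" using gc E by (auto simp: reduced_GC_def)
    then show ?thesis using gauss_iff[OF \<eta>(1)] S Y' \<eta>(2) nz by auto
  qed
  have si: "sigma_integral Y X = K" if X: "X \<in> ?S" for X
  proof -
    obtain \<eta> where \<eta>: "\<eta> \<in> E" "X = pvi_var \<eta>" using X by blast
    then show ?thesis using br E(2) first_integral_iff[OF \<eta>(1)] by auto
  qed
  show ?thesis
  proof (rule exI[of _ Y], rule exI[of _ ?V], intro conjI ballI impI)
    show "{X \<in> ?S. ?V X = 0 \<or> ?V X = 1 \<or> ?V X = X} sparse_in ?S"
    proof -
      have "{X \<in> ?S. ?V X = 0 \<or> ?V X = 1 \<or> ?V X = X}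
        = {X \<in> ?S. ?V X = 0} \<union> ({X \<in> ?S. ?V X = 1} \<union> {X \<in> ?S. ?V X = X})" by blast
      then show ?thesis
        using sparse_fixed[OF sg, of "\<lambda>X. 0"] sparse_fixed[OF sg, of "\<lambda>X. 1"] sparse_fixed[OF sg, of "\<lambda>X. X"]
        by (auto intro!: sparse_in_union')
    qed
    show "painleve_VI_on {X \<in> ?S. ?V X \<noteq> 0 \<and> ?V X \<noteq> 1 \<and> ?V X \<noteq> X} 0 t t 1 ?V"
      unfolding painleve_VI_on_def
    proof (intro conjI ballI)
      have "{X \<in> ?S. ?V X \<noteq> 0 \<and> ?V X \<noteq> 1 \<and> ?V X \<noteq> X}
          = ?S \<inter> (?S \<inter> ?V -` (- {0, 1})) \<inter> (?S \<inter> (\<lambda>X. ?V X - X) -` (- {0}))" by auto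
      also have "open \<dots>"
        by (intro open_Int continuous_open_preimage opS continuous_intros holomorphic_on_imp_continuous_on hol_pvi) auto
      finally show "open {X \<in> ?S. ?V X \<noteq> 0 \<and> ?V X \<noteq> 1 \<and> ?V X \<noteq> X}" .
      show "?V holomorphic_on {X \<in> ?S. ?V X \<noteq> 0 \<and> ?V X \<noteq> 1 \<and> ?V X \<noteq> X}"
        using hol_pvi by (rule holomorphic_on_subset) auto
    next
      fix X assume X: "X \<in> {X \<in> ?S. ?V X \<noteq> 0 \<and> ?V X \<noteq> 1 \<and> ?V X \<noteq> X}"
      then show "X \<noteq> 0" "X \<noteq> 1" "?V X \<noteq> 0" "?V X \<noteq> 1" "?V X \<noteq> X" using nz by auto
      show "deriv (deriv ?V) X = painleve_VI_rhs 0 t t 1 X (?V X) (deriv ?V X)"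
        by (rule painleve[OF _ _ _ _ sg si t]) (use X in auto)
    qed
    show "Y X = X * (X - 1) * H_VI 0 t t 1 X (?V X) (deriv ?V X)"
      if "X \<in> ?S" "?V X \<noteq> 0 \<and> ?V X \<noteq> 1 \<and> ?V X \<noteq> X" for X
      by (rule Y_eq_H_VI[OF that(1) _ _ _ si t]) (use that in auto)
    show "SD_Ia (K / 4) 0 (- K\<^sup>2 / 64) 0 Y X" if "X \<in> ?S" for X
      by (rule SD_Ia[OF that si[OF that]])
  qed (use hY hol_pvi q_Y in auto)
qed

text \<open>The derivative 2 \<eta> X^2 of \<open>pvi_var\<close> has no zeros on E, so the map is
  constant on no nonempty open set and the open mapping theorem applies.\<close>

lemma open_pvi_var_image:
  assumes "open E" "\<And>\<eta>. \<eta> \<in> E \<Longrightarrow> \<eta> \<noteq> 0 \<and> \<eta>\<^sup>2 \<noteq> 1"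
  shows "open (pvi_var ` E)"
proof (rule open_mapping_thm2[OF holomorphic_on_pvi_var[OF assms(2)] assms(1) assms(1) order_refl])
  fix X assume X: "open X" "X \<subseteq> E" "X \<noteq> {}"
  show "\<not> pvi_var constant_on X"
  proof
    assume "pvi_var constant_on X"
    then obtain k where k: "\<And>\<eta>. \<eta> \<in> X \<Longrightarrow> pvi_var \<eta> = k" by (auto simp: constant_on_def)
    obtain \<eta> where \<eta>: "\<eta> \<in> X" using X by blast
    have D0: "(pvi_var has_field_derivative 0) (at \<eta>)"
      by (rule has_field_derivative_transform_within_open[OF DERIV_const X(1) \<eta>]) (simp add: k)
    have nz: "\<eta> \<noteq> 0" "\<eta>\<^sup>2 \<noteq> 1" using assms(2)[of \<eta>] X \<eta> by auto
    show False using DERIV_unique[OF D0 pvi_var_facts(5)[OF nz]] pvi_var_facts(1)[OF nz] nz by auto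
  qed
qed auto

text \<open>The fields are built from a local Painleve solution. A nonzero Hamiltonian at the start
  keeps Y nonzero nearby; since Y = (X - V) Y', also Y' and hence v are nonzero.\<close>

lemma HVI_solution_exists:
  assumes \<eta>0: "\<eta>0 \<noteq> 0" "\<eta>0 \<noteq> 1" "\<eta>0 \<noteq> -1" and c: "c \<noteq> 0"
    and V0: "V0 \<noteq> 0" "V0 \<noteq> 1" "V0 \<noteq> pvi_var \<eta>0"
    and H: "H_VI 0 (csqrt K / 2) (csqrt K / 2) 1 (pvi_var \<eta>0) V0 V1 \<noteq> 0"
  shows "\<exists>r>0. \<exists>v h q V. HVI_solution (ball \<eta>0 r) c K v h q V \<and>
           V (pvi_var \<eta>0) = V0 \<and> deriv V (pvi_var \<eta>0) = V1"
proof -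
  let ?t = "csqrt K / 2"
  have sq: "\<eta>0\<^sup>2 \<noteq> 1" using \<eta>0 by (simp add: power2_eq_1_iff)
  let ?X0 = "pvi_var \<eta>0"
  obtain r0 V where r0: "r0 > 0" and PVI: "painleve_VI_on (ball ?X0 r0) 0 ?t ?t 1 V"
    and ic: "V ?X0 = V0" "deriv V ?X0 = V1"
    using painleve_VI_local_solution[OF pvi_var_facts(1,2)[OF \<eta>0(1) sq] V0, of 0 ?t ?t 1 V1] by blast
  interpret P0: painleve_hamiltonian "ball ?X0 r0" V ?t by unfold_locales (rule PVI)
  define Y where "Y = P0.Y"
  define U where "U = ball ?X0 r0 \<inter> Y -` (- {0})"
  define N0 where "N0 = {\<eta> :: complex. \<eta> \<noteq> 0 \<and> \<eta>\<^sup>2 \<noteq> 1}"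
  have "open U" unfolding U_def Y_def
    by (intro continuous_open_preimage holomorphic_on_imp_continuous_on P0.hol_Y) auto
  moreover have "open N0" unfolding N0_def
    by (intro open_Collect_conj open_Collect_neq continuous_intros)
  moreover have "continuous_on N0 pvi_var"
    by (intro holomorphic_on_imp_continuous_on holomorphic_on_pvi_var) (auto simp: N0_def)
  ultimately have "open (N0 \<inter> pvi_var -` U)" by (intro continuous_open_preimage)
  moreover have "\<eta>0 \<in> N0 \<inter> pvi_var -` U"
    using \<eta>0 sq r0 H pvi_var_facts(1,2)[OF \<eta>0(1) sq]
    by (simp add: N0_def U_def Y_def P0.Y_def ic)
  ultimately obtain r where r: "r > 0" "ball \<eta>0 r \<subseteq> N0 \<inter> pvi_var -` U"
    using open_contains_ball[THEN iffD1] by blast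
  let ?B = "ball \<eta>0 r" and ?S = "pvi_var ` ball \<eta>0 r"
  have B: "\<eta> \<noteq> 0 \<and> \<eta>\<^sup>2 \<noteq> 1" if "\<eta> \<in> ?B" for \<eta>
    using subsetD[OF r(2) that] by (simp add: N0_def)
  have B0: "0 \<notin> ?B" using B by blast
  have S: "open ?S" "?S \<subseteq> U" "?S \<subseteq> ball ?X0 r0"
    using open_pvi_var_image[OF open_ball B] r by (auto simp: U_def)
  have PVI': "painleve_VI_on ?S 0 ?t ?t 1 V"
    using PVI S by (auto simp: painleve_VI_on_def elim: holomorphic_on_subset)
  interpret P: painleve_hamiltonian ?S V ?t by unfold_locales (rule PVI')
  have PY: "P.Y = Y" by (simp add: Y_def)
  have Y': "deriv Y X \<noteq> 0" if X: "X \<in> ?S" for X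
    using P.Y_eq[OF X] P.deriv_Y[OF X] S X unfolding PY by (auto simp: U_def)
  \<comment> \<open>These definitions make the branch formulas true by construction; the Gauss
    equation and the first integral then come from \<open>P.sigma\<close>.\<close>
  define q where "q = (\<lambda>\<eta>. - (8 / c) * Y (pvi_var \<eta>))"
  define h where "h = (\<lambda>\<eta>. c * \<eta>\<^sup>2 / (\<eta>\<^sup>2 - 1))"
  define v where "v = (\<lambda>\<eta>. - (1 - \<eta>\<^sup>2) * deriv q \<eta> / h \<eta>)"
  have hY: "Y holomorphic_on ?S" using P.hol_Y PY by simp
  have "(Y \<circ> pvi_var) holomorphic_on ?B"
    by (rule holomorphic_on_compose[OF holomorphic_on_pvi_var[OF B] hY])
  then have hq: "q holomorphic_on ?B" unfolding q_def o_def by (intro holomorphic_intros)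
  have hh: "h holomorphic_on ?B" unfolding h_def using B by (intro holomorphic_intros) auto
  have h_nz: "h \<eta> \<noteq> 0" if "\<eta> \<in> ?B" for \<eta> using B[OF that] c by (simp add: h_def)
  have hv: "v holomorphic_on ?B" unfolding v_def
    using hq hh h_nz by (auto intro!: holomorphic_intros holomorphic_deriv)
  have q': "deriv q \<eta> = - (8 / c) * (deriv Y (pvi_var \<eta>) * (2 * \<eta> * (pvi_var \<eta>)\<^sup>2))" if \<eta>: "\<eta> \<in> ?B" for \<eta>
    unfolding q_def using \<eta> B[OF \<eta>]
    by (intro DERIV_imp_deriv DERIV_cmult DERIV_chain2[OF holomorphic_derivI[OF hY S(1)]] pvi_var_facts(5)) auto
  have v_nz: "v \<eta> \<noteq> 0" if \<eta>: "\<eta> \<in> ?B" for \<eta>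
    using q'[OF \<eta>] Y'[of "pvi_var \<eta>"] pvi_var_facts(1)[of \<eta>] \<eta> B[OF \<eta>] c h_nz[OF \<eta>] by (simp add: v_def)
  have br: "nonconstant_q_branch c v h q \<eta>" for \<eta>
    by (simp add: nonconstant_q_branch_def v_def h_def)
  interpret hvi_branch_sigma ?B v h q c ?B ?S Y
    by unfold_locales (use B0 hv hh hq v_nz c br S hY in \<open>auto simp: q_def\<close>)
  have pf: "profile_functions ?B v h q"
    using B0 v_nz hv hh hq r by (auto simp: profile_functions_def)
  have S01: "0 \<notin> ?S" "1 \<notin> ?S" using X_facts(1,2) by force+
  have "gauss_eq v h q \<eta>" "first_integral v h q \<eta> = K" if \<eta>: "\<eta> \<in> ?B" for \<eta>
    using P.sigma[unfolded PY, OF Y' X_in[OF \<eta>]] gauss_iff[OF \<eta> S01 Y'] first_integral_iff[OF \<eta>]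
    by (auto simp: csqrt_half_squared)
  then have "HVI_solution ?B c K v h q V"
    using pf c br PVI' codazzi by (simp add: HVI_solution_def reduced_GC_def q_def PY[symmetric] P.Y_def Let_def)
  then show ?thesis using r ic by blast
qed

lemma HVI_solutionD:
  assumes "HVI_solution B c K v h q V"
  shows "hvi_branch B v h q c" "painleve_hamiltonian (pvi_var ` B) V (csqrt K / 2)"
    "\<And>\<eta>. \<eta> \<in> B \<Longrightarrow> q \<eta> = - (8 / c) * painleve_hamiltonian.Y V (csqrt K / 2) (pvi_var \<eta>)"
    "\<And>\<eta>. \<eta> \<in> B \<Longrightarrow> first_integral v h q \<eta> = K" "open B" "connected B"
proof -
  note d = assms[unfolded HVI_solution_def]
  show "hvi_branch B v h q c" using profile_hvi_branch[of B v h q c] d by blast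
  show P: "painleve_hamiltonian (pvi_var ` B) V (csqrt K / 2)" using d by unfold_locales blast
  show "q \<eta> = - (8 / c) * painleve_hamiltonian.Y V (csqrt K / 2) (pvi_var \<eta>)" if "\<eta> \<in> B" for \<eta>
    using d that by (simp add: painleve_hamiltonian.Y_def[OF P] Let_def)
qed (use assms in \<open>auto simp: HVI_solution_def profile_functions_def\<close>)

text \<open>Recovers V from q and c alone, so that equal fields have equal Painleve solutions; v
  \<noteq> 0 guarantees that Y' can be divided by.\<close>

lemma HVI_solution_V_eq:
  assumes sol: "HVI_solution B c K v h q V" and X: "X \<in> pvi_var ` B"
  defines "Y \<equiv> painleve_hamiltonian.Y V (csqrt K / 2)"
  shows "V X = X - Y X / deriv Y X"
proof -
  note d = HVI_solutionD[OF sol]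
  interpret P: painleve_hamiltonian "pvi_var ` B" V "csqrt K / 2" by (rule d(2))
  interpret hvi_branch B v h q c by (rule d(1))
  interpret hvi_branch_sigma B v h q c B "pvi_var ` B" Y
    by unfold_locales (use d P.S P.hol_Y in \<open>auto simp: Y_def\<close>)
  show ?thesis using P.V_eq[OF X] X Y'_nz unfolding Y_def by auto
qed

text \<open>Equal fields determine c through h, K through the first integral, and V through
  \<open>HVI_solution_V_eq\<close>. Conversely, equal initial values give equal V on the connected
  image of B, and q, h, v are explicit in V and c.\<close>

lemma HVI_solution_parameters:
  assumes s1: "HVI_solution B c1 K1 v1 h1 q1 V1" and s2: "HVI_solution B c2 K2 v2 h2 q2 V2"
    and \<eta>0: "\<eta>0 \<in> B"
  shows "(\<forall>\<eta>\<in>B. v1 \<eta> = v2 \<eta> \<and> h1 \<eta> = h2 \<eta> \<and> q1 \<eta> = q2 \<eta>) \<longleftrightarrow>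
         (c1 = c2 \<and> K1 = K2 \<and> V1 (pvi_var \<eta>0) = V2 (pvi_var \<eta>0) \<and>
          deriv V1 (pvi_var \<eta>0) = deriv V2 (pvi_var \<eta>0))"
proof -
  note d1 = HVI_solutionD[OF s1] and d2 = HVI_solutionD[OF s2]
  interpret B1: hvi_branch B v1 h1 q1 c1 by (rule d1(1))
  interpret B2: hvi_branch B v2 h2 q2 c2 by (rule d2(1))
  interpret P1: painleve_hamiltonian "pvi_var ` B" V1 "csqrt K1 / 2" by (rule d1(2))
  interpret P2: painleve_hamiltonian "pvi_var ` B" V2 "csqrt K2 / 2" by (rule d2(2))
  let ?S = "pvi_var ` B"
  have X0: "pvi_var \<eta>0 \<in> ?S" using \<eta>0 by simp
  show ?thesis
  proof (intro iffI)
    assume eq: "\<forall>\<eta>\<in>B. v1 \<eta> = v2 \<eta> \<and> h1 \<eta> = h2 \<eta> \<and> q1 \<eta> = q2 \<eta>"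
    have "c1 = c2"
      using eq[rule_format, OF \<eta>0] B1.h_eq[OF \<eta>0] B2.h_eq[OF \<eta>0] B1.eta_nz[OF \<eta>0] B1.sq_ne_1[OF \<eta>0] by auto
    have "deriv v1 \<eta>0 = deriv v2 \<eta>0"
      by (rule deriv_cong_ev) (use eq \<eta>0 d1(5) in \<open>auto simp: eventually_nhds\<close>)
    then have "first_integral v1 h1 q1 \<eta>0 = first_integral v2 h2 q2 \<eta>0"
      using eq \<eta>0 by (simp add: first_integral_def)
    then have "K1 = K2" using d1(4)[OF \<eta>0] d2(4)[OF \<eta>0] by simp
    have Y: "P1.Y X = P2.Y X" if "X \<in> ?S" for X
      using that d1(3) d2(3) eq B1.c \<open>c1 = c2\<close> by auto
    have Y': "deriv P1.Y X = deriv P2.Y X" if "X \<in> ?S" for X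
      by (rule deriv_cong_ev) (use Y that P1.S in \<open>auto simp: eventually_nhds\<close>)
    have V: "V1 X = V2 X" if "X \<in> ?S" for X
      using HVI_solution_V_eq[OF s1 that] HVI_solution_V_eq[OF s2 that] Y[OF that] Y'[OF that] by simp
    have "deriv V1 (pvi_var \<eta>0) = deriv V2 (pvi_var \<eta>0)"
      by (rule deriv_cong_ev) (use V X0 P1.S in \<open>auto simp: eventually_nhds\<close>)
    then show "c1 = c2 \<and> K1 = K2 \<and> V1 (pvi_var \<eta>0) = V2 (pvi_var \<eta>0) \<and>
          deriv V1 (pvi_var \<eta>0) = deriv V2 (pvi_var \<eta>0)"
      using \<open>c1 = c2\<close> \<open>K1 = K2\<close> V[OF X0] by simp
  next
    assume eq: "c1 = c2 \<and> K1 = K2 \<and> V1 (pvi_var \<eta>0) = V2 (pvi_var \<eta>0) \<and>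
          deriv V1 (pvi_var \<eta>0) = deriv V2 (pvi_var \<eta>0)"
    have "connected ?S"
      by (intro connected_continuous_image d1(6) holomorphic_on_imp_continuous_on holomorphic_on_pvi_var)
         (use B1.eta_nz B1.sq_ne_1 in auto)
    then have V: "V1 X = V2 X" if "X \<in> ?S" for X
      using painleve_VI_unique[OF P1.PVI _ _ X0 _ _ that, of V2] P2.PVI eq by auto
    have V': "deriv V1 X = deriv V2 X" if "X \<in> ?S" for X
      by (rule deriv_cong_ev) (use V that P1.S in \<open>auto simp: eventually_nhds\<close>)
    have q: "q1 \<eta> = q2 \<eta>" if "\<eta> \<in> B" for \<eta>
    proof -
      have "P1.Y (pvi_var \<eta>) = P2.Y (pvi_var \<eta>)"
        unfolding P1.Y_def P2.Y_def using V V' that eq by simp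
      then show ?thesis using d1(3)[OF that] d2(3)[OF that] eq by simp
    qed
    have q': "deriv q1 \<eta> = deriv q2 \<eta>" if "\<eta> \<in> B" for \<eta>
      by (rule deriv_cong_ev) (use q that d1(5) in \<open>auto simp: eventually_nhds\<close>)
    show "\<forall>\<eta>\<in>B. v1 \<eta> = v2 \<eta> \<and> h1 \<eta> = h2 \<eta> \<and> q1 \<eta> = q2 \<eta>"
      using B1.h_eq B2.h_eq B1.v_eq B2.v_eq q q' eq by auto
  qed
qed

section \<open>The HIMC solution\<close>

lemma exp_eq_sinh_ccoth:
  fixes y a :: complex
  assumes "exp y = a" "a\<^sup>2 \<noteq> 1"
  shows "sinh y = (a\<^sup>2 - 1) / (2 * a)" "ccoth y = (a\<^sup>2 + 1) / (a\<^sup>2 - 1)" "a \<noteq> 0"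
proof -
  show a: "a \<noteq> 0" using assms(1) exp_not_eq_zero by blast
  have s: "sinh y = (a\<^sup>2 - 1) / (2 * a)"
    using a by (simp add: sinh_field_def exp_minus assms(1) field_simps power2_eq_square)
  have "cosh y = (a\<^sup>2 + 1) / (2 * a)"
    using a by (simp add: cosh_field_def exp_minus assms(1) field_simps power2_eq_square)
  then show "ccoth y = (a\<^sup>2 + 1) / (a\<^sup>2 - 1)"
    unfolding ccoth_def s using a by simp
  show "sinh y = (a\<^sup>2 - 1) / (2 * a)" by fact
qed

section \<open>The substitution \<eta> = exp (- 4 cz x)\<close>

context hvi_branch
begin

lemma DERIV_comp_exp:
  assumes "exp (- 4 * cz * x) \<in> D" "f holomorphic_on D"
  shows "((\<lambda>x. f (exp (- 4 * cz * x))) has_field_derivative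
    - 4 * cz * exp (- 4 * cz * x) * deriv f (exp (- 4 * cz * x))) (at x)"
proof -
  have "((\<lambda>x. exp (- 4 * cz * x)) has_field_derivative exp (- 4 * cz * x) * (- 4 * cz)) (at x)"
    by (rule derivative_eq_intros refl)+ simp
  from DERIV_chain2[OF holomorphic_derivI[OF assms(2) D(1) assms(1)] this]
  show ?thesis by (simp add: mult_ac)
qed

lemma deriv_qh:
  assumes "exp (- 4 * cz * x) \<in> D"
  shows "deriv (\<lambda>x. k * q (exp (- 4 * cz * x))) x
    = - 4 * cz * k * exp (- 4 * cz * x) * deriv q (exp (- 4 * cz * x))"
  using DERIV_imp_deriv[OF DERIV_cmult[OF DERIV_comp_exp[OF assms hol(3)], of k]] by (simp add: mult_ac)

lemma open_exp_preimage: "open {x. exp (- 4 * cz * x) \<in> D}"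
proof -
  have "open ((\<lambda>x. exp (- 4 * cz * x)) -` D)"
    by (intro open_vimage D(1) continuous_intros)
  then show ?thesis by (simp add: vimage_def)
qed

lemma deriv_deriv_qh:
  assumes "exp (- 4 * cz * x) \<in> D"
  defines "\<eta> \<equiv> exp (- 4 * cz * x)"
  shows "deriv (deriv (\<lambda>x. k * q (exp (- 4 * cz * x)))) x
    = 16 * cz\<^sup>2 * k * \<eta> * (deriv q \<eta> + \<eta> * deriv (deriv q) \<eta>)"
proof -
  have "deriv (deriv (\<lambda>x. k * q (exp (- 4 * cz * x)))) x =
      deriv (\<lambda>x. - 4 * cz * k * (exp (- 4 * cz * x) * deriv q (exp (- 4 * cz * x)))) x"
    by (rule deriv_cong_ev)
       (use assms(1) open_exp_preimage[of cz] deriv_qh[of cz _ k] in \<open>auto simp: eventually_nhds mult.assoc\<close>)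
  also have "\<dots> = - 4 * cz * k * (- 4 * cz * \<eta> * deriv q \<eta> + \<eta> * (- 4 * cz * \<eta> * deriv (deriv q) \<eta>))"
    unfolding \<eta>_def
    by (rule DERIV_imp_deriv)
       (rule derivative_eq_intros DERIV_comp_exp[OF assms(1) holomorphic_deriv[OF hol(3) D(1)]] refl | simp add: mult_ac)+
  also have "\<dots> = 16 * cz\<^sup>2 * k * \<eta> * (deriv q \<eta> + \<eta> * deriv (deriv q) \<eta>)"
    by (simp add: power2_eq_square algebra_simps)
  finally show ?thesis .
qed

text \<open>The logarithmic derivative of \<open>v_eq\<close>. The last summand stems from (\<eta>^2
  - 1)^2 / \<eta>^2 and becomes the \<open>ccoth\<close> term next to qh'' / qh'.\<close>

lemma log_deriv_v:
  assumes \<eta>: "\<eta> \<in> D"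
  shows "\<eta> * deriv v \<eta> / v \<eta> + 1 =
    1 + \<eta> * deriv (deriv q) \<eta> / deriv q \<eta> + 2 * (\<eta>\<^sup>2 + 1) / (\<eta>\<^sup>2 - 1)"
proof -
  have nz: "\<eta> \<noteq> 0" "\<eta>\<^sup>2 - 1 \<noteq> 0" using eta_nz sq_ne_1 \<eta> by auto
  let ?s = "\<eta>\<^sup>2 - 1" and ?a = "deriv q \<eta>" and ?b = "deriv (deriv q) \<eta>"
  have "((\<lambda>\<eta>. (\<eta>\<^sup>2 - 1)\<^sup>2 * deriv q \<eta> / (c * \<eta>\<^sup>2)) has_field_derivative
     ((2 * (2 * \<eta>) * ?s * ?a + ?s\<^sup>2 * ?b) * (c * \<eta>\<^sup>2) - ?s\<^sup>2 * ?a * (c * (2 * \<eta>))) / (c * \<eta>\<^sup>2 * (c * \<eta>\<^sup>2))) (at \<eta>)"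
    by (rule derivative_eq_intros holomorphic_derivI[OF holomorphic_deriv[OF hol(3) D(1)] D(1) \<eta>] refl)+
       (use nz c in \<open>auto simp: algebra_simps\<close>)
  then have "(v has_field_derivative
     ((2 * (2 * \<eta>) * ?s * ?a + ?s\<^sup>2 * ?b) * (c * \<eta>\<^sup>2) - ?s\<^sup>2 * ?a * (c * (2 * \<eta>))) / (c * \<eta>\<^sup>2 * (c * \<eta>\<^sup>2))) (at \<eta>)"
    by (rule has_field_derivative_transform_within_open[OF _ D(1) \<eta>]) (simp add: v_eq)
  note v' = DERIV_imp_deriv[OF this]
  show ?thesis
    unfolding v' v_eq[OF \<eta>] using nz c q'_nz[OF \<eta>]
    by (simp add: divide_simps) algebra
qed

text \<open>Since d/dx = - 4 cz \<eta> d/d\<eta>, the expression inside the square is - 4 cz times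
  \<eta> v' / v + 1, whence the factor 16 cz^2. The constant cz c / (4 cq) in \<open>qh\<close>
  gives the remaining terms the same factor.\<close>

lemma himc_integral:
  assumes nz: "cz \<noteq> 0" "cq \<noteq> 0" and \<eta>D: "exp (- 4 * cz * x) \<in> D"
  defines "qh \<equiv> \<lambda>x. cz * c / (4 * cq) * q (exp (- 4 * cz * x))"
  shows "(deriv (deriv qh) x / deriv qh x + 8 * cz * ccoth (4 * cz * x))\<^sup>2
      + 16 * cq * ((4 * cz / sinh (4 * cz * x))\<^sup>2 * (((qh x)\<^sup>2 + 0\<^sup>2) / deriv qh x)
        + deriv qh x + 8 * cz * ccoth (4 * cz * x) * qh x)
     = 16 * cz\<^sup>2 * first_integral v h q (exp (- 4 * cz * x))"
    and "sinh (4 * cz * x) \<noteq> 0" and "deriv qh x \<noteq> 0"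
proof -
  define \<eta> where "\<eta> = exp (- 4 * cz * x)"
  have \<eta>: "\<eta> \<in> D" using \<eta>D by (simp add: \<eta>_def)
  have nz\<eta>: "\<eta> \<noteq> 0" "\<eta>\<^sup>2 - 1 \<noteq> 0" "deriv q \<eta> \<noteq> 0" using eta_nz sq_ne_1 q'_nz \<eta> by auto
  \<comment> \<open>The argument 4 cz x is minus the exponent in \<eta>; this is the origin of the
    minus signs in \<open>s\<close> and \<open>ct\<close>.\<close>
  have e: "exp (4 * cz * x) = 1 / \<eta>" by (simp add: \<eta>_def exp_minus field_simps)
  have s: "sinh (4 * cz * x) = - (\<eta>\<^sup>2 - 1) / (2 * \<eta>)"
    and ct: "ccoth (4 * cz * x) = - (\<eta>\<^sup>2 + 1) / (\<eta>\<^sup>2 - 1)"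
  proof -
    have n: "(1 / \<eta>)\<^sup>2 \<noteq> 1" using nz\<eta> by (simp add: power_divide)
    have e': "(1 / \<eta>)\<^sup>2 - 1 = - (\<eta>\<^sup>2 - 1) / \<eta>\<^sup>2" "(1 / \<eta>)\<^sup>2 + 1 = (\<eta>\<^sup>2 + 1) / \<eta>\<^sup>2"
      using nz\<eta> by (simp_all add: field_simps)
    show "sinh (4 * cz * x) = - (\<eta>\<^sup>2 - 1) / (2 * \<eta>)"
      unfolding exp_eq_sinh_ccoth(1)[OF e n] e' using nz\<eta> by (simp add: power2_eq_square)
    show "ccoth (4 * cz * x) = - (\<eta>\<^sup>2 + 1) / (\<eta>\<^sup>2 - 1)"
      unfolding exp_eq_sinh_ccoth(2)[OF e n] e' using nz\<eta> by (simp add: divide_simps) (simp add: algebra_simps)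
  qed
  show "sinh (4 * cz * x) \<noteq> 0" unfolding s using nz\<eta> by auto
  have q1: "deriv qh x = - (cz\<^sup>2 * c / cq) * \<eta> * deriv q \<eta>"
    unfolding qh_def deriv_qh[OF \<eta>D] using nz by (simp add: \<eta>_def power2_eq_square)
  show "deriv qh x \<noteq> 0" unfolding q1 using nz nz\<eta> c by simp
  have "deriv (deriv qh) x / deriv qh x = - 4 * cz * (1 + \<eta> * deriv (deriv q) \<eta> / deriv q \<eta>)"
    unfolding q1 unfolding qh_def deriv_deriv_qh[OF \<eta>D] \<eta>_def[symmetric]
    using nz nz\<eta> c by (simp add: field_simps power2_eq_square)
  then have "deriv (deriv qh) x / deriv qh x + 8 * cz * ccoth (4 * cz * x)
      = - 4 * cz * (1 + \<eta> * deriv (deriv q) \<eta> / deriv q \<eta> + 2 * (\<eta>\<^sup>2 + 1) / (\<eta>\<^sup>2 - 1))"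
    unfolding ct using nz\<eta> by (simp add: ring_distribs)
  then have A: "(deriv (deriv qh) x / deriv qh x + 8 * cz * ccoth (4 * cz * x))\<^sup>2
      = 16 * cz\<^sup>2 * (\<eta> * deriv v \<eta> / v \<eta> + 1)\<^sup>2"
    unfolding log_deriv_v[OF \<eta>] by (simp add: power_mult_distrib)
  have B: "16 * cq * ((4 * cz / sinh (4 * cz * x))\<^sup>2 * (((qh x)\<^sup>2 + 0\<^sup>2) / deriv qh x))
     = 16 * cz\<^sup>2 * (- 4 * (q \<eta>)\<^sup>2 / (\<eta> * v \<eta>))"
    unfolding q1 s v_eq[OF \<eta>] unfolding qh_def \<eta>_def[symmetric] using nz nz\<eta> c
    by (simp add: divide_simps) (simp add: power2_eq_square power4_eq_xxxx algebra_simps)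
  have C: "16 * cq * deriv qh x = 16 * cz\<^sup>2 * (- (h \<eta>)\<^sup>2 * v \<eta> / \<eta>)"
    unfolding q1 v_eq[OF \<eta>] h_eq[OF \<eta>] using nz nz\<eta> c
    by (simp add: divide_simps) (simp add: power2_eq_square power4_eq_xxxx algebra_simps)
  have E: "16 * cq * (8 * cz * ccoth (4 * cz * x) * qh x) = 16 * cz\<^sup>2 * (- 2 * h \<eta> * q \<eta> - 2 * h \<eta> * q \<eta> / \<eta>\<^sup>2)"
    unfolding ct h_eq[OF \<eta>] unfolding qh_def \<eta>_def[symmetric] using nz nz\<eta> c
    by (simp add: divide_simps) (simp add: power2_eq_square power4_eq_xxxx algebra_simps)
  show "(deriv (deriv qh) x / deriv qh x + 8 * cz * ccoth (4 * cz * x))\<^sup>2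
      + 16 * cq * ((4 * cz / sinh (4 * cz * x))\<^sup>2 * (((qh x)\<^sup>2 + 0\<^sup>2) / deriv qh x)
        + deriv qh x + 8 * cz * ccoth (4 * cz * x) * qh x)
     = 16 * cz\<^sup>2 * first_integral v h q (exp (- 4 * cz * x))"
    unfolding distrib_left[of "16 * cq"] A B C E unfolding first_integral_def \<eta>_def[symmetric]
    by (simp add: algebra_simps)
qed

lemma first_integral_iff_himc:
  assumes nz: "cz \<noteq> 0" "cu \<noteq> 0" "cq \<noteq> 0"
  defines "qh \<equiv> \<lambda>x. cz * c / (4 * cq) * q (exp (- 4 * cz * x))"
  shows "(\<forall>\<eta>\<in>D. first_integral v h q \<eta> = K) \<longleftrightarrow>
    himc_profile {x. exp (- 4 * cz * x) \<in> D} cz cu cq (16 * cz\<^sup>2 * K) 0 (\<lambda>x. cq / cu * deriv qh x) qh"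
proof -
  let ?S = "{x. exp (- 4 * cz * x) \<in> D}"
  have "qh field_differentiable at x" if "x \<in> ?S" for x
    unfolding qh_def field_differentiable_def
    using DERIV_cmult[OF DERIV_comp_exp[of cz x q]] that hol(3) by blast
  then have hq: "qh holomorphic_on ?S"
    by (auto simp: holomorphic_on_def intro: field_differentiable_at_within)
  have pt: "16 * cz\<^sup>2 * K = (deriv (deriv qh) x / deriv qh x + 8 * cz * ccoth (4 * cz * x))\<^sup>2
      + 16 * cq * ((4 * cz / sinh (4 * cz * x))\<^sup>2 * (((qh x)\<^sup>2 + 0\<^sup>2) / deriv qh x)
        + deriv qh x + 8 * cz * ccoth (4 * cz * x) * qh x) \<longleftrightarrow> first_integral v h q (exp (- 4 * cz * x)) = K"
    if "x \<in> ?S" for x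
    using himc_integral(1)[OF nz(1,3), of x] that nz unfolding qh_def by auto
  have "himc_profile ?S cz cu cq (16 * cz\<^sup>2 * K) 0 (\<lambda>x. cq / cu * deriv qh x) qh
    \<longleftrightarrow> (\<forall>x\<in>?S. first_integral v h q (exp (- 4 * cz * x)) = K)"
    unfolding himc_profile_def
    using pt hq open_exp_preimage nz himc_integral(2,3)[OF nz(1,3), folded qh_def] by auto
  also have "\<dots> \<longleftrightarrow> (\<forall>\<eta>\<in>D. first_integral v h q \<eta> = K)"
  proof safe
    fix \<eta> assume *: "\<forall>x\<in>?S. first_integral v h q (exp (- 4 * cz * x)) = K" "\<eta> \<in> D"
    \<comment> \<open>Every point of D is nonzero, hence a value of the exponential, so the HIMC
      equation on the preimage controls the first integral on all of D.\<close>
    have "exp (- 4 * cz * (- Ln \<eta> / (4 * cz))) = \<eta>" using nz eta_nz[OF *(2)] by simp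
    then show "first_integral v h q \<eta> = K"
      using bspec[OF *(1), of "- Ln \<eta> / (4 * cz)"] *(2) by simp
  qed auto
  finally show ?thesis by blast
qed

text \<open>The shift (Z + L, W - L) preserves Z + W, hence x and \<eta> = g1 / g2, so L enters only
  through the factors \<open>sinh\<close> and \<open>ccoth\<close> and through \<open>ch\<close>.
  The derivatives of Z and W account for the change of conformal coordinates.\<close>

lemma himc_translates:
  assumes nz: "cz \<noteq> 0" "cu \<noteq> 0" "cq \<noteq> 0" and gauge: "gauge_functions D \<Omega> g1 g2"
    and ZW: "Z holomorphic_on (fst ` \<Omega>)" "W holomorphic_on (snd ` \<Omega>)"
    and g1: "\<forall>s\<in>fst ` \<Omega>. g1 s = exp (- 2 * cz * Z s)"
    and g2: "\<forall>s\<in>snd ` \<Omega>. g2 s = exp (2 * cz * W s)" and zw: "(z, w) \<in> \<Omega>"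
  defines "qh \<equiv> \<lambda>x. cz * c / (4 * cq) * q (exp (- 4 * cz * x))"
  defines "vh \<equiv> \<lambda>x. cq / cu * deriv qh x"
  defines "ch \<equiv> \<lambda>L. 4 * cz * c * exp (- 4 * cz * L)"
  defines "m1 \<equiv> \<lambda>L. 1 - exp (- 4 * cz * L) * (g1 z)\<^sup>2"
  defines "m2 \<equiv> \<lambda>L. 1 - exp (- 4 * cz * L) * (g2 w)\<^sup>2"
  assumes m: "m1 L \<noteq> 0" "m2 L \<noteq> 0"
  shows "himc_H cz (ch L) (Z z + L) (W w - L) = gc_H g1 g2 h z w * (m1 L * m2 L)"
    and "deriv Z z * deriv W w * himc_expu cz (ch L) cu vh (Z z + L) (W w - L)
      = gc_expu g1 g2 v z w / (m1 L * m2 L)\<^sup>2"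
    and "(deriv Z z)\<^sup>2 * himc_Q cz (ch L) cq 0 qh (Z z + L) (W w - L) = gc_Q g1 g2 q z w / (m1 L)\<^sup>2"
    and "(deriv W w)\<^sup>2 * himc_R cz (ch L) cq 0 qh (Z z + L) (W w - L) = gc_R g1 g2 q z w / (m2 L)\<^sup>2"
proof -
  define G F \<tau> where "G = g1 z" and "F = g2 w" and "\<tau> = exp (- 4 * cz * L)"
  define \<eta> where "\<eta> = G / F"
  have op: "open (fst ` \<Omega>)" "open (snd ` \<Omega>)" and \<eta>: "\<eta> \<in> D"
    using gauge zw by (auto simp: gauge_functions_def \<eta>_def G_def F_def intro: open_image_fst open_image_snd)
  have zz: "z \<in> fst ` \<Omega>" "w \<in> snd ` \<Omega>" using zw by force+
  have GF: "G = exp (- 2 * cz * Z z)" "F = exp (2 * cz * W w)"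
    using g1 g2 zz by (auto simp: G_def F_def)
  have nz': "G \<noteq> 0" "F \<noteq> 0" "\<tau> \<noteq> 0" by (auto simp: GF \<tau>_def)
  have sq: "G\<^sup>2 - F\<^sup>2 \<noteq> 0" using sq_ne_1[OF \<eta>] nz' by (auto simp: \<eta>_def power_divide)
  have M: "m1 L = 1 - \<tau> * G\<^sup>2" "m2 L = 1 - \<tau> * F\<^sup>2"
    by (simp_all add: m1_def m2_def \<tau>_def G_def F_def)
  define p r where "p = m1 L" and "r = m2 L"
  have pr: "p \<noteq> 0" "r \<noteq> 0" using m by (auto simp: p_def r_def)
  have dg1: "deriv g1 z = - 2 * cz * deriv Z z * G"
  proof -
    have "((\<lambda>s. exp (- 2 * cz * Z s)) has_field_derivative - 2 * cz * deriv Z z * exp (- 2 * cz * Z z)) (at z)"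
      by (rule derivative_eq_intros holomorphic_derivI[OF ZW(1) op(1) zz(1)] refl)+ simp
    then have "(g1 has_field_derivative - 2 * cz * deriv Z z * exp (- 2 * cz * Z z)) (at z)"
      by (rule has_field_derivative_transform_within_open[OF _ op(1) zz(1)]) (use g1 in auto)
    then show ?thesis unfolding GF by (rule DERIV_imp_deriv)
  qed
  have dg2: "deriv g2 w = 2 * cz * deriv W w * F"
  proof -
    have "((\<lambda>s. exp (2 * cz * W s)) has_field_derivative 2 * cz * deriv W w * exp (2 * cz * W w)) (at w)"
      by (rule derivative_eq_intros holomorphic_derivI[OF ZW(2) op(2) zz(2)] refl)+ simp
    then have "(g2 has_field_derivative 2 * cz * deriv W w * exp (2 * cz * W w)) (at w)"
      by (rule has_field_derivative_transform_within_open[OF _ op(2) zz(2)]) (use g2 in auto)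
    then show ?thesis unfolding GF by (rule DERIV_imp_deriv)
  qed
  \<comment> \<open>Through a^2 and b^2 the values of \<open>ccoth\<close> and of the squared
    \<open>sinh\<close> become rational in \<tau>, G^2 and F^2, with poles or zeros only from
    \<open>m1 L\<close> and \<open>m2 L\<close>.\<close>
  define a b where "a = exp (2 * cz * (Z z + L))" and "b = exp (2 * cz * (W w - L))"
  have a2: "a\<^sup>2 = 1 / (\<tau> * G\<^sup>2)" and b2: "b\<^sup>2 = \<tau> * F\<^sup>2"
    unfolding a_def b_def \<tau>_def GF
    by (simp_all add: power2_eq_square mult_exp_exp exp_minus[symmetric] divide_inverse algebra_simps)
  have ab1: "a\<^sup>2 \<noteq> 1" "b\<^sup>2 \<noteq> 1"
    using pr nz' unfolding a2 b2 p_def r_def M by auto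
  note ha = exp_eq_sinh_ccoth[OF a_def[symmetric] ab1(1)] and hb = exp_eq_sinh_ccoth[OF b_def[symmetric] ab1(2)]
  have ca: "ccoth (2 * cz * (Z z + L)) = (1 + \<tau> * G\<^sup>2) / p"
    and sa: "(sinh (2 * cz * (Z z + L)))\<^sup>2 = p\<^sup>2 / (4 * \<tau> * G\<^sup>2)"
  proof -
    have e: "a\<^sup>2 - 1 = p / (\<tau> * G\<^sup>2)" "a\<^sup>2 + 1 = (1 + \<tau> * G\<^sup>2) / (\<tau> * G\<^sup>2)"
      using nz' unfolding a2 p_def M by (simp_all add: field_simps)
    show "ccoth (2 * cz * (Z z + L)) = (1 + \<tau> * G\<^sup>2) / p"
      unfolding ha(2) e using nz' by simp
    show "(sinh (2 * cz * (Z z + L)))\<^sup>2 = p\<^sup>2 / (4 * \<tau> * G\<^sup>2)"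
      unfolding ha(1) e unfolding power_divide power_mult_distrib a2 using nz'
      by (simp add: power2_eq_square)
  qed
  have cb: "ccoth (2 * cz * (W w - L)) = - (1 + \<tau> * F\<^sup>2) / r"
    and sb: "(sinh (2 * cz * (W w - L)))\<^sup>2 = r\<^sup>2 / (4 * \<tau> * F\<^sup>2)"
  proof -
    have e: "b\<^sup>2 - 1 = - r" "b\<^sup>2 + 1 = 1 + \<tau> * F\<^sup>2"
      unfolding b2 r_def M by simp_all
    show "ccoth (2 * cz * (W w - L)) = - (1 + \<tau> * F\<^sup>2) / r"
      unfolding hb(2) e by (simp only: divide_minus_right minus_divide_left)
    show "(sinh (2 * cz * (W w - L)))\<^sup>2 = r\<^sup>2 / (4 * \<tau> * F\<^sup>2)"
      unfolding hb(1) e unfolding power_divide power_mult_distrib b2 by simp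
  qed
  have x: "exp (- 4 * cz * himc_x (Z z + L) (W w - L)) = \<eta>"
  proof -
    have "- 4 * cz * himc_x (Z z + L) (W w - L) = - 2 * cz * Z z - 2 * cz * W w"
      by (simp add: himc_x_def field_simps)
    then show ?thesis unfolding \<eta>_def GF exp_diff[symmetric] by simp
  qed
  then have xD: "exp (- 4 * cz * himc_x (Z z + L) (W w - L)) \<in> D" using \<eta> by simp
  have gH: "gc_H g1 g2 h z w = c / (G\<^sup>2 - F\<^sup>2)"
    unfolding gc_H_def G_def[symmetric] F_def[symmetric] \<eta>_def[symmetric] h_eq[OF \<eta>]
    using nz' sq by (simp add: \<eta>_def power_divide divide_simps)
  \<comment> \<open>The terms of degree 0 and 2 in \<tau> cancel in the numerator; the remaining
    factor \<tau> is compensated by the exponential in \<open>ch L\<close>.\<close>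
  have cs: "ccoth (2 * cz * (Z z + L)) + ccoth (2 * cz * (W w - L)) = 2 * \<tau> * (G\<^sup>2 - F\<^sup>2) / (p * r)"
  proof -
    have "(1 + \<tau> * G\<^sup>2) * r - (1 + \<tau> * F\<^sup>2) * p = 2 * \<tau> * (G\<^sup>2 - F\<^sup>2)"
      unfolding p_def r_def M by (simp add: algebra_simps)
    then show ?thesis unfolding ca cb using pr by (simp add: field_simps)
  qed
  show H: "himc_H cz (ch L) (Z z + L) (W w - L) = gc_H g1 g2 h z w * (m1 L * m2 L)"
    unfolding himc_H_def cs gH ch_def \<tau>_def[symmetric] p_def[symmetric] r_def[symmetric]
    using nz nz' pr sq c by (simp add: field_simps)
  have vx: "cu * vh (himc_x (Z z + L) (W w - L)) = - (cz\<^sup>2 * c) * \<eta> * deriv q \<eta>"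
    unfolding vh_def qh_def deriv_qh[OF xD] unfolding x using nz by (simp add: power2_eq_square)
  have "deriv q \<eta> = c * \<eta>\<^sup>2 * v \<eta> / (\<eta>\<^sup>2 - 1)\<^sup>2"
    using v_eq[OF \<eta>] eta_nz[OF \<eta>] sq_ne_1[OF \<eta>] c by simp
  also have "(\<eta>\<^sup>2 - 1)\<^sup>2 = (G\<^sup>2 - F\<^sup>2)\<^sup>2 / (F\<^sup>2)\<^sup>2"
    using nz' by (simp add: \<eta>_def power_divide divide_simps)
  also have "\<eta>\<^sup>2 = G\<^sup>2 / F\<^sup>2" by (simp add: \<eta>_def power_divide)
  also have "c * (G\<^sup>2 / F\<^sup>2) * v \<eta> / ((G\<^sup>2 - F\<^sup>2)\<^sup>2 / (F\<^sup>2)\<^sup>2) = c * G\<^sup>2 * F\<^sup>2 * v \<eta> / (G\<^sup>2 - F\<^sup>2)\<^sup>2"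
    using nz' by (simp add: power2_eq_square)
  finally have q': "deriv q \<eta> = c * G\<^sup>2 * F\<^sup>2 * v \<eta> / (G\<^sup>2 - F\<^sup>2)\<^sup>2" .
  show "deriv Z z * deriv W w * himc_expu cz (ch L) cu vh (Z z + L) (W w - L)
      = gc_expu g1 g2 v z w / (m1 L * m2 L)\<^sup>2"
    unfolding himc_expu_def H gc_expu_def dg1 dg2 gH p_def[symmetric] r_def[symmetric]
      mult.assoc[of 4 cu] vx q' G_def[symmetric] F_def[symmetric] \<eta>_def[symmetric]
    using nz' sq pr c by (simp add: \<eta>_def divide_simps) (simp add: power2_eq_square algebra_simps)
  show "(deriv Z z)\<^sup>2 * himc_Q cz (ch L) cq 0 qh (Z z + L) (W w - L) = gc_Q g1 g2 q z w / (m1 L)\<^sup>2"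
    unfolding himc_Q_def gc_Q_def power_divide sa ch_def qh_def x dg1 p_def[symmetric]
      \<tau>_def[symmetric] G_def[symmetric] F_def[symmetric] \<eta>_def[symmetric]
    using nz nz' pr c by (simp add: field_simps power2_eq_square)
  show "(deriv W w)\<^sup>2 * himc_R cz (ch L) cq 0 qh (Z z + L) (W w - L) = gc_R g1 g2 q z w / (m2 L)\<^sup>2"
    unfolding himc_R_def gc_R_def power_divide sb ch_def qh_def x dg2 r_def[symmetric]
      \<tau>_def[symmetric] G_def[symmetric] F_def[symmetric] \<eta>_def[symmetric]
    using nz nz' pr c by (simp add: field_simps power2_eq_square)
qed

end

section \<open>Limits under infinite translation\<close>

text \<open>Dividing the real parameter by cz turns exp (- 4 cz L) into exp (- 4 l), which decays
  whatever the argument of cz.\<close>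

lemma tendsto_translate_factor:
  fixes cz k :: complex
  assumes "cz \<noteq> 0"
  shows "((\<lambda>l::real. 1 - exp (- 4 * cz * (of_real l / cz)) * k) \<longlongrightarrow> 1) at_top"
proof -
  have "((\<lambda>l::real. exp (- 4 * l)) \<longlongrightarrow> 0) at_top"
    by real_asymp
  then have "((\<lambda>l::real. complex_of_real (exp (- 4 * l))) \<longlongrightarrow> of_real 0) at_top"
    by (rule tendsto_of_real)
  then have "((\<lambda>l::real. 1 - complex_of_real (exp (- 4 * l)) * k) \<longlongrightarrow> 1 - of_real 0 * k) at_top"
    by (intro tendsto_diff tendsto_mult tendsto_const)
  moreover have "exp (- 4 * cz * (of_real l / cz)) = complex_of_real (exp (- 4 * l))" for l
  proof -
    have "- 4 * cz * (of_real l / cz) = complex_of_real (- 4 * l)" using assms by simp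
    then show ?thesis by (simp only: exp_of_real)
  qed
  ultimately show ?thesis by simp
qed

text \<open>The closed form is available only where both factors are nonzero; as they tend to 1,
  this holds eventually, and continuity of \<phi> at (1, 1) gives the limit.\<close>

lemma tendsto_along_translates:
  fixes f :: "complex \<Rightarrow> complex" and \<phi> :: "complex \<Rightarrow> complex \<Rightarrow> complex"
  assumes "cz \<noteq> 0"
    and f: "\<And>L. 1 - exp (- 4 * cz * L) * k1 \<noteq> 0 \<Longrightarrow> 1 - exp (- 4 * cz * L) * k2 \<noteq> 0 \<Longrightarrow>
      f L = \<phi> (1 - exp (- 4 * cz * L) * k1) (1 - exp (- 4 * cz * L) * k2)"
    and cont: "isCont (\<lambda>p. \<phi> (fst p) (snd p)) (1, 1)" and a: "\<phi> 1 1 = a"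
  shows "((\<lambda>l::real. f (of_real l / cz)) \<longlongrightarrow> a) at_top"
proof -
  let ?m = "\<lambda>k (l::real). 1 - exp (- 4 * cz * (of_real l / cz)) * k"
  note t = tendsto_translate_factor[OF assms(1)]
  have "((\<lambda>l. \<phi> (?m k1 l) (?m k2 l)) \<longlongrightarrow> \<phi> 1 1) at_top"
    using isCont_tendsto_compose[OF cont tendsto_Pair[OF t[of k1] t[of k2]]] by simp
  moreover have "\<forall>\<^sub>F l in at_top. \<phi> (?m k1 l) (?m k2 l) = f (of_real l / cz)"
    using tendsto_imp_eventually_ne[OF t[of k1] one_neq_zero] tendsto_imp_eventually_ne[OF t[of k2] one_neq_zero]
    by eventually_elim (simp add: f)
  ultimately show ?thesis
    using a by (auto intro: Lim_transform_eventually)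
qed

theorem mainTheorem3:
  fixes D :: "complex set" and v h q :: "complex \<Rightarrow> complex"
  assumes "profile_functions D v h q"
  shows
    "(reduced_GC D v h q \<longrightarrow> (\<exists>K. \<forall>\<eta>\<in>D. first_integral v h q \<eta> = K))
   \<and>
     (((\<forall>\<eta>\<in>D. codazzi_eqs v h q \<eta>) \<and> (\<exists>\<eta>\<in>D. deriv q \<eta> \<noteq> 0)) \<longleftrightarrow>
      (\<exists>c. c \<noteq> 0 \<and> (\<forall>\<eta>\<in>D. nonconstant_q_branch c v h q \<eta>)))
   \<and>
     (\<forall>c K. reduced_GC D v h q \<and> c \<noteq> 0 \<and>
        (\<forall>\<eta>\<in>D. nonconstant_q_branch c v h q \<eta> \<and> first_integral v h q \<eta> = K) \<longrightarrow>
        1 \<notin> D \<and> -1 \<notin> D \<and>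
        (\<exists>tinf t0 t1 tX.
           tinf = 0 \<and> t0\<^sup>2 = K / 4 \<and> t1\<^sup>2 = K / 4 \<and> tX = 1 \<and>
           SD_A0 tinf t0 t1 tX = K / 4 \<and> SD_A2 tinf t0 t1 tX = 0 \<and>
           SD_A3 tinf t0 t1 tX = - K\<^sup>2 / 64 \<and> SD_A4 tinf t0 t1 tX = 0 \<and>
           (\<forall>E. open E \<and> E \<subseteq> D \<and> inj_on pvi_var E \<longrightarrow>
              (\<exists>Y V. Y holomorphic_on (pvi_var ` E) \<and> V holomorphic_on (pvi_var ` E) \<and>
                 (\<forall>\<eta>\<in>E. q \<eta> = - (8 / c) * Y (pvi_var \<eta>)) \<and>
                 (\<forall>X\<in>pvi_var ` E.
                    SD_Ia (SD_A0 tinf t0 t1 tX) (SD_A2 tinf t0 t1 tX)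
                      (SD_A3 tinf t0 t1 tX) (SD_A4 tinf t0 t1 tX) Y X) \<and>
                 {X \<in> pvi_var ` E. V X = 0 \<or> V X = 1 \<or> V X = X} sparse_in (pvi_var ` E) \<and>
                 painleve_VI_on {X \<in> pvi_var ` E. V X \<noteq> 0 \<and> V X \<noteq> 1 \<and> V X \<noteq> X} tinf t0 t1 tX V \<and>
                 (\<forall>X\<in>pvi_var ` E. V X \<noteq> 0 \<and> V X \<noteq> 1 \<and> V X \<noteq> X \<longrightarrow>
                    Y X = X * (X - 1) * H_VI tinf t0 t1 tX X (V X) (deriv V X))))))
   \<and>
     (\<forall>\<eta>0 c K V0 V1.
        \<eta>0 \<noteq> 0 \<and> \<eta>0 \<noteq> 1 \<and> \<eta>0 \<noteq> -1 \<and> c \<noteq> 0 \<and> V0 \<noteq> 0 \<and> V0 \<noteq> 1 \<and> V0 \<noteq> pvi_var \<eta>0 \<and>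
        H_VI 0 (csqrt K / 2) (csqrt K / 2) 1 (pvi_var \<eta>0) V0 V1 \<noteq> 0 \<longrightarrow>
        (\<exists>r>0. \<exists>v' h' q' V. HVI_solution (ball \<eta>0 r) c K v' h' q' V \<and>
           V (pvi_var \<eta>0) = V0 \<and> deriv V (pvi_var \<eta>0) = V1))
   \<and>
     (\<forall>B \<eta>0 c1 K1 v1 h1 q1 V1 c2 K2 v2 h2 q2 V2.
        HVI_solution B c1 K1 v1 h1 q1 V1 \<and> HVI_solution B c2 K2 v2 h2 q2 V2 \<and> \<eta>0 \<in> B \<longrightarrow>
        ((\<forall>\<eta>\<in>B. v1 \<eta> = v2 \<eta> \<and> h1 \<eta> = h2 \<eta> \<and> q1 \<eta> = q2 \<eta>) \<longleftrightarrow>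
         (c1 = c2 \<and> K1 = K2 \<and> V1 (pvi_var \<eta>0) = V2 (pvi_var \<eta>0) \<and>
          deriv V1 (pvi_var \<eta>0) = deriv V2 (pvi_var \<eta>0))))
   \<and>
     (\<forall>c \<Omega> g1 g2.
        reduced_GC D v h q \<and> c \<noteq> 0 \<and> (\<forall>\<eta>\<in>D. nonconstant_q_branch c v h q \<eta>) \<and>
        gauge_functions D \<Omega> g1 g2 \<longrightarrow>
        (\<forall>(z, w)\<in>\<Omega>. 1 / gc_H g1 g2 h z w = (1 / c) * ((g1 z)\<^sup>2 - (g2 w)\<^sup>2)) \<and>
        harmonic_on \<Omega> (\<lambda>z w. 1 / gc_H g1 g2 h z w))
   \<and>
     (\<forall>c K cz cu cq.
        c \<noteq> 0 \<and> (\<forall>\<eta>\<in>D. nonconstant_q_branch c v h q \<eta>) \<and> cz \<noteq> 0 \<and> cu \<noteq> 0 \<and> cq \<noteq> 0 \<longrightarrow>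
        (let qh = (\<lambda>x. cz * c / (4 * cq) * q (exp (- 4 * cz * x)));
             vh = (\<lambda>x. cq / cu * deriv qh x)
         in (\<forall>\<eta>\<in>D. first_integral v h q \<eta> = K) \<longleftrightarrow>
            himc_profile {x. exp (- 4 * cz * x) \<in> D} cz cu cq (16 * cz\<^sup>2 * K) 0 vh qh))
   \<and>
     (\<forall>c cz cu cq \<Omega> g1 g2 Z W z w.
        reduced_GC D v h q \<and> c \<noteq> 0 \<and> (\<forall>\<eta>\<in>D. nonconstant_q_branch c v h q \<eta>) \<and>
        cz \<noteq> 0 \<and> cu \<noteq> 0 \<and> cq \<noteq> 0 \<and> gauge_functions D \<Omega> g1 g2 \<and>
        Z holomorphic_on (fst ` \<Omega>) \<and> W holomorphic_on (snd ` \<Omega>) \<and>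
        (\<forall>s\<in>fst ` \<Omega>. g1 s = exp (- 2 * cz * Z s)) \<and>
        (\<forall>s\<in>snd ` \<Omega>. g2 s = exp (2 * cz * W s)) \<and> (z, w) \<in> \<Omega> \<longrightarrow>
        (let qh = (\<lambda>x. cz * c / (4 * cq) * q (exp (- 4 * cz * x)));
             vh = (\<lambda>x. cq / cu * deriv qh x);
             H = gc_H g1 g2 h z w; U = gc_expu g1 g2 v z w;
             Q = gc_Q g1 g2 q z w; R = gc_R g1 g2 q z w;
             ch = (\<lambda>L. 4 * cz * c * exp (- 4 * cz * L));
             HH = (\<lambda>L. himc_H cz (ch L) (Z z + L) (W w - L));
             HU = (\<lambda>L. deriv Z z * deriv W w * himc_expu cz (ch L) cu vh (Z z + L) (W w - L));
             HQ = (\<lambda>L. (deriv Z z)\<^sup>2 * himc_Q cz (ch L) cq 0 qh (Z z + L) (W w - L));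
             HR = (\<lambda>L. (deriv W w)\<^sup>2 * himc_R cz (ch L) cq 0 qh (Z z + L) (W w - L));
             m1 = (\<lambda>L. 1 - exp (- 4 * cz * L) * (g1 z)\<^sup>2);
             m2 = (\<lambda>L. 1 - exp (- 4 * cz * L) * (g2 w)\<^sup>2)
         in (\<forall>L. m1 L \<noteq> 0 \<and> m2 L \<noteq> 0 \<longrightarrow>
               HH L = H * (m1 L * m2 L) \<and> HU L = U / (m1 L * m2 L)\<^sup>2 \<and>
               HQ L = Q / (m1 L)\<^sup>2 \<and> HR L = R / (m2 L)\<^sup>2) \<and>
            ((\<lambda>l::real. HH (of_real l / cz)) \<longlongrightarrow> H) at_top \<and>
            ((\<lambda>l::real. HU (of_real l / cz)) \<longlongrightarrow> U) at_top \<and>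
            ((\<lambda>l::real. HQ (of_real l / cz)) \<longlongrightarrow> Q) at_top \<and>
            ((\<lambda>l::real. HR (of_real l / cz)) \<longlongrightarrow> R) at_top))"
proof (intro conjI)
  show "reduced_GC D v h q \<longrightarrow> (\<exists>K. \<forall>\<eta>\<in>D. first_integral v h q \<eta> = K)"
    using first_integral_const[OF assms] by blast
next
  show "((\<forall>\<eta>\<in>D. codazzi_eqs v h q \<eta>) \<and> (\<exists>\<eta>\<in>D. deriv q \<eta> \<noteq> 0)) \<longleftrightarrow>
      (\<exists>c. c \<noteq> 0 \<and> (\<forall>\<eta>\<in>D. nonconstant_q_branch c v h q \<eta>))"
    by (rule codazzi_branch_iff[OF assms])
next
  show "\<forall>c K. reduced_GC D v h q \<and> c \<noteq> 0 \<and>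
        (\<forall>\<eta>\<in>D. nonconstant_q_branch c v h q \<eta> \<and> first_integral v h q \<eta> = K) \<longrightarrow>
        1 \<notin> D \<and> -1 \<notin> D \<and>
        (\<exists>tinf t0 t1 tX.
           tinf = 0 \<and> t0\<^sup>2 = K / 4 \<and> t1\<^sup>2 = K / 4 \<and> tX = 1 \<and>
           SD_A0 tinf t0 t1 tX = K / 4 \<and> SD_A2 tinf t0 t1 tX = 0 \<and>
           SD_A3 tinf t0 t1 tX = - K\<^sup>2 / 64 \<and> SD_A4 tinf t0 t1 tX = 0 \<and>
           (\<forall>E. open E \<and> E \<subseteq> D \<and> inj_on pvi_var E \<longrightarrow>
              (\<exists>Y V. Y holomorphic_on (pvi_var ` E) \<and> V holomorphic_on (pvi_var ` E) \<and>
                 (\<forall>\<eta>\<in>E. q \<eta> = - (8 / c) * Y (pvi_var \<eta>)) \<and>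
                 (\<forall>X\<in>pvi_var ` E.
                    SD_Ia (SD_A0 tinf t0 t1 tX) (SD_A2 tinf t0 t1 tX)
                      (SD_A3 tinf t0 t1 tX) (SD_A4 tinf t0 t1 tX) Y X) \<and>
                 {X \<in> pvi_var ` E. V X = 0 \<or> V X = 1 \<or> V X = X} sparse_in (pvi_var ` E) \<and>
                 painleve_VI_on {X \<in> pvi_var ` E. V X \<noteq> 0 \<and> V X \<noteq> 1 \<and> V X \<noteq> X} tinf t0 t1 tX V \<and>
                 (\<forall>X\<in>pvi_var ` E. V X \<noteq> 0 \<and> V X \<noteq> 1 \<and> V X \<noteq> X \<longrightarrow>
                    Y X = X * (X - 1) * H_VI tinf t0 t1 tX X (V X) (deriv V X)))))"
  proof (intro allI impI, elim conjE)
    fix c K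
    assume gc: "reduced_GC D v h q" and c: "c \<noteq> 0"
      and br: "\<forall>\<eta>\<in>D. nonconstant_q_branch c v h q \<eta> \<and> first_integral v h q \<eta> = K"
    let ?t = "csqrt K / 2"
    interpret hvi_branch D v h q c
      using profile_hvi_branch[OF assms c] br by blast
    \<comment> \<open>The differences of squares in A_2 and A_4 vanish, and 4 A_3 = (0 - K/4) (K/4 -
      0).\<close>
    have A: "SD_A0 0 ?t ?t 1 = K / 4" "SD_A2 0 ?t ?t 1 = 0" "SD_A3 0 ?t ?t 1 = - K\<^sup>2 / 64" "SD_A4 0 ?t ?t 1 = 0"
      by (simp_all add: SD_A0_def SD_A2_def SD_A3_def SD_A4_def csqrt_half_squared power2_eq_square[of K])
    show "1 \<notin> D \<and> -1 \<notin> D \<and>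
        (\<exists>tinf t0 t1 tX.
           tinf = 0 \<and> t0\<^sup>2 = K / 4 \<and> t1\<^sup>2 = K / 4 \<and> tX = 1 \<and>
           SD_A0 tinf t0 t1 tX = K / 4 \<and> SD_A2 tinf t0 t1 tX = 0 \<and>
           SD_A3 tinf t0 t1 tX = - K\<^sup>2 / 64 \<and> SD_A4 tinf t0 t1 tX = 0 \<and>
           (\<forall>E. open E \<and> E \<subseteq> D \<and> inj_on pvi_var E \<longrightarrow>
              (\<exists>Y V. Y holomorphic_on (pvi_var ` E) \<and> V holomorphic_on (pvi_var ` E) \<and>
                 (\<forall>\<eta>\<in>E. q \<eta> = - (8 / c) * Y (pvi_var \<eta>)) \<and>
                 (\<forall>X\<in>pvi_var ` E.
                    SD_Ia (SD_A0 tinf t0 t1 tX) (SD_A2 tinf t0 t1 tX)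
                      (SD_A3 tinf t0 t1 tX) (SD_A4 tinf t0 t1 tX) Y X) \<and>
                 {X \<in> pvi_var ` E. V X = 0 \<or> V X = 1 \<or> V X = X} sparse_in (pvi_var ` E) \<and>
                 painleve_VI_on {X \<in> pvi_var ` E. V X \<noteq> 0 \<and> V X \<noteq> 1 \<and> V X \<noteq> X} tinf t0 t1 tX V \<and>
                 (\<forall>X\<in>pvi_var ` E. V X \<noteq> 0 \<and> V X \<noteq> 1 \<and> V X \<noteq> X \<longrightarrow>
                    Y X = X * (X - 1) * H_VI tinf t0 t1 tX X (V X) (deriv V X)))))"
      by (intro conjI pm1_notin, rule exI[of _ 0], rule exI[of _ ?t], rule exI[of _ ?t], rule exI[of _ 1],
          unfold A, intro conjI refl csqrt_half_squared allI impI, elim conjE,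
          rule branch_is_painleve[OF assms gc c br _ _ _ csqrt_half_squared])
  qed
next
  show "\<forall>\<eta>0 c K V0 V1.
        \<eta>0 \<noteq> 0 \<and> \<eta>0 \<noteq> 1 \<and> \<eta>0 \<noteq> -1 \<and> c \<noteq> 0 \<and> V0 \<noteq> 0 \<and> V0 \<noteq> 1 \<and> V0 \<noteq> pvi_var \<eta>0 \<and>
        H_VI 0 (csqrt K / 2) (csqrt K / 2) 1 (pvi_var \<eta>0) V0 V1 \<noteq> 0 \<longrightarrow>
        (\<exists>r>0. \<exists>v' h' q' V. HVI_solution (ball \<eta>0 r) c K v' h' q' V \<and>
           V (pvi_var \<eta>0) = V0 \<and> deriv V (pvi_var \<eta>0) = V1)"
    using HVI_solution_exists by blast
next
  show "\<forall>B \<eta>0 c1 K1 v1 h1 q1 V1 c2 K2 v2 h2 q2 V2.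
        HVI_solution B c1 K1 v1 h1 q1 V1 \<and> HVI_solution B c2 K2 v2 h2 q2 V2 \<and> \<eta>0 \<in> B \<longrightarrow>
        ((\<forall>\<eta>\<in>B. v1 \<eta> = v2 \<eta> \<and> h1 \<eta> = h2 \<eta> \<and> q1 \<eta> = q2 \<eta>) \<longleftrightarrow>
         (c1 = c2 \<and> K1 = K2 \<and> V1 (pvi_var \<eta>0) = V2 (pvi_var \<eta>0) \<and>
          deriv V1 (pvi_var \<eta>0) = deriv V2 (pvi_var \<eta>0)))"
    by (intro allI impI, elim conjE) (rule HVI_solution_parameters)
next
  show "\<forall>c \<Omega> g1 g2.
        reduced_GC D v h q \<and> c \<noteq> 0 \<and> (\<forall>\<eta>\<in>D. nonconstant_q_branch c v h q \<eta>) \<and>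
        gauge_functions D \<Omega> g1 g2 \<longrightarrow>
        (\<forall>(z, w)\<in>\<Omega>. 1 / gc_H g1 g2 h z w = (1 / c) * ((g1 z)\<^sup>2 - (g2 w)\<^sup>2)) \<and>
        harmonic_on \<Omega> (\<lambda>z w. 1 / gc_H g1 g2 h z w)"
    by (intro allI impI, elim conjE) (rule inverse_H_harmonic[OF profile_hvi_branch[OF assms]])
next
  show "\<forall>c K cz cu cq.
        c \<noteq> 0 \<and> (\<forall>\<eta>\<in>D. nonconstant_q_branch c v h q \<eta>) \<and> cz \<noteq> 0 \<and> cu \<noteq> 0 \<and> cq \<noteq> 0 \<longrightarrow>
        (let qh = (\<lambda>x. cz * c / (4 * cq) * q (exp (- 4 * cz * x)));
             vh = (\<lambda>x. cq / cu * deriv qh x)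
         in (\<forall>\<eta>\<in>D. first_integral v h q \<eta> = K) \<longleftrightarrow>
            himc_profile {x. exp (- 4 * cz * x) \<in> D} cz cu cq (16 * cz\<^sup>2 * K) 0 vh qh)"
    unfolding Let_def
    by (intro allI impI, elim conjE) (rule hvi_branch.first_integral_iff_himc[OF profile_hvi_branch[OF assms]])
next
  show "\<forall>c cz cu cq \<Omega> g1 g2 Z W z w.
        reduced_GC D v h q \<and> c \<noteq> 0 \<and> (\<forall>\<eta>\<in>D. nonconstant_q_branch c v h q \<eta>) \<and>
        cz \<noteq> 0 \<and> cu \<noteq> 0 \<and> cq \<noteq> 0 \<and> gauge_functions D \<Omega> g1 g2 \<and>
        Z holomorphic_on (fst ` \<Omega>) \<and> W holomorphic_on (snd ` \<Omega>) \<and>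
        (\<forall>s\<in>fst ` \<Omega>. g1 s = exp (- 2 * cz * Z s)) \<and>
        (\<forall>s\<in>snd ` \<Omega>. g2 s = exp (2 * cz * W s)) \<and> (z, w) \<in> \<Omega> \<longrightarrow>
        (let qh = (\<lambda>x. cz * c / (4 * cq) * q (exp (- 4 * cz * x)));
             vh = (\<lambda>x. cq / cu * deriv qh x);
             H = gc_H g1 g2 h z w; U = gc_expu g1 g2 v z w;
             Q = gc_Q g1 g2 q z w; R = gc_R g1 g2 q z w;
             ch = (\<lambda>L. 4 * cz * c * exp (- 4 * cz * L));
             HH = (\<lambda>L. himc_H cz (ch L) (Z z + L) (W w - L));
             HU = (\<lambda>L. deriv Z z * deriv W w * himc_expu cz (ch L) cu vh (Z z + L) (W w - L));
             HQ = (\<lambda>L. (deriv Z z)\<^sup>2 * himc_Q cz (ch L) cq 0 qh (Z z + L) (W w - L));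
             HR = (\<lambda>L. (deriv W w)\<^sup>2 * himc_R cz (ch L) cq 0 qh (Z z + L) (W w - L));
             m1 = (\<lambda>L. 1 - exp (- 4 * cz * L) * (g1 z)\<^sup>2);
             m2 = (\<lambda>L. 1 - exp (- 4 * cz * L) * (g2 w)\<^sup>2)
         in (\<forall>L. m1 L \<noteq> 0 \<and> m2 L \<noteq> 0 \<longrightarrow>
               HH L = H * (m1 L * m2 L) \<and> HU L = U / (m1 L * m2 L)\<^sup>2 \<and>
               HQ L = Q / (m1 L)\<^sup>2 \<and> HR L = R / (m2 L)\<^sup>2) \<and>
            ((\<lambda>l::real. HH (of_real l / cz)) \<longlongrightarrow> H) at_top \<and>
            ((\<lambda>l::real. HU (of_real l / cz)) \<longlongrightarrow> U) at_top \<and>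
            ((\<lambda>l::real. HQ (of_real l / cz)) \<longlongrightarrow> Q) at_top \<and>
            ((\<lambda>l::real. HR (of_real l / cz)) \<longlongrightarrow> R) at_top)"
  proof (intro allI impI, elim conjE)
    fix c cz cu cq :: complex and \<Omega> g1 g2 Z W z w
    assume c: "c \<noteq> 0" and br: "\<forall>\<eta>\<in>D. nonconstant_q_branch c v h q \<eta>"
      and nz: "cz \<noteq> 0" "cu \<noteq> 0" "cq \<noteq> 0" and "gauge_functions D \<Omega> g1 g2"
      "Z holomorphic_on (fst ` \<Omega>)" "W holomorphic_on (snd ` \<Omega>)"
      "\<forall>s\<in>fst ` \<Omega>. g1 s = exp (- 2 * cz * Z s)"
      "\<forall>s\<in>snd ` \<Omega>. g2 s = exp (2 * cz * W s)" "(z, w) \<in> \<Omega>"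
    note T = hvi_branch.himc_translates[OF profile_hvi_branch[OF assms c br] this(3-)]
    let ?qh = "\<lambda>x. cz * c / (4 * cq) * q (exp (- 4 * cz * x))" and ?ch = "\<lambda>L. 4 * cz * c * exp (- 4 * cz * L)"
    let ?vh = "\<lambda>x. cq / cu * deriv ?qh x"
    \<comment> \<open>With these k1 and k2 the arguments of \<phi> are \<open>m1\<close> and
      \<open>m2\<close>; for each field \<phi> is the corresponding factor formula of
      \<open>himc_translates\<close>.\<close>
    note lim = tendsto_along_translates[OF nz(1), where ?k1.0 = "(g1 z)\<^sup>2" and ?k2.0 = "(g2 w)\<^sup>2"]
    have H: "((\<lambda>l::real. himc_H cz (?ch (of_real l / cz)) (Z z + of_real l / cz) (W w - of_real l / cz))
        \<longlongrightarrow> gc_H g1 g2 h z w) at_top"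
      by (rule lim[where f = "\<lambda>L. himc_H cz (?ch L) (Z z + L) (W w - L)" and
            \<phi> = "\<lambda>p r. gc_H g1 g2 h z w * (p * r)"])
         (rule T(1), assumption, assumption, (auto intro!: continuous_intros)[2])
    have U: "((\<lambda>l::real. deriv Z z * deriv W w *
          himc_expu cz (?ch (of_real l / cz)) cu ?vh (Z z + of_real l / cz) (W w - of_real l / cz))
        \<longlongrightarrow> gc_expu g1 g2 v z w) at_top"
      by (rule lim[where f = "\<lambda>L. deriv Z z * deriv W w * himc_expu cz (?ch L) cu ?vh (Z z + L) (W w - L)" and
            \<phi> = "\<lambda>p r. gc_expu g1 g2 v z w / (p * r)\<^sup>2"])
         (rule T(2), assumption, assumption, (auto intro!: continuous_intros)[2])
    have Q: "((\<lambda>l::real. (deriv Z z)\<^sup>2 *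
          himc_Q cz (?ch (of_real l / cz)) cq 0 ?qh (Z z + of_real l / cz) (W w - of_real l / cz))
        \<longlongrightarrow> gc_Q g1 g2 q z w) at_top"
      by (rule lim[where f = "\<lambda>L. (deriv Z z)\<^sup>2 * himc_Q cz (?ch L) cq 0 ?qh (Z z + L) (W w - L)" and
            \<phi> = "\<lambda>p r. gc_Q g1 g2 q z w / p\<^sup>2"])
         (rule T(3), assumption, assumption, (auto intro!: continuous_intros)[2])
    have R: "((\<lambda>l::real. (deriv W w)\<^sup>2 *
          himc_R cz (?ch (of_real l / cz)) cq 0 ?qh (Z z + of_real l / cz) (W w - of_real l / cz))
        \<longlongrightarrow> gc_R g1 g2 q z w) at_top"
      by (rule lim[where f = "\<lambda>L. (deriv W w)\<^sup>2 * himc_R cz (?ch L) cq 0 ?qh (Z z + L) (W w - L)" and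
            \<phi> = "\<lambda>p r. gc_R g1 g2 q z w / r\<^sup>2"])
         (rule T(4), assumption, assumption, (auto intro!: continuous_intros)[2])
    show "(let qh = (\<lambda>x. cz * c / (4 * cq) * q (exp (- 4 * cz * x)));
             vh = (\<lambda>x. cq / cu * deriv qh x);
             H = gc_H g1 g2 h z w; U = gc_expu g1 g2 v z w;
             Q = gc_Q g1 g2 q z w; R = gc_R g1 g2 q z w;
             ch = (\<lambda>L. 4 * cz * c * exp (- 4 * cz * L));
             HH = (\<lambda>L. himc_H cz (ch L) (Z z + L) (W w - L));
             HU = (\<lambda>L. deriv Z z * deriv W w * himc_expu cz (ch L) cu vh (Z z + L) (W w - L));
             HQ = (\<lambda>L. (deriv Z z)\<^sup>2 * himc_Q cz (ch L) cq 0 qh (Z z + L) (W w - L));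
             HR = (\<lambda>L. (deriv W w)\<^sup>2 * himc_R cz (ch L) cq 0 qh (Z z + L) (W w - L));
             m1 = (\<lambda>L. 1 - exp (- 4 * cz * L) * (g1 z)\<^sup>2);
             m2 = (\<lambda>L. 1 - exp (- 4 * cz * L) * (g2 w)\<^sup>2)
         in (\<forall>L. m1 L \<noteq> 0 \<and> m2 L \<noteq> 0 \<longrightarrow>
               HH L = H * (m1 L * m2 L) \<and> HU L = U / (m1 L * m2 L)\<^sup>2 \<and>
               HQ L = Q / (m1 L)\<^sup>2 \<and> HR L = R / (m2 L)\<^sup>2) \<and>
            ((\<lambda>l::real. HH (of_real l / cz)) \<longlongrightarrow> H) at_top \<and>
            ((\<lambda>l::real. HU (of_real l / cz)) \<longlongrightarrow> U) at_top \<and>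
            ((\<lambda>l::real. HQ (of_real l / cz)) \<longlongrightarrow> Q) at_top \<and>
            ((\<lambda>l::real. HR (of_real l / cz)) \<longlongrightarrow> R) at_top)"
      unfolding Let_def by (intro conjI allI impI H U Q R T; elim conjE)
  qed
qed

end
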